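(* Let $m,p,q\ge1$ be integers and $\sigma_1,\sigma_2,\sigma_3\in\{\pm1\}$ with $(m,\sigma_1)\ne(1,1)$, and suppose that $(p,\sigma_2)\neq(1,1)$ or $(q,\sigma_3)\neq(1,1)$. If the weight $w=m+p+q$ and the integer $\frac{1-\sigma_1\sigma_2\sigma_3}{2}$ have the same parity, then the triple $t$-value $t(m,p,q;\sigma_1,\sigma_2,\sigma_3)$ and the triple $\tilde t$-value $\tilde t(m,p,q;\sigma_1,\sigma_2,\sigma_3)$ are reducible to combinations of (i.e. are polynomials with rational coefficients in) (alternating) zeta values, the Dirichlet beta values, (alternating) double zeta values and (alternating) double $t$-values.
   Context: For signs $\sigma_i\in\{\pm1\}$ and positive integers $s_i$ with $(s_1,\sigma_1)\ne(1,1)$: $\zeta(s_1,\ldots,s_k;\sigma_1,\ldots,\sigma_k)=\sum_{n_1>\cdots>n_k\ge1}\prod_{i}\frac{\sigma_i^{n_i}}{n_i^{s_i}}$, $t(s_1,\ldots,s_k;\sigma_1,\ldots,\sigma_k)=\sum_{n_1>\cdots>n_k\ge1}\prod_i\frac{\sigma_i^{n_i}}{(2n_i-1)^{s_i}}$, and $\tilde t(s_1,\ldots,s_k;\sigma_1,\ldots,\sigma_k)=2^{s_1+\cdots+s_k}t(s_1,\ldots,s_k;\sigma_1,\ldots,\sigma_k)$, sums over $n_1$ being outermost (limits of partial sums). Zeta values are the $\zeta(s;\sigma)$ (in particular $\zeta(1;-1)=-\ln2$); double zeta values and double $t$-values are the case $k=2$; the Dirichlet beta values are $\beta(s)=\sum_{n\ge1}\frac{(-1)^{n-1}}{(2n-1)^s}$,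 $s\ge1$ (in particular $\beta(1)=\pi/4$). *)

theory Defs
  imports Complex_Main "HOL-Library.Multiset"
begin

text \<open>
  The arguments \<open>s\<^sub>1, \<dots>, s\<^sub>k; \<sigma>\<^sub>1, \<dots>, \<sigma>\<^sub>k\<close> are encoded as the list
  \<open>[(s\<^sub>1, \<sigma>\<^sub>1), \<dots>, (s\<^sub>k, \<sigma>\<^sub>k)]\<close>. The functions with suffix \<open>partial\<close> are the sums over
  \<open>N \<ge> n\<^sub>1 > \<dots> > n\<^sub>k \<ge> 1\<close>; the values are their limits for \<open>N \<rightarrow> \<infinity>\<close>, which exist
  when \<open>(s\<^sub>1, \<sigma>\<^sub>1) \<noteq> (1, 1)\<close>.
\<close>

type_synonym signed_index = "(nat \<times> int) list"

fun zeta_partial :: "signed_index \<Rightarrow> nat \<Rightarrow> real" where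
  "zeta_partial [] N = 1"
| "zeta_partial ((s, \<sigma>) # xs) N =
     (\<Sum>n = 1..N. of_int \<sigma> ^ n / real n ^ s * zeta_partial xs (n - 1))"

fun t_partial :: "signed_index \<Rightarrow> nat \<Rightarrow> real" where
  "t_partial [] N = 1"
| "t_partial ((s, \<sigma>) # xs) N =
     (\<Sum>n = 1..N. of_int \<sigma> ^ n / (2 * real n - 1) ^ s * t_partial xs (n - 1))"

definition zeta_val :: "signed_index \<Rightarrow> real" where
  "zeta_val xs = lim (zeta_partial xs)"

definition t_val :: "signed_index \<Rightarrow> real" where
  "t_val xs = lim (t_partial xs)"

definition t_tilde_val :: "signed_index \<Rightarrow> real" where
  "t_tilde_val xs = 2 ^ sum_list (map fst xs) * t_val xs"

definition beta_val :: "nat \<Rightarrow> real" where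
  "beta_val s = lim (\<lambda>N. \<Sum>n = 1..N. (-1) ^ (n - 1) / (2 * real n - 1) ^ s)"

definition admissible :: "signed_index \<Rightarrow> bool" where
  "admissible xs \<longleftrightarrow> xs \<noteq> [] \<and> (\<forall>(s, \<sigma>) \<in> set xs. s \<ge> 1 \<and> \<sigma> \<in> {1, -1}) \<and> hd xs \<noteq> (1, 1)"

definition zeta_values :: "nat \<Rightarrow> real set" where
  "zeta_values k = {zeta_val xs | xs. admissible xs \<and> length xs = k}"

definition t_values :: "nat \<Rightarrow> real set" where
  "t_values k = {t_val xs | xs. admissible xs \<and> length xs = k}"

definition beta_values :: "real set" where
  "beta_values = {beta_val s | s. s \<ge> 1}"

text \<open>
  The values at points of \<open>G\<close> of polynomials with rational coefficients: a finite multiset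
  of elements of \<open>G\<close> represents a monomial.
\<close>

definition rat_polynomials_in :: "real set \<Rightarrow> real set" where
  "rat_polynomials_in G =
     {\<Sum>M\<in>F. of_rat (c M) * prod_mset M | (F :: real multiset set) (c :: real multiset \<Rightarrow> rat).
        finite F \<and> (\<forall>M\<in>F. set_mset M \<subseteq> G)}"

end

theory Submission
  imports Defs "HOL-Analysis.Analysis" "HOL-Real_Asymp.Real_Asymp"
begin

text \<open>
  Extend \<open>X\<^sub>i(n) = \<sigma>\<^sub>i\<^sup>n / (2n - 1)\<^bsup>s\<^sub>i\<^esup>\<close> to all integers \<open>n\<close>; then \<open>X\<^sub>i(1 - n) = \<epsilon>\<^sub>i X\<^sub>i(n)\<close> for a sign
  \<open>\<epsilon>\<^sub>i\<close>, and the parity hypothesis says precisely that \<open>\<epsilon>\<^sub>1 \<epsilon>\<^sub>2 \<epsilon>\<^sub>3 = 1\<close>. The sum of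
  \<open>X\<^sub>1(n\<^sub>1) X\<^sub>2(n\<^sub>2) X\<^sub>3(n\<^sub>3)\<close> over all integers \<open>n\<^sub>1 > n\<^sub>2 > n\<^sub>3\<close> is evaluated in two ways. Splitting
  it according to the signs of the \<open>n\<^sub>i\<close>, and using the stuffle relations to reverse
  \<open>t(s\<^sub>3, s\<^sub>2, s\<^sub>1)\<close>, gives \<open>2 t(s\<^sub>1, s\<^sub>2, s\<^sub>3)\<close> plus products and values of lower depth. Writing
  \<open>n\<^sub>1 = n + k\<close>, \<open>n\<^sub>2 = n\<close>, \<open>n\<^sub>3 = n - l\<close> and expanding in partial fractions with respect to \<open>n\<close>
  gives alternating double zeta values in \<open>k\<close> and \<open>l\<close> times sums over all odd integers, which
  are multiples of single \<open>t\<close>-values. If \<open>(s\<^sub>3, \<sigma>\<^sub>3) = (1, 1)\<close>, the sum over \<open>n\<^sub>3\<close> is regularised by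
  adding a divergent constant.
\<close>

subsection \<open>Rational polynomials in a set of reals\<close>

text \<open>The series involved may converge only conditionally, so the order of summation (over
  \<open>n\<close>, then \<open>l\<close>, then \<open>k\<close>) is part of the construction, and
  each exchange has to be earned. The estimates rest on two facts: a block of admissible terms
  beyond \<open>i\<close> is of order \<open>1 / i\<close>, because of either absolute decay or
  alternation, and a sum of non-admissible terms is bounded crudely by a square root. Together they
  leave majorants of order \<open>n\<close> to the power \<open>-3/2\<close>. The poles
  \<open>-2k\<close>, \<open>0\<close>, \<open>2l\<close> are even while the points
  \<open>2n - 1\<close> are odd. No pole is ever hit, and the coefficients are powers of even
  numbers, which is why zeta values rather than t-values arise from \<open>k\<close> and
  \<open>l\<close>. The region where all variables are nonpositive contributes the reversed triple
  sum times \<open>\<epsilon>1 * \<epsilon>2 * \<epsilon>3\<close>. In depth three, reversal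
  preserves the sign modulo products and lower depth, so this copy adds to the positive one exactly
  when that product is 1. If the third index is \<open>(1, 1)\<close>, its partial sums grow, and
  only admissibility of the second index controls the inner double sums; if the second is
  \<open>(1, 1)\<close>, the tails of the third provide the decay.\<close>

lemma rat_polynomials_in_base:
  assumes "x \<in> G" shows "x \<in> rat_polynomials_in G"
  unfolding rat_polynomials_in_def using assms
  by (intro CollectI exI[of _ "{{#x#}}"] exI[of _ "\<lambda>_. 1"]) auto

lemma rat_polynomials_in_rat: "of_rat r \<in> rat_polynomials_in G"
  unfolding rat_polynomials_in_def
  by (intro CollectI exI[of _ "{{#}}"] exI[of _ "\<lambda>_. r"]) auto

lemma rat_polynomials_in_add:
  assumes "x \<in> rat_polynomials_in G" "y \<in> rat_polynomials_in G"
  shows "x + y \<in> rat_polynomials_in G"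
proof -
  obtain F c where x: "x = (\<Sum>M\<in>F. of_rat (c M) * prod_mset M)" "finite F" "\<forall>M\<in>F. set_mset M \<subseteq> G"
    using assms(1) unfolding rat_polynomials_in_def by blast
  obtain F' c' where y: "y = (\<Sum>M\<in>F'. of_rat (c' M) * prod_mset M)" "finite F'" "\<forall>M\<in>F'. set_mset M \<subseteq> G"
    using assms(2) unfolding rat_polynomials_in_def by blast
  define d where "d M = (if M \<in> F then c M else 0) + (if M \<in> F' then c' M else 0)" for M
  have "(\<Sum>M\<in>F \<union> F'. of_rat (d M) * prod_mset M) =
        (\<Sum>M\<in>F \<union> F'. if M \<in> F then of_rat (c M) * prod_mset M else 0) +
        (\<Sum>M\<in>F \<union> F'. if M \<in> F' then of_rat (c' M) * prod_mset M else 0)"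
    unfolding sum.distrib[symmetric] by (intro sum.cong refl) (auto simp: d_def of_rat_add algebra_simps)
  also have "(\<Sum>M\<in>F \<union> F'. if M \<in> F then of_rat (c M) * prod_mset M else 0) = x"
    using x y by (subst sum.inter_filter[symmetric]) (auto intro!: sum.cong)
  also have "(\<Sum>M\<in>F \<union> F'. if M \<in> F' then of_rat (c' M) * prod_mset M else 0) = y"
    using x y by (subst sum.inter_filter[symmetric]) (auto intro!: sum.cong)
  finally have "x + y = (\<Sum>M\<in>F \<union> F'. of_rat (d M) * prod_mset M)" ..
  then show ?thesis unfolding rat_polynomials_in_def using x y
    by (intro CollectI exI[of _ "F \<union> F'"] exI[of _ d]) auto
qed

lemma rat_polynomials_in_sum:
  "(\<And>i. i \<in> I \<Longrightarrow> f i \<in> rat_polynomials_in G) \<Longrightarrow> sum f I \<in> rat_polynomials_in G"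
  using rat_polynomials_in_rat[of 0 G]
  by (induction I rule: infinite_finite_induct) (auto intro: rat_polynomials_in_add)

lemma rat_polynomials_in_mult:
  assumes "x \<in> rat_polynomials_in G" "y \<in> rat_polynomials_in G"
  shows "x * y \<in> rat_polynomials_in G"
proof -
  obtain F c where x: "x = (\<Sum>M\<in>F. of_rat (c M) * prod_mset M)" "finite F" "\<forall>M\<in>F. set_mset M \<subseteq> G"
    using assms(1) unfolding rat_polynomials_in_def by blast
  obtain F' c' where y: "y = (\<Sum>M\<in>F'. of_rat (c' M) * prod_mset M)" "finite F'" "\<forall>M\<in>F'. set_mset M \<subseteq> G"
    using assms(2) unfolding rat_polynomials_in_def by blast
  \<comment> \<open>Closure under finite sums reduces the claim to single monomials, so coinciding
    products \<open>M + M'\<close> need no collecting of coefficients.\<close>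
  have "of_rat (c M) * prod_mset M * (of_rat (c' M') * prod_mset M') \<in> rat_polynomials_in G"
    if "M \<in> F" "M' \<in> F'" for M M'
    unfolding rat_polynomials_in_def using that x y
    by (intro CollectI exI[of _ "{M + M'}"] exI[of _ "\<lambda>_. c M * c' M'"]) (auto simp: of_rat_mult)
  then show ?thesis unfolding x(1) y(1) sum_product
    by (intro rat_polynomials_in_sum) auto
qed

lemma rat_polynomials_in_Rats: "x \<in> \<rat> \<Longrightarrow> x \<in> rat_polynomials_in G"
  using rat_polynomials_in_rat by (auto elim!: Rats_cases)

lemma rat_polynomials_in_minus:
  assumes "x \<in> rat_polynomials_in G" shows "- x \<in> rat_polynomials_in G"
  using rat_polynomials_in_mult[OF rat_polynomials_in_Rats[of "-1"] assms] by simp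

lemma rat_polynomials_in_diff:
  assumes "x \<in> rat_polynomials_in G" "y \<in> rat_polynomials_in G"
  shows "x - y \<in> rat_polynomials_in G"
  using rat_polynomials_in_add[OF assms(1) rat_polynomials_in_minus[OF assms(2)]] by simp

lemmas rat_polynomials_in_intros =
  rat_polynomials_in_add rat_polynomials_in_mult rat_polynomials_in_diff rat_polynomials_in_minus
  rat_polynomials_in_Rats

subsection \<open>Limits of nested sums\<close>

text \<open>Dominated convergence for series. Summability is exported together with the limit
  because \<open>suminf\<close> alone does not guarantee it.\<close>

lemma tannery_sequentially:
  fixes a :: "nat \<Rightarrow> nat \<Rightarrow> real"
  assumes "\<And>k. (\<lambda>n. a k n) \<longlonglongrightarrow> b k" "\<And>k n. \<bar>a k n\<bar> \<le> M k" "summable M"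
  shows "\<And>n. summable (\<lambda>k. a k n)" "summable b" "(\<lambda>n. \<Sum>k. a k n) \<longlonglongrightarrow> suminf b"
proof -
  show "summable (\<lambda>k. a k n)" for n
    using assms by (intro summable_comparison_test'[OF assms(3)]) auto
  have *: "eventually (\<lambda>(k,n). norm (a k n) \<le> M k) (at_top \<times>\<^sub>F sequentially)"
    by (intro always_eventually) (use assms(2) in auto)
  have "\<bar>b k\<bar> \<le> M k" for k
    by (rule tendsto_upperbound[OF tendsto_rabs[OF assms(1)]]) (auto simp: assms(2))
  then show "summable b" by (intro summable_comparison_test'[OF assms(3)]) auto
  show "(\<lambda>n. \<Sum>k. a k n) \<longlonglongrightarrow> suminf b"
    using tannerys_theorem[OF assms(1) * assms(3)] by simp
qed

lemma sum_1_eq_lessThan: "(\<Sum>n = 1..N. f n) = (\<Sum>n<N. f (Suc n))" for N :: nat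
  using sum.shift_bounds_Suc_ivl[of f 0 N] by (simp add: atLeast0LessThan atLeastLessThanSuc_atLeastAtMost)

text \<open>Cauchy's criterion with a majorant for block sums instead of absolute values, so that it
  also covers alternating series.\<close>

lemma convergent_if_interval_sums_small:
  fixes Z :: "nat \<Rightarrow> real"
  assumes "\<And>i j. i \<le> j \<Longrightarrow> \<bar>\<Sum>n\<in>{i<..j}. Z n\<bar> \<le> D i" "D \<longlonglongrightarrow> 0"
  shows "convergent (\<lambda>N. \<Sum>n = 1..N. Z n)"
proof -
  have split: "(\<Sum>n = 1..j. Z n) - (\<Sum>n = 1..i. Z n) = (\<Sum>n\<in>{i<..j}. Z n)" if "i \<le> j" for i j
  proof -
    have "{1..j} = {1..i} \<union> {i<..j}" "{1..i} \<inter> {i<..j} = {}" using that by auto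
    then show ?thesis by (simp add: sum.union_disjoint)
  qed
  have "Cauchy (\<lambda>N. \<Sum>n = 1..N. Z n)"
  proof (rule CauchyI')
    fix e :: real assume "e > 0"
    then obtain i where i: "\<And>n. n \<ge> i \<Longrightarrow> \<bar>D n\<bar> < e"
      using LIMSEQ_D[OF assms(2), of e] by auto
    show "\<exists>M. \<forall>m\<ge>M. \<forall>n>m. dist (\<Sum>n = 1..m. Z n) (\<Sum>n = 1..n. Z n) < e"
    proof (intro exI[of _ i] allI impI)
      fix m n :: nat assume "m \<ge> i" "n > m"
      have "dist (\<Sum>n = 1..m. Z n) (\<Sum>n = 1..n. Z n) = \<bar>\<Sum>n\<in>{m<..n}. Z n\<bar>"
        using split[of m n] \<open>n > m\<close> by (simp add: dist_real_def abs_minus_commute)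
      also have "\<dots> \<le> D m" using assms(1) \<open>n > m\<close> by simp
      also have "\<dots> < e" using i[OF \<open>m \<ge> i\<close>] by auto
      finally show "dist (\<Sum>n = 1..m. Z n) (\<Sum>n = 1..n. Z n) < e" .
    qed
  qed
  then show ?thesis by (simp add: Cauchy_convergent_iff)
qed

lemma sum_nested_swap:
  fixes Z Y :: "nat \<Rightarrow> real"
  shows "(\<Sum>n = 1..N. Z n * (\<Sum>k = 1..n - 1. Y k)) = (\<Sum>k = 1..N. Y k * (\<Sum>n\<in>{k<..N}. Z n))"
proof -
  have "(\<Sum>n = 1..N. Z n * (\<Sum>k = 1..n - 1. Y k)) = (\<Sum>n = 1..N. \<Sum>k\<in>{k\<in>{1..N}. k < n}. Z n * Y k)"
    unfolding sum_distrib_left by (intro sum.cong refl) auto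
  also have "\<dots> = (\<Sum>k = 1..N. \<Sum>n\<in>{n\<in>{1..N}. k < n}. Z n * Y k)"
    by (rule sum.swap_restrict) auto
  also have "\<dots> = (\<Sum>k = 1..N. Y k * (\<Sum>n\<in>{k<..N}. Z n))"
    unfolding sum_distrib_left by (intro sum.cong refl) (auto simp: mult.commute intro!: sum.cong)
  finally show ?thesis .
qed

lemma sum_shift_interval:
  fixes Z :: "nat \<Rightarrow> real"
  shows "(\<Sum>i = 1..K. Z (k + i)) = (\<Sum>n\<in>{k<..k + K}. Z n)"
  by (rule sum.reindex_bij_witness[of _ "\<lambda>n. n - k" "\<lambda>i. k + i"]) auto

text \<open>All three limits equal the sum of \<open>Y k\<close> times the tail of \<open>Z\<close>
  beyond \<open>k\<close>: the nested sum after exchanging the two finite summations, the sum over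
  the gap \<open>i\<close> between the two indices, and the sum over tails itself. The bound
  \<open>D\<close> dominates every inner block sum, so \<open>Z\<close> may converge conditionally
  and the sum of \<open>Y\<close> may even diverge. The gap form links sums in \<open>n\<close>,
  \<open>k\<close> to nested sums.\<close>

lemma nested_sum_limits:
  fixes Z Y D :: "nat \<Rightarrow> real"
  assumes D: "\<And>i j. i \<le> j \<Longrightarrow> \<bar>\<Sum>n\<in>{i<..j}. Z n\<bar> \<le> D i" "D \<longlonglongrightarrow> 0"
    and Y: "summable (\<lambda>k. \<bar>Y (Suc k)\<bar> * D (Suc k))"
    and z: "(\<lambda>N. \<Sum>n = 1..N. Z n) \<longlonglongrightarrow> z"
  shows "\<exists>l. (\<lambda>N. \<Sum>n = 1..N. Z n * (\<Sum>k = 1..n - 1. Y k)) \<longlonglongrightarrow> l \<and>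
    (\<forall>K. summable (\<lambda>k. Y (Suc k) * (\<Sum>i = 1..K. Z (Suc k + i)))) \<and>
    (\<lambda>K. \<Sum>k. Y (Suc k) * (\<Sum>i = 1..K. Z (Suc k + i))) \<longlonglongrightarrow> l \<and>
    (\<lambda>K. \<Sum>k = 1..K. Y k * (z - (\<Sum>n = 1..k. Z n))) \<longlonglongrightarrow> l"
proof -
  define R where "R k = z - (\<Sum>n = 1..k. Z n)" for k
  have split: "(\<Sum>n\<in>{i<..j}. Z n) = (\<Sum>n = 1..j. Z n) - (\<Sum>n = 1..i. Z n)" if "i \<le> j" for i j
  proof -
    have "{1..j} = {1..i} \<union> {i<..j}" "{1..i} \<inter> {i<..j} = {}" using that by auto
    then show ?thesis by (simp add: sum.union_disjoint)
  qed
  have D0: "D i \<ge> 0" for i using D(1)[of i i] by simp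
  have R1: "(\<lambda>N. \<Sum>n\<in>{k<..N}. Z n) \<longlonglongrightarrow> R k" for k
  proof -
    have "(\<lambda>N. (\<Sum>n = 1..N. Z n) - (\<Sum>n = 1..k. Z n)) \<longlonglongrightarrow> R k"
      unfolding R_def by (intro tendsto_intros z)
    moreover have "eventually (\<lambda>N. (\<Sum>n\<in>{k<..N}. Z n) = (\<Sum>n = 1..N. Z n) - (\<Sum>n = 1..k. Z n)) sequentially"
      using eventually_ge_at_top[of k] by eventually_elim (use split in auto)
    ultimately show ?thesis by (subst tendsto_cong) auto
  qed
  have R2: "(\<lambda>K. \<Sum>i = 1..K. Z (k + i)) \<longlonglongrightarrow> R k" for k
    unfolding sum_shift_interval
    using filterlim_compose[OF R1[of k] filterlim_add_const_nat_at_top[of k]] by (simp add: add.commute)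
  have b1: "\<bar>\<Sum>n\<in>{k<..N}. Z n\<bar> \<le> D k" for k N
    using D(1)[of k N] D0[of k] by (cases "k \<le> N") auto
  define l where "l = (\<Sum>k. Y (Suc k) * R (Suc k))"
  have bnd: "\<bar>Y (Suc k) * x\<bar> \<le> \<bar>Y (Suc k)\<bar> * D (Suc k)" if "\<bar>x\<bar> \<le> D (Suc k)" for x k
    unfolding abs_mult using that by (intro mult_left_mono) auto
  note T2 = tannery_sequentially[where a = "\<lambda>k K. Y (Suc k) * (\<Sum>i = 1..K. Z (Suc k + i))"
      and b = "\<lambda>k. Y (Suc k) * R (Suc k)" and M = "\<lambda>k. \<bar>Y (Suc k)\<bar> * D (Suc k)",
      OF tendsto_mult[OF tendsto_const R2] bnd Y]
  have T2b: "\<bar>\<Sum>i = 1..K. Z (Suc k + i)\<bar> \<le> D (Suc k)" for k K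
    unfolding sum_shift_interval by (rule b1)
  note T1 = tannery_sequentially[where a = "\<lambda>k N. Y (Suc k) * (\<Sum>n\<in>{Suc k<..N}. Z n)"
      and b = "\<lambda>k. Y (Suc k) * R (Suc k)" and M = "\<lambda>k. \<bar>Y (Suc k)\<bar> * D (Suc k)",
      OF tendsto_mult[OF tendsto_const R1] bnd[OF b1] Y]
  have "(\<Sum>n = 1..N. Z n * (\<Sum>k = 1..n - 1. Y k)) = (\<Sum>k. Y (Suc k) * (\<Sum>n\<in>{Suc k<..N}. Z n))" for N
    unfolding sum_nested_swap sum_1_eq_lessThan[of _ N]
    by (rule suminf_finite[symmetric]) auto
  then have l1: "(\<lambda>N. \<Sum>n = 1..N. Z n * (\<Sum>k = 1..n - 1. Y k)) \<longlonglongrightarrow> l"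
    using T1(3) unfolding l_def by simp
  have l3: "(\<lambda>K. \<Sum>k = 1..K. Y k * (z - (\<Sum>n = 1..k. Z n))) \<longlonglongrightarrow> l"
    unfolding R_def[symmetric] l_def sum_1_eq_lessThan[of "\<lambda>k. Y k * R k"] by (rule summable_LIMSEQ[OF T1(2)])
  show ?thesis
    using l1 T2(1)[OF T2b] T2(3)[OF T2b, folded l_def] l3 by blast
qed

text \<open>Mertens' theorem on Cauchy products, indexed from 1: the antidiagonals are
  \<open>a + b = k + 1\<close>.\<close>

lemma mertens_partial_sums:
  fixes x y :: "nat \<Rightarrow> real"
  assumes x: "summable (\<lambda>a. \<bar>x (Suc a)\<bar>)" and y: "(\<lambda>N. \<Sum>b = 1..N. y b) \<longlonglongrightarrow> v"
    and u: "(\<lambda>N. \<Sum>a = 1..N. x a) \<longlonglongrightarrow> u"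
  shows "(\<lambda>K. \<Sum>k = 1..K. \<Sum>b = 1..k. x (k + 1 - b) * y b) \<longlonglongrightarrow> u * v"
proof -
  have "(\<lambda>N. \<bar>\<Sum>b = 1..N. y b\<bar>) \<longlonglongrightarrow> \<bar>v\<bar>" using y by (rule tendsto_rabs)
  then have "Bseq (\<lambda>N. \<Sum>b = 1..N. y b)" using y by (intro convergent_imp_Bseq) (auto simp: convergent_def)
  then obtain B where B: "\<And>N. \<bar>\<Sum>b = 1..N. y b\<bar> \<le> B" by (auto simp: Bseq_def)
  \<comment> \<open>Regrouping by the first index turns the triangle into rows that hold partial
    sums of \<open>y\<close>. Truncated subtraction empties the rows with \<open>a \<ge> K\<close>,
    so the finite sum is already an infinite series to which dominated convergence applies.\<close>
  have eq: "(\<Sum>k = 1..K. \<Sum>b = 1..k. x (k + 1 - b) * y b) = (\<Sum>a. x (Suc a) * (\<Sum>b = 1..K - a. y b))" for K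
  proof -
    have "(\<Sum>k = 1..K. \<Sum>b = 1..k. x (k + 1 - b) * y b) = (\<Sum>(k,b)\<in>(SIGMA k:{1..K}. {1..k}). x (k + 1 - b) * y b)"
      by (simp add: sum.Sigma)
    also have "\<dots> = (\<Sum>(a,b)\<in>(SIGMA a:{..<K}. {1..K - a}). x (Suc a) * y b)"
      by (rule sum.reindex_bij_witness[of _ "\<lambda>(a,b). (a + b, b)" "\<lambda>(k,b). (k - b, b)"])
         (auto simp: Suc_diff_le)
    also have "\<dots> = (\<Sum>a<K. \<Sum>b = 1..K - a. x (Suc a) * y b)" by (simp add: sum.Sigma)
    also have "\<dots> = (\<Sum>a<K. x (Suc a) * (\<Sum>b = 1..K - a. y b))" by (simp add: sum_distrib_left)
    also have "\<dots> = (\<Sum>a. x (Suc a) * (\<Sum>b = 1..K - a. y b))"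
      by (rule suminf_finite[symmetric]) auto
    finally show ?thesis .
  qed
  have lim: "(\<lambda>K. \<Sum>b = 1..K - a. y b) \<longlonglongrightarrow> v" for a
    using filterlim_compose[OF y filterlim_minus_const_nat_at_top[of a]] by simp
  have "(\<lambda>K. \<Sum>a. x (Suc a) * (\<Sum>b = 1..K - a. y b)) \<longlonglongrightarrow> (\<Sum>a. x (Suc a) * v)"
  proof (rule tannery_sequentially(3))
    show "(\<lambda>K. x (Suc k) * (\<Sum>b = 1..K - k. y b)) \<longlonglongrightarrow> x (Suc k) * v" for k
      by (intro tendsto_intros lim)
    show "\<bar>x (Suc k) * (\<Sum>b = 1..n - k. y b)\<bar> \<le> \<bar>x (Suc k)\<bar> * B" for k n
      unfolding abs_mult by (intro mult_left_mono B) auto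
    show "summable (\<lambda>a. \<bar>x (Suc a)\<bar> * B)" by (intro summable_mult2 x)
  qed
  also have "(\<Sum>a. x (Suc a) * v) = u * v"
  proof -
    have s: "summable (\<lambda>a. x (Suc a))" using x by (rule summable_rabs_cancel)
    have "(\<lambda>N. \<Sum>a = 1..N. x a) \<longlonglongrightarrow> (\<Sum>a. x (Suc a))"
      unfolding sum_1_eq_lessThan by (rule summable_LIMSEQ[OF s])
    then have "(\<Sum>a. x (Suc a)) = u" using u LIMSEQ_unique by blast
    then show ?thesis using suminf_mult2[OF s, of v] by simp
  qed
  finally show ?thesis unfolding eq .
qed

subsection \<open>Stuffle relations and convergence\<close>

text \<open>Arbitrary functions instead of signed indices: the merged entries of a stuffle product
  are pointwise products and remain of this form.\<close>

fun nested_sum :: "(nat \<Rightarrow> real) list \<Rightarrow> nat \<Rightarrow> real" where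
  "nested_sum [] N = 1"
| "nested_sum (f # fs) N = (\<Sum>n = 1..N. f n * nested_sum fs (n - 1))"

lemma nested_sum_0 [simp]: "nested_sum (f # fs) 0 = 0"
  by simp

text \<open>Recursion on the upper limit. With the defining equation for nonempty lists removed from
  the simp set, stuffle identities become inductions on \<open>N\<close> that compare
  increments.\<close>

lemma nested_sum_Suc [simp]:
  "nested_sum (f # fs) (Suc N) = nested_sum (f # fs) N + f (Suc N) * nested_sum fs N"
  by simp

lemma nested_sum_single: "nested_sum [f] N = (\<Sum>n = 1..N. f n)"
  by simp

lemmas nested_sum_Cons = nested_sum.simps(2)
declare nested_sum.simps(2) [simp del]

lemma stuffle_1_1:
  "nested_sum [f] N * nested_sum [g] N =
     nested_sum [f, g] N + nested_sum [g, f] N + nested_sum [\<lambda>n. f n * g n] N"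
  by (induction N) (auto simp: algebra_simps)

lemma stuffle_1_2:
  "nested_sum [f] N * nested_sum [g, h] N =
     nested_sum [f, g, h] N + nested_sum [g, f, h] N + nested_sum [g, h, f] N +
     nested_sum [\<lambda>n. f n * g n, h] N + nested_sum [g, \<lambda>n. f n * h n] N"
proof (induction N)
  case (Suc N)
  \<comment> \<open>The increment in which \<open>g\<close> takes the largest index leaves a product
    of two sums of depth one.\<close>
  have "g (Suc N) * (nested_sum [f] N * nested_sum [h] N) =
        g (Suc N) * (nested_sum [f, h] N + nested_sum [h, f] N + nested_sum [\<lambda>n. f n * h n] N)"
    by (simp only: stuffle_1_1)
  then show ?case using Suc by (simp add: algebra_simps)
qed auto

text \<open>The antipode relation of the stuffle Hopf algebra in depth three.\<close>

lemma nested_sum_reversal: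
  "nested_sum [h, g, f] N =
     nested_sum [f, g, h] N - nested_sum [f, g] N * nested_sum [h] N + nested_sum [f] N * nested_sum [h, g] N
     + nested_sum [f, \<lambda>n. g n * h n] N - nested_sum [h, \<lambda>n. f n * g n] N"
proof -
  \<comment> \<open>Subtract the stuffle products of \<open>f\<close> with \<open>[h, g]\<close> and
    of \<open>h\<close> with \<open>[f, g]\<close>: the orders \<open>[f, h, g]\<close> and
    \<open>[h, f, g]\<close> and the term merging \<open>f\<close> with \<open>h\<close> cancel. The
    merged functions must first agree syntactically.\<close>
  have "(\<lambda>n. g n * f n) = (\<lambda>n. f n * g n)" "(\<lambda>n. h n * f n) = (\<lambda>n. f n * h n)"
    "(\<lambda>n. h n * g n) = (\<lambda>n. g n * h n)"
    by (simp_all add: mult.commute)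
  then show ?thesis
    using stuffle_1_2[of f N h g] stuffle_1_2[of h N f g] by (simp add: algebra_simps)
qed

section \<open>Signed terms: block estimates and convergence\<close>

fun signed_term :: "(nat \<Rightarrow> real) \<Rightarrow> nat \<times> int \<Rightarrow> nat \<Rightarrow> real" where
  "signed_term w (s, \<sigma>) n = of_int \<sigma> ^ n / w n ^ s"

definition odd_denom :: "nat \<Rightarrow> real" where
  "odd_denom n = 2 * real n - 1"

text \<open>The lower bound gives decay and monotonicity gives the alternating series estimate. Both
  \<open>real\<close> and \<open>odd_denom\<close> qualify, so zeta sums and t-sums share one
  treatment; \<open>odd_denom 0\<close> is negative, hence \<open>n \<ge> 1\<close>.\<close>

definition denominators :: "(nat \<Rightarrow> real) \<Rightarrow> bool" where
  "denominators w \<longleftrightarrow> (\<forall>n\<ge>1. real n \<le> w n \<and> w n \<le> w (Suc n))"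

lemma denominators_real: "denominators real"
  by (auto simp: denominators_def)

lemma denominators_odd_denom: "denominators odd_denom"
  by (auto simp: denominators_def odd_denom_def)

lemma zeta_partial_eq: "zeta_partial xs N = nested_sum (map (signed_term real) xs) N"
  by (induction xs arbitrary: N) (auto simp: nested_sum_Cons)

lemma t_partial_eq: "t_partial xs N = nested_sum (map (signed_term odd_denom) xs) N"
  by (induction xs arbitrary: N) (auto simp: nested_sum_Cons odd_denom_def)

definition valid_index :: "nat \<times> int \<Rightarrow> bool" where
  "valid_index x \<longleftrightarrow> fst x \<ge> 1 \<and> snd x \<in> {1, -1}"

definition admissible_index :: "nat \<times> int \<Rightarrow> bool" where
  "admissible_index x \<longleftrightarrow> valid_index x \<and> x \<noteq> (1, 1)"

lemma admissible_indexD: "admissible_index x \<Longrightarrow> valid_index x"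
  by (simp add: admissible_index_def)

lemma admissible_iff: "admissible (x # xs) \<longleftrightarrow> admissible_index x \<and> (\<forall>y\<in>set xs. valid_index y)"
  by (auto simp: admissible_def admissible_index_def valid_index_def)

fun merge_index :: "nat \<times> int \<Rightarrow> nat \<times> int \<Rightarrow> nat \<times> int" where
  "merge_index (s, \<sigma>) (s', \<sigma>') = (s + s', \<sigma> * \<sigma>')"

lemma signed_term_merge:
  "signed_term w x n * signed_term w y n = signed_term w (merge_index x y) n"
  by (cases x; cases y) (simp add: power_add power_mult_distrib)

lemma signed_term_merge_fun:
  "(\<lambda>n. signed_term w x n * signed_term w y n) = signed_term w (merge_index x y)"
  using signed_term_merge by blast

text \<open>The merged exponent is at least 2, which excludes \<open>(1, 1)\<close> whatever the
  signs are.\<close>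

lemma admissible_merge_index:
  "valid_index x \<Longrightarrow> valid_index y \<Longrightarrow> admissible_index (merge_index x y)"
  by (cases x; cases y) (auto simp: admissible_index_def valid_index_def)

lemma alternating_interval_sum:
  fixes c :: "nat \<Rightarrow> real"
  assumes "\<And>n. n \<ge> 1 \<Longrightarrow> 0 \<le> c n" "\<And>n. n \<ge> 1 \<Longrightarrow> c (Suc n) \<le> c n"
  shows "\<bar>\<Sum>n\<in>{i<..j}. (-1) ^ n * c n\<bar> \<le> c (Suc i)"
proof -
  \<comment> \<open>Leibniz' estimate in inductive form: normalised by the sign of its first term, a
    block lies between 0 and its first coefficient. Peeling off that first term reverses the sign of
    the rest.\<close>
  have *: "0 \<le> (-1) ^ Suc i * (\<Sum>n\<in>{i<..i + d}. (-1) ^ n * c n) \<and>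
        (-1) ^ Suc i * (\<Sum>n\<in>{i<..i + d}. (-1) ^ n * c n) \<le> c (Suc i)" for d
  proof (induction d arbitrary: i)
    case 0
    then show ?case using assms by auto
  next
    case (Suc d)
    have sq: "(-1) ^ i * (-1) ^ i = (1 :: real)" by (simp flip: power_mult_distrib)
    have "{i<..i + Suc d} = insert (Suc i) {Suc i<..Suc i + d}" by auto
    then have "(\<Sum>n\<in>{i<..i + Suc d}. (-1) ^ n * c n) =
          (-1) ^ Suc i * c (Suc i) + (\<Sum>n\<in>{Suc i<..Suc i + d}. (-1) ^ n * c n)"
      by simp
    then have "(-1) ^ Suc i * (\<Sum>n\<in>{i<..i + Suc d}. (-1) ^ n * c n) =
          c (Suc i) - (-1) ^ Suc (Suc i) * (\<Sum>n\<in>{Suc i<..Suc i + d}. (-1) ^ n * c n)"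
      using sq by (simp add: ring_distribs flip: mult.assoc)
    then show ?case using Suc[of "Suc i"] assms(2)[of "Suc i"] by auto
  qed
  show ?thesis
  proof (cases "i \<le> j")
    case True
    then obtain d where j: "j = i + d" using le_Suc_ex by blast
    have "\<bar>\<Sum>n\<in>{i<..j}. (-1) ^ n * c n\<bar> = \<bar>(-1) ^ Suc i * (\<Sum>n\<in>{i<..i + d}. (-1) ^ n * c n)\<bar>"
      unfolding j by (simp add: abs_mult)
    then show ?thesis using *[of d] by linarith
  qed (use assms(1)[of "Suc i"] in auto)
qed

text \<open>Telescoping against \<open>2 * C / n - 2 * C / (n + 1)\<close>; the factor 2 pays for
  replacing \<open>n * (n + 1)\<close> by \<open>n ^ 2\<close>.\<close>

lemma inverse_square_interval_sum:
  fixes f :: "nat \<Rightarrow> real"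
  assumes "\<And>n. n \<ge> 1 \<Longrightarrow> \<bar>f n\<bar> \<le> C / real n ^ 2" "C \<ge> 0"
  shows "\<bar>\<Sum>n\<in>{i<..j}. f n\<bar> \<le> 2 * C / real (Suc i)"
proof (cases "i \<le> j")
  case True
  have identity: "2 * C / x - 2 * C / (x + 1) - C / x ^ 2 = C * (x - 1) / (x ^ 2 * (x + 1))"
    if "x \<ge> 1" for x C :: real
    using that by (simp add: divide_simps power2_eq_square) (simp add: algebra_simps)
  have "\<bar>\<Sum>n\<in>{i<..j}. f n\<bar> \<le> (\<Sum>n\<in>{i<..j}. \<bar>f n\<bar>)" by (rule sum_abs)
  also have "\<dots> \<le> (\<Sum>n\<in>{i<..j}. 2 * C / real n - 2 * C / real (Suc n))"
  proof (rule sum_mono)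
    fix n assume "n \<in> {i<..j}"
    then have n: "real n \<ge> 1" "n \<ge> 1" by auto
    have "2 * C / real n - 2 * C / real (Suc n) - C / real n ^ 2 = C * (real n - 1) / (real n ^ 2 * (real n + 1))"
      using identity[OF n(1), of C] by (simp add: add.commute)
    moreover have "\<dots> \<ge> 0" using n assms(2) by (intro divide_nonneg_nonneg mult_nonneg_nonneg) auto
    ultimately show "\<bar>f n\<bar> \<le> 2 * C / real n - 2 * C / real (Suc n)"
      using assms(1)[OF n(2)] by linarith
  qed
  also have "\<dots> = 2 * C / real (Suc i) - 2 * C / real (Suc j)"
    using True by (induction j rule: dec_induct) (auto simp: atLeastSucAtMost_greaterThanAtMost[symmetric] sum.cl_ivl_Suc)
  also have "\<dots> \<le> 2 * C / real (Suc i)" using assms(2) by simp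
  finally show ?thesis .
qed (use assms in auto)

lemma abs_signed_term_eq:
  assumes "denominators w" "valid_index x" "n \<ge> 1"
  shows "\<bar>signed_term w x n\<bar> = 1 / w n ^ fst x"
  using assms by (cases x) (auto simp: valid_index_def abs_mult power_abs denominators_def)

lemma abs_signed_term_le:
  assumes "denominators w" "valid_index x" "n \<ge> 1" "j \<le> fst x"
  shows "\<bar>signed_term w x n\<bar> \<le> 1 / real n ^ j"
proof -
  have w: "real n \<le> w n" "real n \<ge> 1" using assms by (auto simp: denominators_def)
  have "real n ^ j \<le> real n ^ fst x" using w(2) assms(4) by (rule power_increasing[rotated])
  also have "\<dots> \<le> w n ^ fst x" using w by (intro power_mono) auto
  finally show ?thesis unfolding abs_signed_term_eq[OF assms(1-3)] using w
    by (intro divide_left_mono mult_pos_pos) auto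
qed

lemma abs_signed_term_le_inverse:
  assumes "denominators w" "valid_index x" "n \<ge> 1"
  shows "\<bar>signed_term w x n\<bar> \<le> 1 / real n"
  using abs_signed_term_le[OF assms, of 1] assms(2) by (simp add: valid_index_def)

text \<open>Sign 1 forces the exponent to be at least 2, and then telescoping applies; sign -1 gives
  an alternating block bounded by its first term. The constant 2 serves both cases.\<close>

lemma signed_term_interval_sum:
  assumes w: "denominators w" and x: "admissible_index x"
  shows "\<bar>\<Sum>n\<in>{i<..j}. signed_term w x n\<bar> \<le> 2 / real (Suc i)"
proof (cases "snd x = 1")
  case True
  then have "fst x \<ge> 2" using x by (cases x) (auto simp: admissible_index_def valid_index_def)
  then show ?thesis
    using inverse_square_interval_sum[of "signed_term w x" 1 i j]
      abs_signed_term_le[OF w admissible_indexD[OF x], of _ 2] by auto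
next
  case False
  then have x': "snd x = -1" using x by (auto simp: admissible_index_def valid_index_def)
  have eq: "signed_term w x n = (-1) ^ n * (1 / w n ^ fst x)" for n
    using x' by (cases x) auto
  have wp: "w n > 0" "w n \<le> w (Suc n)" if "n \<ge> 1" for n
    using w that unfolding denominators_def by force+
  have "\<bar>\<Sum>n\<in>{i<..j}. signed_term w x n\<bar> \<le> 1 / w (Suc i) ^ fst x"
    unfolding eq
  proof (rule alternating_interval_sum)
    show "0 \<le> 1 / w n ^ fst x" if "n \<ge> 1" for n using wp[OF that] by auto
    show "1 / w (Suc n) ^ fst x \<le> 1 / w n ^ fst x" if "n \<ge> 1" for n
      using wp[OF that] wp[of "Suc n"] by (intro divide_left_mono power_mono mult_pos_pos zero_less_power) auto
  qed
  also have "\<dots> \<le> 1 / real (Suc i)"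
    using abs_signed_term_le_inverse[OF w admissible_indexD[OF x], of "Suc i"]
      abs_signed_term_eq[OF w admissible_indexD[OF x], of "Suc i"] by simp
  also have "\<dots> \<le> 2 / real (Suc i)" by (intro divide_right_mono) auto
  finally show ?thesis .
qed

text \<open>The common majorant, written in the shape in which a factor of order
  \<open>1 / n ^ 2\<close> times a growth of order \<open>sqrt n\<close> produces it.\<close>

lemma summable_inverse_three_halves: "summable (\<lambda>k. 1 / (real (Suc k) * sqrt (real (Suc k))))"
proof -
  have "summable (\<lambda>n. real n powr (-3/2))" by (subst summable_real_powr_iff) auto
  then have "summable (\<lambda>n. real (Suc n) powr (-3/2))" by (subst summable_Suc_iff)
  moreover have "real (Suc n) powr (-3/2) = 1 / (real (Suc n) * sqrt (real (Suc n)))" for n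
  proof -
    have "real (Suc n) powr (-3/2) = 1 / real (Suc n) powr (1 + 1/2)"
      by (subst powr_minus_divide[symmetric]) simp
    also have "real (Suc n) powr (1 + 1/2) = real (Suc n) * sqrt (real (Suc n))"
      by (simp only: powr_add powr_half_sqrt) (simp add: powr_half_sqrt)
    finally show ?thesis .
  qed
  ultimately show ?thesis by simp
qed

lemma LIMSEQ_const_over_Suc: "(\<lambda>i. C / real (Suc i)) \<longlonglongrightarrow> 0"
  using LIMSEQ_Suc[OF lim_const_over_n[of C]] by simp

lemma summable_inverse_three_halves_bound:
  fixes f :: "nat \<Rightarrow> real"
  assumes "\<And>k. \<bar>f k\<bar> \<le> C / (real (Suc k) * sqrt (real (Suc k)))"
  shows "summable f" "summable (\<lambda>k. \<bar>f k\<bar>)"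
proof -
  have "summable (\<lambda>k. C * (1 / (real (Suc k) * sqrt (real (Suc k)))))"
    by (intro summable_mult summable_inverse_three_halves)
  then show "summable f" "summable (\<lambda>k. \<bar>f k\<bar>)"
    by (rule summable_comparison_test'[where N = 0], use assms in simp)+
qed

text \<open>The condition on \<open>Y\<close> is met by a single term of size \<open>1 / n\<close>
  and also by such a term times a harmonic sum; multiplied by the tail bound
  \<open>2 / (k + 1)\<close> it is still summable.\<close>

lemma nested_sum_limits_signed_term:
  fixes Y :: "nat \<Rightarrow> real"
  assumes w: "denominators w" and x: "admissible_index x"
    and Y: "\<And>n. n \<ge> 1 \<Longrightarrow> \<bar>Y n\<bar> \<le> C / sqrt (real n)"
    and z: "(\<lambda>N. \<Sum>n = 1..N. signed_term w x n) \<longlonglongrightarrow> z"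
  shows "\<exists>l. (\<lambda>N. \<Sum>n = 1..N. signed_term w x n * (\<Sum>k = 1..n - 1. Y k)) \<longlonglongrightarrow> l \<and>
    (\<forall>K. summable (\<lambda>k. Y (Suc k) * (\<Sum>i = 1..K. signed_term w x (Suc k + i)))) \<and>
    (\<lambda>K. \<Sum>k. Y (Suc k) * (\<Sum>i = 1..K. signed_term w x (Suc k + i))) \<longlonglongrightarrow> l \<and>
    (\<lambda>K. \<Sum>k = 1..K. Y k * (z - (\<Sum>n = 1..k. signed_term w x n))) \<longlonglongrightarrow> l"
proof -
  have "\<bar>\<bar>Y (Suc k)\<bar> * (2 / real (Suc (Suc k)))\<bar> \<le> 2 * C / (real (Suc k) * sqrt (real (Suc k)))" for k
  proof -
    have "\<bar>\<bar>Y (Suc k)\<bar> * (2 / real (Suc (Suc k)))\<bar> = \<bar>Y (Suc k)\<bar> * (2 / real (Suc (Suc k)))"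
      by (simp add: abs_mult)
    also have "\<dots> \<le> (C / sqrt (real (Suc k))) * (2 / real (Suc k))"
      using Y[of "Suc k"] order_trans[OF abs_ge_zero Y[of "Suc k"]]
      by (intro mult_mono divide_left_mono) auto
    finally show ?thesis by (simp add: field_simps)
  qed
  then have "summable (\<lambda>k. \<bar>Y (Suc k)\<bar> * (2 / real (Suc (Suc k))))"
    by (rule summable_inverse_three_halves_bound(1))
  from nested_sum_limits[OF signed_term_interval_sum[OF w x] LIMSEQ_const_over_Suc this z]
  show ?thesis .
qed

lemma convergent_signed_term_sum:
  assumes "denominators w" "admissible_index x"
  shows "convergent (nested_sum [signed_term w x])"
  unfolding nested_sum_single
  by (rule convergent_if_interval_sums_small[OF signed_term_interval_sum[OF assms] LIMSEQ_const_over_Suc])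

text \<open>A square root instead of the logarithm costs nothing, since the sum is later multiplied
  by two factors of order \<open>1 / n\<close>.\<close>

lemma harmonic_sum_le_sqrt: "(\<Sum>n = 1..N. 1 / real n) \<le> 2 * sqrt (real N)"
proof (induction N)
  case (Suc N)
  define a b where "a = sqrt (real N)" and "b = sqrt (real (Suc N))"
  have ab: "a \<ge> 0" "a \<le> b" "b \<ge> 1" "b ^ 2 - a ^ 2 = 1" "b ^ 2 = real (Suc N)"
    by (auto simp: a_def b_def)
  \<comment> \<open>What is needed is \<open>1 / b^2 \<le> 2 * (b - a)\<close>. It follows from
    \<open>(b - a) * (a + b) = 1\<close>, because \<open>a + b\<close> is at most
    \<open>2 * b\<close> and hence at most \<open>2 * b^2\<close>.\<close>
  have "1 = (b - a) * (a + b)" using ab(4) by (simp add: algebra_simps power2_eq_square)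
  also have "\<dots> \<le> (b - a) * (2 * b ^ 2)"
  proof (intro mult_left_mono)
    have "b * 1 \<le> b * b" using ab by (intro mult_left_mono) auto
    then show "a + b \<le> 2 * b ^ 2" using ab(2) unfolding power2_eq_square by linarith
  qed (use ab in auto)
  finally have "1 / real (Suc N) \<le> 2 * b - 2 * a" using ab by (simp add: field_simps)
  then show ?case using Suc by (simp add: a_def b_def)
qed auto

lemma abs_nested_sum_single_le:
  assumes "denominators w" "valid_index x"
  shows "\<bar>nested_sum [signed_term w x] N\<bar> \<le> 2 * sqrt (real N)"
proof -
  have "\<bar>nested_sum [signed_term w x] N\<bar> \<le> (\<Sum>n = 1..N. 1 / real n)"
    unfolding nested_sum_single
    by (rule order_trans[OF sum_abs sum_mono]) (use abs_signed_term_le_inverse[OF assms] in auto)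
  then show ?thesis using harmonic_sum_le_sqrt[of N] by linarith
qed

lemma divide_self_le_divide_sqrt:
  assumes "n \<ge> 1" "C \<ge> 0" shows "C / real n \<le> C / sqrt (real n)"
proof -
  have "sqrt (real n) * 1 \<le> sqrt (real n) * sqrt (real n)" using assms by (intro mult_left_mono) auto
  then show ?thesis using assms by (intro divide_left_mono) auto
qed

lemma mult_le_divide_sqrt:
  assumes "n \<ge> 1" "\<bar>x\<bar> \<le> 1 / real n" "\<bar>y\<bar> \<le> C * sqrt (real n)"
  shows "\<bar>x * y\<bar> \<le> C / sqrt (real n)"
proof -
  have "\<bar>x * y\<bar> \<le> 1 / real n * (C * sqrt (real n))"
    unfolding abs_mult using assms by (intro mult_mono) auto
  also have "\<dots> = C / sqrt (real n)"
    by (simp add: real_div_sqrt divide_simps)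
  finally show ?thesis .
qed

text \<open>The inner variables enter only through a bound on the second summand, so depths two and
  three are instances of one argument.\<close>

lemma convergent_nested_sum:
  assumes w: "denominators w" and x: "admissible_index x"
    and Y: "\<And>n. n \<ge> 1 \<Longrightarrow> \<bar>f n * nested_sum fs (n - 1)\<bar> \<le> C / sqrt (real n)"
  shows "convergent (nested_sum (signed_term w x # f # fs))"
proof -
  obtain z where z: "(\<lambda>N. \<Sum>n = 1..N. signed_term w x n) \<longlonglongrightarrow> z"
    using convergent_signed_term_sum[OF w x] unfolding nested_sum_single convergent_def by blast
  from nested_sum_limits_signed_term[OF w x Y z] show ?thesis
    unfolding convergent_def nested_sum_Cons[of "signed_term w x"] nested_sum_Cons[of f] by blast
qed

lemma convergent_nested_sum_2:
  assumes "denominators w" "admissible_index x" "valid_index y"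
  shows "convergent (nested_sum [signed_term w x, signed_term w y])"
proof (rule convergent_nested_sum[where C = 1])
  fix n :: nat assume n: "n \<ge> 1"
  show "\<bar>signed_term w y n * nested_sum [] (n - 1)\<bar> \<le> 1 / sqrt (real n)"
    using abs_signed_term_le_inverse[OF assms(1,3) n] divide_self_le_divide_sqrt[OF n, of 1] by simp
qed (use assms in auto)

lemma convergent_nested_sum_3:
  assumes "denominators w" "admissible_index x" "valid_index y" "valid_index z"
  shows "convergent (nested_sum [signed_term w x, signed_term w y, signed_term w z])"
proof (rule convergent_nested_sum[where C = 2])
  fix n :: nat assume n: "n \<ge> 1"
  have "\<bar>nested_sum [signed_term w z] (n - 1)\<bar> \<le> 2 * sqrt (real n)"
    using abs_nested_sum_single_le[OF assms(1,4), of "n - 1"] by (rule order_trans) auto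
  then show "\<bar>signed_term w y n * nested_sum [signed_term w z] (n - 1)\<bar> \<le> 2 / sqrt (real n)"
    using abs_signed_term_le_inverse[OF assms(1,3) n] by (intro mult_le_divide_sqrt[OF n])
qed (use assms in auto)

section \<open>Limits in depth at most three and the ring of permitted values\<close>

lemma
  assumes "admissible_index x"
  shows zeta_tendsto_1: "nested_sum [signed_term real x] \<longlonglongrightarrow> zeta_val [x]"
    and t_tendsto_1: "nested_sum [signed_term odd_denom x] \<longlonglongrightarrow> t_val [x]"
  using convergent_signed_term_sum[OF _ assms] denominators_real denominators_odd_denom
  unfolding convergent_LIMSEQ_iff zeta_val_def t_val_def zeta_partial_eq[abs_def] t_partial_eq[abs_def] by auto

lemma
  assumes "admissible_index x" "valid_index y"
  shows zeta_tendsto_2: "nested_sum [signed_term real x, signed_term real y] \<longlonglongrightarrow> zeta_val [x, y]"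
    and t_tendsto_2: "nested_sum [signed_term odd_denom x, signed_term odd_denom y] \<longlonglongrightarrow> t_val [x, y]"
  using convergent_nested_sum_2[OF _ assms] denominators_real denominators_odd_denom
  unfolding convergent_LIMSEQ_iff zeta_val_def t_val_def zeta_partial_eq[abs_def] t_partial_eq[abs_def] by auto

lemma t_tendsto_3:
  assumes "admissible_index x" "valid_index y" "valid_index z"
  shows "nested_sum [signed_term odd_denom x, signed_term odd_denom y, signed_term odd_denom z]
           \<longlonglongrightarrow> t_val [x, y, z]"
  using convergent_nested_sum_3[OF denominators_odd_denom assms]
  unfolding convergent_LIMSEQ_iff t_val_def t_partial_eq[abs_def] by auto

definition values_ring :: "real set" where
  "values_ring = rat_polynomials_in (zeta_values 1 \<union> beta_values \<union> zeta_values 2 \<union> t_values 2)"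

lemmas values_ring_intros =
  rat_polynomials_in_intros[where G = "zeta_values 1 \<union> beta_values \<union> zeta_values 2 \<union> t_values 2",
    folded values_ring_def]

lemma zeta_1_in_values_ring:
  assumes "admissible_index x"
  shows "zeta_val [x] \<in> values_ring"
  unfolding values_ring_def
proof (rule rat_polynomials_in_base)
  have "zeta_val [x] \<in> zeta_values 1"
    unfolding zeta_values_def using assms by (intro CollectI exI[of _ "[x]"]) (auto simp: admissible_iff)
  then show "zeta_val [x] \<in> zeta_values 1 \<union> beta_values \<union> zeta_values 2 \<union> t_values 2"
    by blast
qed

lemma zeta_2_in_values_ring:
  assumes "admissible_index x" "valid_index y"
  shows "zeta_val [x, y] \<in> values_ring"
  unfolding values_ring_def
proof (rule rat_polynomials_in_base)
  have "zeta_val [x, y] \<in> zeta_values 2"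
    unfolding zeta_values_def using assms by (intro CollectI exI[of _ "[x, y]"]) (auto simp: admissible_iff)
  then show "zeta_val [x, y] \<in> zeta_values 1 \<union> beta_values \<union> zeta_values 2 \<union> t_values 2"
    by blast
qed

lemma t_2_in_values_ring:
  assumes "admissible_index x" "valid_index y"
  shows "t_val [x, y] \<in> values_ring"
  unfolding values_ring_def
proof (rule rat_polynomials_in_base)
  have "t_val [x, y] \<in> t_values 2"
    unfolding t_values_def using assms by (intro CollectI exI[of _ "[x, y]"]) (auto simp: admissible_iff)
  then show "t_val [x, y] \<in> zeta_values 1 \<union> beta_values \<union> zeta_values 2 \<union> t_values 2"
    by blast
qed

text \<open>Single t-values are not among the generators. With sign 1 they are
  \<open>1 - 1 / 2 ^ s\<close> times a zeta value, with sign -1 they are minus a beta value.\<close>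

lemma t_1_in_values_ring:
  assumes x: "admissible_index x" shows "t_val [x] \<in> values_ring"
proof (cases "snd x = 1")
  case True
  obtain s where s: "x = (s, 1)" using True by (cases x) auto
  \<comment> \<open>The first \<open>2 * N\<close> terms are split by parity; the even ones are the
    first \<open>N\<close> terms divided by \<open>2 ^ s\<close>.\<close>
  have "nested_sum [signed_term real x] (2 * N) =
        nested_sum [signed_term real x] N / 2 ^ s + nested_sum [signed_term odd_denom x] N" for N
  proof (induction N)
    case (Suc N)
    have odd_eq: "2 * real (Suc N) - 1 = real (Suc (2 * N))" by simp
    have "real (Suc (Suc (2 * N))) = 2 * real (Suc N)" by simp
    then have even_eq: "1 / real (Suc (Suc (2 * N))) ^ s = 1 / real (Suc N) ^ s / 2 ^ s"
      by (simp only: power_mult_distrib) (simp add: mult.commute)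
    have "2 * Suc N = Suc (Suc (2 * N))" by simp
    then show ?case using Suc
      by (simp del: of_nat_Suc mult_Suc_right add: s odd_denom_def odd_eq even_eq add_divide_distrib)
  qed auto
  moreover have "(\<lambda>N. nested_sum [signed_term real x] (2 * N)) \<longlonglongrightarrow> zeta_val [x]"
    by (rule filterlim_compose[OF zeta_tendsto_1[OF x]])
       (auto intro: filterlim_subseq simp: strict_mono_def)
  ultimately have "(\<lambda>N. nested_sum [signed_term real x] N / 2 ^ s + nested_sum [signed_term odd_denom x] N)
       \<longlonglongrightarrow> zeta_val [x]" by simp
  moreover have "(\<lambda>N. nested_sum [signed_term real x] N / 2 ^ s + nested_sum [signed_term odd_denom x] N)
       \<longlonglongrightarrow> zeta_val [x] / 2 ^ s + t_val [x]"
    by (intro tendsto_intros zeta_tendsto_1[OF x] t_tendsto_1[OF x]) auto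
  ultimately have "zeta_val [x] = zeta_val [x] / 2 ^ s + t_val [x]" by (rule LIMSEQ_unique)
  then have "t_val [x] = zeta_val [x] - (1 / 2 ^ s) * zeta_val [x]" by simp
  then show ?thesis
    using zeta_1_in_values_ring[OF x]
    by (metis (no_types) Rats_1 Rats_divide Rats_number_of Rats_power values_ring_intros(2,3,5))
next
  case False
  obtain s where s: "x = (s, -1)" "s \<ge> 1"
    using False x by (cases x) (auto simp: admissible_index_def valid_index_def)
  have "(\<Sum>n = 1..N. (-1) ^ (n - 1) / (2 * real n - 1) ^ s) = - nested_sum [signed_term odd_denom x] N" for N
    unfolding nested_sum_single sum_negf[symmetric]
    by (intro sum.cong refl) (auto simp: s odd_denom_def power_eq_if)
  then have "beta_val s = lim (\<lambda>N. - nested_sum [signed_term odd_denom x] N)"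
    by (simp add: beta_val_def)
  also have "\<dots> = - t_val [x]" by (intro limI tendsto_minus t_tendsto_1 x)
  finally have "t_val [x] = - beta_val s" by simp
  moreover have "beta_val s \<in> values_ring"
    unfolding values_ring_def by (intro rat_polynomials_in_base) (use s in \<open>auto simp: beta_values_def\<close>)
  ultimately show ?thesis by (simp add: values_ring_intros(4))
qed

subsection \<open>Partial fractions with three poles\<close>

text \<open>The variable is \<open>a\<close> and the pole is \<open>u\<close>; the powers of the
  differences to the other poles \<open>v\<close> and \<open>w\<close> form the coefficient, which
  is constant in \<open>a\<close>.\<close>

definition pole_term :: "real \<Rightarrow> nat \<Rightarrow> nat \<Rightarrow> nat \<Rightarrow> real \<Rightarrow> real \<Rightarrow> real \<Rightarrow> real" where
  "pole_term a j \<alpha> \<beta> u v w = inverse (a - u) ^ j * inverse (u - v) ^ \<alpha> * inverse (u - w) ^ \<beta>"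

lemma DERIV_inverse_power_left:
  assumes "u \<noteq> (x :: real)"
  shows "((\<lambda>x. inverse (u - x) ^ n) has_real_derivative real n * inverse (u - x) ^ Suc n) (at x)"
proof -
  have "((\<lambda>x. inverse (u - x)) has_real_derivative inverse (u - x) ^ 2) (at x)"
    using assms by (auto intro!: derivative_eq_intros simp: power2_eq_square)
  from DERIV_power[OF this, of n] show ?thesis
    by (rule DERIV_cong) (cases n; simp add: power2_eq_square algebra_simps)
qed

lemma DERIV_inverse_power_right:
  assumes "u \<noteq> (x :: real)"
  shows "((\<lambda>x. inverse (x - u) ^ n) has_real_derivative - real n * inverse (x - u) ^ Suc n) (at x)"
proof -
  have "((\<lambda>x. inverse (x - u)) has_real_derivative - (inverse (x - u) ^ 2)) (at x)"
    using assms by (auto intro!: derivative_eq_intros simp: power2_eq_square)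
  from DERIV_power[OF this, of n] show ?thesis
    by (rule DERIV_cong) (cases n; simp add: power2_eq_square algebra_simps)
qed

lemma DERIV_mult_3:
  fixes f g h :: "real \<Rightarrow> real"
  assumes "(f has_real_derivative f') (at x)" "(g has_real_derivative g') (at x)"
    "(h has_real_derivative h') (at x)"
  shows "((\<lambda>x. f x * g x * h x) has_real_derivative
           f' * g x * h x + f x * g' * h x + f x * g x * h') (at x)"
  by (rule DERIV_cong[OF DERIV_mult[OF DERIV_mult[OF assms(1,2)] assms(3)]]) (simp add: algebra_simps)

lemma DERIV_pole_term_pole:
  assumes "a \<noteq> u" "u \<noteq> v" "u \<noteq> w"
  shows "((\<lambda>u. pole_term a j \<alpha> \<beta> u v w) has_real_derivative
           real j * pole_term a (Suc j) \<alpha> \<beta> u v w + (- real \<alpha> * pole_term a j (Suc \<alpha>) \<beta> u v w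
             + - real \<beta> * pole_term a j \<alpha> (Suc \<beta>) u v w)) (at u)"
  unfolding pole_term_def
  by (rule DERIV_cong[OF DERIV_mult_3[OF DERIV_inverse_power_left DERIV_inverse_power_right
          DERIV_inverse_power_right]]) (use assms in \<open>simp_all add: algebra_simps\<close>)

lemma DERIV_pole_term_other:
  assumes "u \<noteq> v" "u \<noteq> w"
  shows "((\<lambda>v. pole_term a j \<alpha> \<beta> u v w) has_real_derivative
           real \<alpha> * pole_term a j (Suc \<alpha>) \<beta> u v w) (at v)"
    and "((\<lambda>w. pole_term a j \<alpha> \<beta> u v w) has_real_derivative
           real \<beta> * pole_term a j \<alpha> (Suc \<beta>) u v w) (at w)"
  unfolding pole_term_def
proof -
  show "((\<lambda>v. inverse (a - u) ^ j * inverse (u - v) ^ \<alpha> * inverse (u - w) ^ \<beta>) has_real_derivative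
      real \<alpha> * (inverse (a - u) ^ j * inverse (u - v) ^ Suc \<alpha> * inverse (u - w) ^ \<beta>)) (at v)"
    by (rule DERIV_cong[OF DERIV_mult_3[OF DERIV_const DERIV_inverse_power_left DERIV_const]])
       (use assms in \<open>simp_all add: algebra_simps\<close>)
  show "((\<lambda>w. inverse (a - u) ^ j * inverse (u - v) ^ \<alpha> * inverse (u - w) ^ \<beta>) has_real_derivative
      real \<beta> * (inverse (a - u) ^ j * inverse (u - v) ^ \<alpha> * inverse (u - w) ^ Suc \<beta>)) (at w)"
    by (rule DERIV_cong[OF DERIV_cmult[OF DERIV_inverse_power_left]])
       (use assms in \<open>simp_all add: algebra_simps\<close>)
qed

text \<open>
  Shapes of the partial fraction expansions of \<open>1 / ((a - x)\<^sup>m (a - y)\<^sup>p (a - z)\<^sup>q)\<close> in \<open>a\<close>. The lower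
  bounds on the exponents are what makes the resulting double zeta values convergent.
\<close>

inductive partial_fractions ::
    "nat \<Rightarrow> nat \<Rightarrow> nat \<Rightarrow> (real \<Rightarrow> real \<Rightarrow> real \<Rightarrow> real \<Rightarrow> real) \<Rightarrow> bool"
  for m p q where
  add: "partial_fractions m p q f \<Longrightarrow> partial_fractions m p q g \<Longrightarrow>
    partial_fractions m p q (\<lambda>x y z a. f x y z a + g x y z a)"
| pole_x: "c \<in> \<rat> \<Longrightarrow> j \<ge> 1 \<Longrightarrow> \<alpha> \<ge> p \<Longrightarrow> \<beta> \<ge> q \<Longrightarrow>
    partial_fractions m p q (\<lambda>x y z a. c * pole_term a j \<alpha> \<beta> x y z)"
| pole_y: "c \<in> \<rat> \<Longrightarrow> j \<ge> 1 \<Longrightarrow> \<alpha> \<ge> m \<Longrightarrow> \<beta> \<ge> q \<Longrightarrow>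
    partial_fractions m p q (\<lambda>x y z a. c * pole_term a j \<alpha> \<beta> y x z)"
| pole_z: "c \<in> \<rat> \<Longrightarrow> j \<ge> 1 \<Longrightarrow> \<alpha> \<ge> m \<Longrightarrow> \<beta> \<ge> p \<Longrightarrow>
    partial_fractions m p q (\<lambda>x y z a. c * pole_term a j \<alpha> \<beta> z x y)"

lemma partial_fractions_scale:
  assumes "partial_fractions m p q f" "r \<in> \<rat>"
  shows "partial_fractions m p q (\<lambda>x y z a. r * f x y z a)"
  using assms
proof (induction rule: partial_fractions.induct)
  case (add f g)
  then show ?case by (simp add: ring_distribs partial_fractions.add)
qed (use assms(2) in \<open>auto simp: mult.assoc[symmetric] intro!: partial_fractions.intros(2-4)\<close>)

text \<open>The bound \<open>m\<close> restricts only terms whose pole is not \<open>x\<close>. For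
  these, \<open>x\<close> occurs in exactly one coefficient factor, whose exponent the derivative
  raises, so the bound \<open>Suc m\<close> holds. In a term with pole \<open>x\<close> the
  derivative raises one of the three exponents and keeps the bounds \<open>p\<close> and
  \<open>q\<close>.\<close>

lemma partial_fractions_DERIV_x:
  assumes "partial_fractions m p q f"
  shows "\<exists>f'. partial_fractions (Suc m) p q f' \<and> (\<forall>x y z a. distinct [x, y, z, a] \<longrightarrow>
           ((\<lambda>x. f x y z a) has_real_derivative f' x y z a) (at x))"
  using assms
proof (induction rule: partial_fractions.induct)
  case (add f g)
  then obtain f' g' where fg:
    "partial_fractions (Suc m) p q f'" "partial_fractions (Suc m) p q g'"
    "\<forall>x y z a. distinct [x, y, z, a] \<longrightarrow> ((\<lambda>x. f x y z a) has_real_derivative f' x y z a) (at x)"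
    "\<forall>x y z a. distinct [x, y, z, a] \<longrightarrow> ((\<lambda>x. g x y z a) has_real_derivative g' x y z a) (at x)"
    by blast
  show ?case
    by (rule exI[of _ "\<lambda>x y z a. f' x y z a + g' x y z a"])
       (intro conjI partial_fractions.add fg allI impI DERIV_add fg(3,4)[rule_format])
next
  case (pole_x c j \<alpha> \<beta>)
  show ?case
    by (rule exI[of _ "\<lambda>x y z a. c * real j * pole_term a (Suc j) \<alpha> \<beta> x y z
         + (c * - real \<alpha> * pole_term a j (Suc \<alpha>) \<beta> x y z + c * - real \<beta> * pole_term a j \<alpha> (Suc \<beta>) x y z)"],
        intro conjI partial_fractions.add partial_fractions.pole_x allI impI,
        insert pole_x, auto intro!: DERIV_cmult[THEN DERIV_cong] DERIV_pole_term_pole simp: algebra_simps)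
next
  case (pole_y c j \<alpha> \<beta>)
  show ?case
    by (rule exI[of _ "\<lambda>x y z a. c * real \<alpha> * pole_term a j (Suc \<alpha>) \<beta> y x z"],
        intro conjI partial_fractions.pole_y allI impI,
        insert pole_y, auto intro!: DERIV_cmult[THEN DERIV_cong] DERIV_pole_term_other)
next
  case (pole_z c j \<alpha> \<beta>)
  show ?case
    by (rule exI[of _ "\<lambda>x y z a. c * real \<alpha> * pole_term a j (Suc \<alpha>) \<beta> z x y"],
        intro conjI partial_fractions.pole_z allI impI,
        insert pole_z, auto intro!: DERIV_cmult[THEN DERIV_cong] DERIV_pole_term_other)
qed

lemma partial_fractions_DERIV_y:
  assumes "partial_fractions m p q f"
  shows "\<exists>f'. partial_fractions m (Suc p) q f' \<and> (\<forall>x y z a. distinct [x, y, z, a] \<longrightarrow>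
           ((\<lambda>y. f x y z a) has_real_derivative f' x y z a) (at y))"
  using assms
proof (induction rule: partial_fractions.induct)
  case (add f g)
  then obtain f' g' where fg:
    "partial_fractions m (Suc p) q f'" "partial_fractions m (Suc p) q g'"
    "\<forall>x y z a. distinct [x, y, z, a] \<longrightarrow> ((\<lambda>y. f x y z a) has_real_derivative f' x y z a) (at y)"
    "\<forall>x y z a. distinct [x, y, z, a] \<longrightarrow> ((\<lambda>y. g x y z a) has_real_derivative g' x y z a) (at y)"
    by blast
  show ?case
    by (rule exI[of _ "\<lambda>x y z a. f' x y z a + g' x y z a"])
       (intro conjI partial_fractions.add fg allI impI DERIV_add fg(3,4)[rule_format])
next
  case (pole_x c j \<alpha> \<beta>)
  show ?case
    by (rule exI[of _ "\<lambda>x y z a. c * real \<alpha> * pole_term a j (Suc \<alpha>) \<beta> x y z"],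
        intro conjI partial_fractions.pole_x allI impI,
        insert pole_x, auto intro!: DERIV_cmult[THEN DERIV_cong] DERIV_pole_term_other)
next
  case (pole_y c j \<alpha> \<beta>)
  show ?case
    by (rule exI[of _ "\<lambda>x y z a. c * real j * pole_term a (Suc j) \<alpha> \<beta> y x z
         + (c * - real \<alpha> * pole_term a j (Suc \<alpha>) \<beta> y x z + c * - real \<beta> * pole_term a j \<alpha> (Suc \<beta>) y x z)"],
        intro conjI partial_fractions.add partial_fractions.pole_y allI impI,
        insert pole_y, auto intro!: DERIV_cmult[THEN DERIV_cong] DERIV_pole_term_pole simp: algebra_simps)
next
  case (pole_z c j \<alpha> \<beta>)
  show ?case
    by (rule exI[of _ "\<lambda>x y z a. c * real \<beta> * pole_term a j \<alpha> (Suc \<beta>) z x y"],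
        intro conjI partial_fractions.pole_z allI impI,
        insert pole_z, auto intro!: DERIV_cmult[THEN DERIV_cong] DERIV_pole_term_other)
qed

lemma partial_fractions_DERIV_z:
  assumes "partial_fractions m p q f"
  shows "\<exists>f'. partial_fractions m p (Suc q) f' \<and> (\<forall>x y z a. distinct [x, y, z, a] \<longrightarrow>
           ((\<lambda>z. f x y z a) has_real_derivative f' x y z a) (at z))"
  using assms
proof (induction rule: partial_fractions.induct)
  case (add f g)
  then obtain f' g' where fg:
    "partial_fractions m p (Suc q) f'" "partial_fractions m p (Suc q) g'"
    "\<forall>x y z a. distinct [x, y, z, a] \<longrightarrow> ((\<lambda>z. f x y z a) has_real_derivative f' x y z a) (at z)"
    "\<forall>x y z a. distinct [x, y, z, a] \<longrightarrow> ((\<lambda>z. g x y z a) has_real_derivative g' x y z a) (at z)"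
    by blast
  show ?case
    by (rule exI[of _ "\<lambda>x y z a. f' x y z a + g' x y z a"])
       (intro conjI partial_fractions.add fg allI impI DERIV_add fg(3,4)[rule_format])
next
  case (pole_x c j \<alpha> \<beta>)
  show ?case
    by (rule exI[of _ "\<lambda>x y z a. c * real \<beta> * pole_term a j \<alpha> (Suc \<beta>) x y z"],
        intro conjI partial_fractions.pole_x allI impI,
        insert pole_x, auto intro!: DERIV_cmult[THEN DERIV_cong] DERIV_pole_term_other)
next
  case (pole_y c j \<alpha> \<beta>)
  show ?case
    by (rule exI[of _ "\<lambda>x y z a. c * real \<beta> * pole_term a j \<alpha> (Suc \<beta>) y x z"],
        intro conjI partial_fractions.pole_y allI impI,
        insert pole_y, auto intro!: DERIV_cmult[THEN DERIV_cong] DERIV_pole_term_other)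
next
  case (pole_z c j \<alpha> \<beta>)
  show ?case
    by (rule exI[of _ "\<lambda>x y z a. c * real j * pole_term a (Suc j) \<alpha> \<beta> z x y
         + (c * - real \<alpha> * pole_term a j (Suc \<alpha>) \<beta> z x y + c * - real \<beta> * pole_term a j \<alpha> (Suc \<beta>) z x y)"],
        intro conjI partial_fractions.add partial_fractions.pole_z allI impI,
        insert pole_z, auto intro!: DERIV_cmult[THEN DERIV_cong] DERIV_pole_term_pole simp: algebra_simps)
qed

definition three_poles :: "nat \<Rightarrow> nat \<Rightarrow> nat \<Rightarrow> real \<Rightarrow> real \<Rightarrow> real \<Rightarrow> real \<Rightarrow> real" where
  "three_poles m p q x y z a = inverse (a - x) ^ m * inverse (a - y) ^ p * inverse (a - z) ^ q"

text \<open>Expansions are known only where poles and variable are distinct; the finite exceptional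
  set is closed, so equality holds in a neighbourhood and can be differentiated.\<close>

lemma DERIV_eq_on_cofinite:
  fixes f g :: "real \<Rightarrow> real"
  assumes "(f has_real_derivative f') (at x)" "(g has_real_derivative g') (at x)"
    "\<And>t. t \<notin> S \<Longrightarrow> f t = g t" "finite S" "x \<notin> S"
  shows "f' = g'"
proof -
  have "(g has_real_derivative f') (at x)"
    by (rule has_field_derivative_transform_within_open[OF assms(1), of "- S"])
       (use assms finite_imp_closed[OF assms(4)] in auto)
  then show ?thesis using assms(2) DERIV_unique by blast
qed

text \<open>Differentiating with respect to a pole raises its multiplicity.\<close>

lemma partial_fractions_exists:
  "\<exists>f. partial_fractions (Suc m) (Suc p) (Suc q) f \<and>
     (\<forall>x y z a. distinct [x, y, z, a] \<longrightarrow> three_poles (Suc m) (Suc p) (Suc q) x y z a = f x y z a)"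
    (is "?P m p q")
proof -
  have step_x: "?P (Suc m) p q" if "?P m p q" for m p q
  proof -
    obtain f where f: "partial_fractions (Suc m) (Suc p) (Suc q) f"
      "\<And>x y z a. distinct [x, y, z, a] \<Longrightarrow> three_poles (Suc m) (Suc p) (Suc q) x y z a = f x y z a"
      using \<open>?P m p q\<close> by blast
    obtain f' where f': "partial_fractions (Suc (Suc m)) (Suc p) (Suc q) f'"
      "\<And>x y z a. distinct [x, y, z, a] \<Longrightarrow> ((\<lambda>x. f x y z a) has_real_derivative f' x y z a) (at x)"
      using partial_fractions_DERIV_x[OF f(1)] by blast
    \<comment> \<open>Differentiation brings down the multiplicity \<open>Suc m\<close>; dividing by
      it keeps the coefficients rational.\<close>
    have "three_poles (Suc (Suc m)) (Suc p) (Suc q) x y z a = inverse (real (Suc m)) * f' x y z a"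
      if d: "distinct [x, y, z, a]" for x y z a
    proof -
      have D: "((\<lambda>x. three_poles (Suc m) (Suc p) (Suc q) x y z a) has_real_derivative
          real (Suc m) * three_poles (Suc (Suc m)) (Suc p) (Suc q) x y z a) (at x)"
        unfolding three_poles_def
        by (rule DERIV_cong[OF DERIV_mult_3[OF DERIV_inverse_power_left DERIV_const DERIV_const]])
           (use d in \<open>simp_all add: algebra_simps\<close>)
      have "real (Suc m) * three_poles (Suc (Suc m)) (Suc p) (Suc q) x y z a = f' x y z a"
        by (rule DERIV_eq_on_cofinite[OF D f'(2)[OF d], of "{y, z, a}"]) (use d f(2) in auto)
      then show ?thesis by (simp add: field_simps)
    qed
    then show ?thesis using partial_fractions_scale[OF f'(1), of "inverse (real (Suc m))"]
      by (intro exI[of _ "\<lambda>x y z a. inverse (real (Suc m)) * f' x y z a"]) auto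
  qed
  have step_y: "?P m (Suc p) q" if "?P m p q" for m p q
  proof -
    obtain f where f: "partial_fractions (Suc m) (Suc p) (Suc q) f"
      "\<And>x y z a. distinct [x, y, z, a] \<Longrightarrow> three_poles (Suc m) (Suc p) (Suc q) x y z a = f x y z a"
      using \<open>?P m p q\<close> by blast
    obtain f' where f': "partial_fractions (Suc m) (Suc (Suc p)) (Suc q) f'"
      "\<And>x y z a. distinct [x, y, z, a] \<Longrightarrow> ((\<lambda>y. f x y z a) has_real_derivative f' x y z a) (at y)"
      using partial_fractions_DERIV_y[OF f(1)] by blast
    have "three_poles (Suc m) (Suc (Suc p)) (Suc q) x y z a = inverse (real (Suc p)) * f' x y z a"
      if d: "distinct [x, y, z, a]" for x y z a
    proof -
      have D: "((\<lambda>y. three_poles (Suc m) (Suc p) (Suc q) x y z a) has_real_derivative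
          real (Suc p) * three_poles (Suc m) (Suc (Suc p)) (Suc q) x y z a) (at y)"
        unfolding three_poles_def
        by (rule DERIV_cong[OF DERIV_mult_3[OF DERIV_const DERIV_inverse_power_left DERIV_const]])
           (use d in \<open>simp_all add: algebra_simps\<close>)
      have "real (Suc p) * three_poles (Suc m) (Suc (Suc p)) (Suc q) x y z a = f' x y z a"
        by (rule DERIV_eq_on_cofinite[OF D f'(2)[OF d], of "{x, z, a}"]) (use d f(2) in auto)
      then show ?thesis by (simp add: field_simps)
    qed
    then show ?thesis using partial_fractions_scale[OF f'(1), of "inverse (real (Suc p))"]
      by (intro exI[of _ "\<lambda>x y z a. inverse (real (Suc p)) * f' x y z a"]) auto
  qed
  have step_z: "?P m p (Suc q)" if "?P m p q" for m p q
  proof -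
    obtain f where f: "partial_fractions (Suc m) (Suc p) (Suc q) f"
      "\<And>x y z a. distinct [x, y, z, a] \<Longrightarrow> three_poles (Suc m) (Suc p) (Suc q) x y z a = f x y z a"
      using \<open>?P m p q\<close> by blast
    obtain f' where f': "partial_fractions (Suc m) (Suc p) (Suc (Suc q)) f'"
      "\<And>x y z a. distinct [x, y, z, a] \<Longrightarrow> ((\<lambda>z. f x y z a) has_real_derivative f' x y z a) (at z)"
      using partial_fractions_DERIV_z[OF f(1)] by blast
    have "three_poles (Suc m) (Suc p) (Suc (Suc q)) x y z a = inverse (real (Suc q)) * f' x y z a"
      if d: "distinct [x, y, z, a]" for x y z a
    proof -
      have D: "((\<lambda>z. three_poles (Suc m) (Suc p) (Suc q) x y z a) has_real_derivative
          real (Suc q) * three_poles (Suc m) (Suc p) (Suc (Suc q)) x y z a) (at z)"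
        unfolding three_poles_def
        by (rule DERIV_cong[OF DERIV_mult_3[OF DERIV_const DERIV_const DERIV_inverse_power_left]])
           (use d in \<open>simp_all add: algebra_simps\<close>)
      have "real (Suc q) * three_poles (Suc m) (Suc p) (Suc (Suc q)) x y z a = f' x y z a"
        by (rule DERIV_eq_on_cofinite[OF D f'(2)[OF d], of "{x, y, a}"]) (use d f(2) in auto)
      then show ?thesis by (simp add: field_simps)
    qed
    then show ?thesis using partial_fractions_scale[OF f'(1), of "inverse (real (Suc q))"]
      by (intro exI[of _ "\<lambda>x y z a. inverse (real (Suc q)) * f' x y z a"]) auto
  qed
  \<comment> \<open>For simple poles the coefficients are the residues, products of two inverse
    differences of poles.\<close>
  have base: "?P 0 0 0"
  proof (intro exI conjI allI impI)
    show "partial_fractions (Suc 0) (Suc 0) (Suc 0) (\<lambda>x y z a. 1 * pole_term a 1 1 1 x y z +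
        (1 * pole_term a 1 1 1 y x z + 1 * pole_term a 1 1 1 z x y))"
      by (intro partial_fractions.intros) auto
    fix x y z a :: real assume "distinct [x, y, z, a]"
    then have d: "x - y \<noteq> 0" "x - z \<noteq> 0" "y - z \<noteq> 0" "a - x \<noteq> 0" "a - y \<noteq> 0" "a - z \<noteq> 0"
      by auto
    have neg: "inverse (y - x) = - inverse (x - y)" "inverse (z - x) = - inverse (x - z)"
      "inverse (z - y) = - inverse (y - z)"
      by (simp_all flip: inverse_minus_eq)
    show "three_poles (Suc 0) (Suc 0) (Suc 0) x y z a = 1 * pole_term a 1 1 1 x y z +
        (1 * pole_term a 1 1 1 y x z + 1 * pole_term a 1 1 1 z x y)"
      unfolding three_poles_def pole_term_def neg using d
      by (simp add: divide_simps) (simp add: algebra_simps)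
  qed
  have "?P m 0 0" by (induction m) (use base step_x in blast)+
  then have "?P m p 0" by (induction p) (use step_y in blast)+
  then show ?thesis by (induction q) (use step_z in blast)+
qed

subsection \<open>Sums over all odd integers\<close>

text \<open>The power of a sign with an arbitrary integer exponent, where only the parity
  matters.\<close>

definition sign_char :: "int \<Rightarrow> int \<Rightarrow> real" where
  "sign_char \<sigma> n = (if even n then 1 else of_int \<sigma>)"

lemma sign_char_nat: "\<sigma> \<in> {1, -1} \<Longrightarrow> sign_char \<sigma> (int n) = of_int \<sigma> ^ n"
  by (auto simp: sign_char_def)

lemma abs_sign_char: "\<sigma> \<in> {1, -1} \<Longrightarrow> \<bar>sign_char \<sigma> n\<bar> = 1"
  by (auto simp: sign_char_def)

fun odd_term :: "nat \<times> int \<Rightarrow> int \<Rightarrow> real" where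
  "odd_term (s, \<sigma>) n = sign_char \<sigma> n * inverse (2 * of_int n - 1) ^ s"

fun reflection_sign :: "nat \<times> int \<Rightarrow> real" where
  "reflection_sign (s, \<sigma>) = of_int \<sigma> * (-1) ^ s"

lemma odd_term_nat: "valid_index x \<Longrightarrow> odd_term x (int n) = signed_term odd_denom x n"
  by (cases x) (auto simp: valid_index_def odd_denom_def divide_inverse power_inverse sign_char_def)

text \<open>Passing from \<open>n\<close> to \<open>1 - n\<close> negates the odd number
  \<open>2 * n - 1\<close>, which gives \<open>(-1) ^ s\<close>, and flips the parity of
  \<open>n\<close>, which gives the sign itself.\<close>

lemma odd_term_reflect:
  assumes "valid_index x" shows "odd_term x (1 - n) = reflection_sign x * odd_term x n"
proof (cases x)
  case (Pair s \<sigma>)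
  have "inverse (2 * of_int (1 - n) - 1 :: real) = - inverse (2 * of_int n - 1)"
    by (simp flip: inverse_minus_eq)
  then have "inverse (2 * of_int (1 - n) - 1 :: real) ^ s = (-1) ^ s * inverse (2 * of_int n - 1) ^ s"
    by (simp only: power_minus[of "inverse _"])
  then show ?thesis using assms Pair by (auto simp: valid_index_def sign_char_def)
qed

lemma abs_odd_term_le:
  assumes "valid_index x" shows "\<bar>odd_term x n\<bar> \<le> 1 / \<bar>2 * of_int n - 1\<bar>"
proof (cases x)
  case (Pair s \<sigma>)
  have *: "\<bar>2 * of_int n - 1 :: real\<bar> \<ge> 1"
  proof -
    have "\<bar>2 * n - 1\<bar> \<ge> 1" by presburger
    then have "of_int \<bar>2 * n - 1\<bar> \<ge> (1 :: real)" by linarith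
    then show ?thesis by simp
  qed
  have "\<bar>odd_term x n\<bar> = (1 / \<bar>2 * of_int n - 1\<bar>) ^ s"
    using assms by (auto simp: Pair valid_index_def abs_mult abs_sign_char power_abs divide_inverse)
  also have "\<dots> \<le> (1 / \<bar>2 * of_int n - 1\<bar>) ^ 1"
    using * assms by (intro power_decreasing) (auto simp: Pair valid_index_def)
  finally show ?thesis by simp
qed

text \<open>A sum over all integers that pairs the odd numbers \<open>2 * n + 1\<close> and
  \<open>- (2 * n + 1)\<close>. The pairing is essential for exponent 1, where the one-sided sums
  may diverge.\<close>

definition bisums :: "(int \<Rightarrow> real) \<Rightarrow> real \<Rightarrow> bool" where
  "bisums h s \<longleftrightarrow> (\<lambda>n. h (int n + 1) + h (- int n)) sums s"

text \<open>A shift changes the paired series by two telescoping series whose sums cancel: both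
  involve \<open>h 1\<close> for the forward shift and \<open>h 0\<close> for the backward one. The
  remaining boundary terms vanish by the decay at both ends.\<close>

lemma bisums_shift_1:
  assumes "bisums h s" "(\<lambda>n. h (int n)) \<longlonglongrightarrow> 0" "(\<lambda>n. h (- int n)) \<longlonglongrightarrow> 0"
  shows "bisums (\<lambda>n. h (n + 1)) s" "bisums (\<lambda>n. h (n - 1)) s"
proof -
  have 1: "(\<lambda>n. h (int n + 1)) \<longlonglongrightarrow> 0"
    using LIMSEQ_Suc[OF assms(2)] by (simp add: algebra_simps)
  have 2: "(\<lambda>n. h (int n + 2) - h (int n + 1)) sums (0 - h 1)"
    using telescope_sums[OF 1] by (simp add: algebra_simps)
  have 3: "(\<lambda>n. h (- int n) - h (- int n - 1)) sums (h 0 - 0)"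
  proof -
    have eq: "- int n - 1 = - int (Suc n)" for n by simp
    show ?thesis unfolding eq using telescope_sums'[OF assms(3)] by simp
  qed
  have 4: "(\<lambda>n. h (int n) - h (int n + 1)) sums (h 0 - 0)"
    using telescope_sums'[OF assms(2)] by (simp add: algebra_simps)
  have 5: "(\<lambda>n. h (1 - int n) - h (- int n)) sums (h 1 - 0)"
  proof -
    have "(\<lambda>n. h (1 - int n)) \<longlonglongrightarrow> 0"
      by (subst filterlim_sequentially_Suc[symmetric]) (use assms(3) in simp)
    from telescope_sums'[OF this] show ?thesis by (simp add: algebra_simps)
  qed
  show "bisums (\<lambda>n. h (n + 1)) s"
    using sums_add[OF sums_add[OF assms(1)[unfolded bisums_def] 2] 5]
    unfolding bisums_def by (simp add: algebra_simps)
  show "bisums (\<lambda>n. h (n - 1)) s"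
    using sums_diff[OF sums_add[OF assms(1)[unfolded bisums_def] 4] 3]
    unfolding bisums_def by (simp add: algebra_simps)
qed

lemma LIMSEQ_inverse_abs_odd:
  "(\<lambda>n. 1 / \<bar>2 * of_int (int n + d) - 1 :: real\<bar>) \<longlonglongrightarrow> 0"
  "(\<lambda>n. 1 / \<bar>2 * of_int (- int n + d) - 1 :: real\<bar>) \<longlonglongrightarrow> 0"
  by real_asymp+

lemma odd_term_tendsto_0:
  assumes "valid_index x"
  shows "(\<lambda>n. odd_term x (int n + d)) \<longlonglongrightarrow> 0" "(\<lambda>n. odd_term x (- int n + d)) \<longlonglongrightarrow> 0"
proof -
  have "eventually (\<lambda>n. norm (odd_term x (int n + d)) \<le> 1 / \<bar>2 * of_int (int n + d) - 1\<bar>) sequentially"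
    unfolding real_norm_def by (intro always_eventually allI abs_odd_term_le[OF assms])
  then show "(\<lambda>n. odd_term x (int n + d)) \<longlonglongrightarrow> 0"
    by (rule Lim_null_comparison[OF _ LIMSEQ_inverse_abs_odd(1)])
  have "eventually (\<lambda>n. norm (odd_term x (- int n + d)) \<le> 1 / \<bar>2 * of_int (- int n + d) - 1\<bar>) sequentially"
    unfolding real_norm_def by (intro always_eventually allI abs_odd_term_le[OF assms])
  then show "(\<lambda>n. odd_term x (- int n + d)) \<longlonglongrightarrow> 0"
    by (rule Lim_null_comparison[OF _ LIMSEQ_inverse_abs_odd(2)])
qed

text \<open>Each pair contributes \<open>1 + reflection_sign x\<close> times a term of the t-series.
  For reflection sign -1 everything cancels, which includes the divergent index
  \<open>(1, 1)\<close>; for reflection sign 1 the index is therefore admissible and the sum is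
  twice its t-value. Shifts leave the sum unchanged.\<close>

lemma bisums_odd_term:
  assumes x: "valid_index x"
  obtains \<tau> where "\<tau> \<in> values_ring" "\<And>d. bisums (\<lambda>n. odd_term x (n + d)) \<tau>"
proof -
  have *: "odd_term x (int n + 1) + odd_term x (- int n) = (1 + reflection_sign x) * signed_term odd_denom x (Suc n)" for n
    using odd_term_reflect[OF x, of "int (Suc n)"] odd_term_nat[OF x, of "Suc n"]
    by (simp add: algebra_simps)
  have "\<exists>\<tau>\<in>values_ring. bisums (odd_term x) \<tau>"
  proof (cases "reflection_sign x = -1")
    case True
    then show ?thesis unfolding bisums_def * using values_ring_intros(5)[of 0]
      by (intro bexI[of _ 0]) (auto simp: sums_zero)
  next
    case False
    then have 1: "reflection_sign x = 1" using x
      by (cases x; cases "even (fst x)") (auto simp: valid_index_def)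
    have adm: "admissible_index x" using False x by (cases x) (auto simp: admissible_index_def)
    have "(\<lambda>n. signed_term odd_denom x (Suc n)) sums t_val [x]"
      using t_tendsto_1[OF adm] unfolding nested_sum_single sum_1_eq_lessThan sums_def .
    then have "bisums (odd_term x) (2 * t_val [x])"
      unfolding bisums_def * 1 using sums_mult[of _ "t_val [x]" 2] by simp
    then show ?thesis using t_1_in_values_ring[OF adm] values_ring_intros(2,5) by (metis Rats_number_of)
  qed
  then obtain \<tau> where \<tau>: "\<tau> \<in> values_ring" "bisums (odd_term x) \<tau>" by blast
  have pos: "bisums (\<lambda>n. odd_term x (n + int d)) \<tau>" for d
  proof (induction d)
    case (Suc d)
    show ?case using bisums_shift_1(1)[OF Suc] odd_term_tendsto_0[OF x, of "int d"]
      by (simp add: add_ac)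
  qed (use \<tau> in simp)
  have neg: "bisums (\<lambda>n. odd_term x (n - int d)) \<tau>" for d
  proof (induction d)
    case (Suc d)
    show ?case using bisums_shift_1(2)[OF Suc] odd_term_tendsto_0[OF x, of "- int d"]
      by (simp add: algebra_simps)
  qed (use \<tau> in simp)
  have "bisums (\<lambda>n. odd_term x (n + d)) \<tau>" for d
    by (cases d rule: int_cases2) (use pos neg in auto)
  with \<tau> show ?thesis by (intro that)
qed

declare signed_term.simps [simp del]

subsection \<open>Evaluation by partial fractions\<close>

locale parity_triple =
  fixes m p q :: nat and \<sigma>1 \<sigma>2 \<sigma>3 :: int
  assumes admissible_1: "admissible_index (m, \<sigma>1)"
    and valid_2: "valid_index (p, \<sigma>2)"
    and valid_3: "valid_index (q, \<sigma>3)"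
    and admissible_2_or_3: "admissible_index (p, \<sigma>2) \<or> admissible_index (q, \<sigma>3)"
    and reflection_sign_prod:
      "reflection_sign (m, \<sigma>1) * reflection_sign (p, \<sigma>2) * reflection_sign (q, \<sigma>3) = 1"
begin

lemma signs: "\<sigma>1 \<in> {1, -1}" "\<sigma>2 \<in> {1, -1}" "\<sigma>3 \<in> {1, -1}"
  using admissible_1 valid_2 valid_3 by (auto simp: admissible_index_def valid_index_def)

lemma exponents: "m \<ge> 1" "p \<ge> 1" "q \<ge> 1"
  using admissible_1 valid_2 valid_3 by (auto simp: admissible_index_def valid_index_def)

lemma valid_1: "valid_index (m, \<sigma>1)"
  using admissible_1 by (rule admissible_indexD)

text \<open>The counterterm that regularises sums over the third variable when \<open>(q, \<sigma>3) = (1, 1)\<close>.\<close>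

definition counterterm :: "nat \<Rightarrow> real" where
  "counterterm L = (if admissible_index (q, \<sigma>3) then 0 else nested_sum [signed_term odd_denom (q, \<sigma>3)] L)"

text \<open>The exceptional value \<open>2 * zeta_val [(1, -1)]\<close>, that is
  \<open>- 2 ln 2\<close>, is the limit of the harmonic sum up to \<open>L\<close> minus twice the
  sum of \<open>1 / (2n - 1)\<close> up to \<open>L\<close>. The factor of that subtraction is
  recorded in \<open>zeta_reg_coeff\<close>.\<close>

definition zeta_reg :: "nat \<Rightarrow> real" where
  "zeta_reg \<beta> = (if admissible_index (\<beta>, \<sigma>3) then zeta_val [(\<beta>, \<sigma>3)] else 2 * zeta_val [(1, -1)])"

definition zeta_reg_coeff :: "nat \<Rightarrow> real" where
  "zeta_reg_coeff \<beta> = (if admissible_index (\<beta>, \<sigma>3) then 0 else 2)"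

lemma zeta_reg_in_values_ring: "zeta_reg \<beta> \<in> values_ring"
proof -
  have "admissible_index (1, -1)" by (simp add: admissible_index_def valid_index_def)
  then show ?thesis unfolding zeta_reg_def
    by (auto intro: zeta_1_in_values_ring values_ring_intros(2)[OF values_ring_intros(5)])
qed

text \<open>The upper limit is \<open>k + L\<close> because the pole at \<open>-2k\<close> produces
  terms in \<open>k + l\<close>. The extra \<open>k\<close> terms vanish in the limit, so one
  counterterm in \<open>L\<close> serves all \<open>k\<close>.\<close>

lemma tendsto_zeta_reg:
  assumes "\<beta> \<ge> q"
  shows "(\<lambda>L. nested_sum [signed_term real (\<beta>, \<sigma>3)] (k + L) - counterterm L * zeta_reg_coeff \<beta>)
           \<longlonglongrightarrow> zeta_reg \<beta>"
proof (induction k)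
  case 0
  show ?case
  proof (cases "admissible_index (\<beta>, \<sigma>3)")
    case True
    then show ?thesis using zeta_tendsto_1[OF True] by (simp add: zeta_reg_def zeta_reg_coeff_def)
  next
    case False
    then have eq: "\<beta> = 1" "q = 1" "\<sigma>3 = 1"
      using assms exponents signs by (auto simp: admissible_index_def valid_index_def)
    have adm: "admissible_index (1, -1)" by (simp add: admissible_index_def valid_index_def)
    \<comment> \<open>In the alternating harmonic sum up to \<open>2 * L\<close> the even terms make
      up half the harmonic sum up to \<open>L\<close>, and the odd terms are minus the sum of
      \<open>1 / (2n - 1)\<close>.\<close>
    have "nested_sum [signed_term real (1, 1)] L - 2 * nested_sum [signed_term odd_denom (1, 1)] L =
        2 * nested_sum [signed_term real (1, -1)] (2 * L)" for L
    proof (induction L)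
      case (Suc L)
      have odd_eq: "2 * real (Suc L) - 1 = real (Suc (2 * L))" by simp
      have "1 / real (Suc L) = 2 / real (Suc (Suc (2 * L)))" "2 * Suc L = Suc (Suc (2 * L))"
        by (simp_all add: field_simps)
      then show ?case using Suc
        by (simp del: of_nat_Suc mult_Suc_right add: signed_term.simps odd_denom_def odd_eq)
    qed simp
    moreover have "(\<lambda>L. 2 * nested_sum [signed_term real (1, -1)] (2 * L)) \<longlonglongrightarrow> 2 * zeta_val [(1, -1)]"
      by (intro tendsto_mult tendsto_const filterlim_compose[OF zeta_tendsto_1[OF adm]])
         (auto intro: filterlim_subseq simp: strict_mono_def)
    moreover have "\<not> admissible_index (1, 1)" by (simp add: admissible_index_def)
    ultimately show ?thesis
      unfolding counterterm_def zeta_reg_def zeta_reg_coeff_def unfolding eq by (simp add: mult.commute)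
  qed
next
  case (Suc k)
  have valid: "valid_index (\<beta>, \<sigma>3)" using assms exponents signs by (auto simp: valid_index_def)
  have "(\<lambda>L. signed_term real (\<beta>, \<sigma>3) (Suc k + L)) \<longlonglongrightarrow> 0"
  proof (rule Lim_null_comparison)
    show "eventually (\<lambda>L. norm (signed_term real (\<beta>, \<sigma>3) (Suc k + L)) \<le> 1 / real (Suc k + L)) sequentially"
      unfolding real_norm_def
      by (intro always_eventually allI abs_signed_term_le_inverse[OF denominators_real valid]) auto
    show "(\<lambda>L. 1 / real (Suc k + L)) \<longlonglongrightarrow> 0"
      using LIMSEQ_ignore_initial_segment[OF LIMSEQ_const_over_Suc[of 1], of k]
      by (simp add: add.commute)
  qed
  from tendsto_add[OF Suc this] show ?case by (simp add: algebra_simps)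
qed

text \<open>
  The effect of summing the function \<open>f\<close>, evaluated at the odd integers with poles at \<open>-2k\<close>, \<open>0\<close>
  and \<open>2l\<close>, first over the odd integers, then over \<open>l\<close> and finally over \<open>k\<close>.
\<close>

definition evaluable :: "(real \<Rightarrow> real \<Rightarrow> real \<Rightarrow> real \<Rightarrow> real) \<Rightarrow> bool" where
  "evaluable f \<longleftrightarrow> (\<exists>E Q V v. v \<in> values_ring \<and>
     (\<forall>k\<ge>1. \<forall>l\<ge>1. bisums (\<lambda>n. sign_char \<sigma>1 (n + int k) * sign_char \<sigma>2 n * sign_char \<sigma>3 (n - int l) *
        f (- 2 * real k) 0 (2 * real l) (2 * of_int n - 1)) (E k l)) \<and>
     (\<forall>k\<ge>1. (\<lambda>L. (\<Sum>l = 1..L. E k l) - counterterm L * Q k) \<longlonglongrightarrow> V k) \<and>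
     (\<lambda>K. \<Sum>k = 1..K. V k) \<longlonglongrightarrow> v)"

text \<open>Meaning of the witnesses: \<open>E k l\<close> is the sum over the odd integers,
  \<open>Q k\<close> the coefficient of the divergence of its sum over \<open>l\<close>,
  \<open>V k\<close> the regularised sum over \<open>l\<close>, and \<open>v\<close> the
  total.\<close>

lemma evaluableI:
  assumes "v \<in> values_ring"
    "\<And>k l. k \<ge> 1 \<Longrightarrow> l \<ge> 1 \<Longrightarrow> bisums (\<lambda>n. sign_char \<sigma>1 (n + int k) * sign_char \<sigma>2 n *
        sign_char \<sigma>3 (n - int l) * f (- 2 * real k) 0 (2 * real l) (2 * of_int n - 1)) (E k l)"
    "\<And>k. k \<ge> 1 \<Longrightarrow> (\<lambda>L. (\<Sum>l = 1..L. E k l) - counterterm L * Q k) \<longlonglongrightarrow> V k"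
    "(\<lambda>K. \<Sum>k = 1..K. V k) \<longlonglongrightarrow> v"
  shows "evaluable f"
  unfolding evaluable_def using assms by blast

lemma bisums_add: "bisums f s \<Longrightarrow> bisums g t \<Longrightarrow> bisums (\<lambda>n. f n + g n) (s + t)"
  unfolding bisums_def by (drule (1) sums_add) (simp add: algebra_simps)

lemma bisums_cmult: "bisums f s \<Longrightarrow> bisums (\<lambda>n. c * f n) (c * s)"
  unfolding bisums_def by (drule sums_mult[where c = c]) (simp add: algebra_simps)

lemma evaluable_add:
  assumes "evaluable f" "evaluable g"
  shows "evaluable (\<lambda>x y z a. f x y z a + g x y z a)"
proof -
  obtain E Q V v where f: "v \<in> values_ring"
    "\<And>k l. k \<ge> 1 \<Longrightarrow> l \<ge> 1 \<Longrightarrow> bisums (\<lambda>n. sign_char \<sigma>1 (n + int k) * sign_char \<sigma>2 n *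
        sign_char \<sigma>3 (n - int l) * f (- 2 * real k) 0 (2 * real l) (2 * of_int n - 1)) (E k l)"
    "\<And>k. k \<ge> 1 \<Longrightarrow> (\<lambda>L. (\<Sum>l = 1..L. E k l) - counterterm L * Q k) \<longlonglongrightarrow> V k"
    "(\<lambda>K. \<Sum>k = 1..K. V k) \<longlonglongrightarrow> v"
    using assms(1) unfolding evaluable_def by blast
  obtain E' Q' V' v' where g: "v' \<in> values_ring"
    "\<And>k l. k \<ge> 1 \<Longrightarrow> l \<ge> 1 \<Longrightarrow> bisums (\<lambda>n. sign_char \<sigma>1 (n + int k) * sign_char \<sigma>2 n *
        sign_char \<sigma>3 (n - int l) * g (- 2 * real k) 0 (2 * real l) (2 * of_int n - 1)) (E' k l)"
    "\<And>k. k \<ge> 1 \<Longrightarrow> (\<lambda>L. (\<Sum>l = 1..L. E' k l) - counterterm L * Q' k) \<longlonglongrightarrow> V' k"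
    "(\<lambda>K. \<Sum>k = 1..K. V' k) \<longlonglongrightarrow> v'"
    using assms(2) unfolding evaluable_def by blast
  show ?thesis
  proof (rule evaluableI)
    show "v + v' \<in> values_ring" by (intro values_ring_intros f g)
    show "bisums (\<lambda>n. sign_char \<sigma>1 (n + int k) * sign_char \<sigma>2 n * sign_char \<sigma>3 (n - int l) *
        (f (- 2 * real k) 0 (2 * real l) (2 * of_int n - 1) + g (- 2 * real k) 0 (2 * real l) (2 * of_int n - 1)))
        (E k l + E' k l)" if "k \<ge> 1" "l \<ge> 1" for k l
      using bisums_add[OF f(2)[OF that] g(2)[OF that]] by (simp add: algebra_simps)
    show "(\<lambda>L. (\<Sum>l = 1..L. E k l + E' k l) - counterterm L * (Q k + Q' k)) \<longlonglongrightarrow> V k + V' k"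
      if "k \<ge> 1" for k
      using tendsto_add[OF f(3)[OF that] g(3)[OF that]] by (simp add: algebra_simps sum.distrib)
    show "(\<lambda>K. \<Sum>k = 1..K. V k + V' k) \<longlonglongrightarrow> v + v'"
      using tendsto_add[OF f(4) g(4)] by (simp add: sum.distrib)
  qed
qed

text \<open>One identity per pole. The dependence on \<open>n\<close> is collected in the product
  character, taken at the shift belonging to that pole; what remains are sign powers whose exponents
  are half the distances to the other two poles.\<close>

lemma sign_char_regroup:
  "sign_char \<sigma>1 (n + int k) * sign_char \<sigma>2 n * sign_char \<sigma>3 (n - int l) =
     of_int \<sigma>2 ^ k * of_int \<sigma>3 ^ (k + l) * sign_char (\<sigma>1 * \<sigma>2 * \<sigma>3) (n + int k)"
  "sign_char \<sigma>1 (n + int k) * sign_char \<sigma>2 n * sign_char \<sigma>3 (n - int l) =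
     of_int \<sigma>1 ^ k * of_int \<sigma>3 ^ l * sign_char (\<sigma>1 * \<sigma>2 * \<sigma>3) n"
  "sign_char \<sigma>1 (n + int k) * sign_char \<sigma>2 n * sign_char \<sigma>3 (n - int l) =
     of_int \<sigma>1 ^ (l + k) * of_int \<sigma>2 ^ l * sign_char (\<sigma>1 * \<sigma>2 * \<sigma>3) (n + - int l)"
  unfolding sign_char_nat[OF signs(1), symmetric] sign_char_nat[OF signs(2), symmetric]
    sign_char_nat[OF signs(3), symmetric]
  using signs by (auto simp: sign_char_def)

lemma valid_prod: "j \<ge> 1 \<Longrightarrow> valid_index (j, \<sigma>1 * \<sigma>2 * \<sigma>3)"
  using signs by (auto simp: valid_index_def)

lemma inverse_scaled_power: "inverse (c * real k) ^ \<alpha> = inverse c ^ \<alpha> * (1 / real k ^ \<alpha>)"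
  by (simp add: power_mult_distrib divide_inverse power_inverse)

lemma nested_sum_single_diff:
  "(\<Sum>l = 1..L. f (k + l)) = nested_sum [f] (k + L) - nested_sum [f] k"
  by (induction L) auto

text \<open>The sum over the odd integers leaves \<open>Y k * Z (k + l)\<close>; summation over
  \<open>l\<close> then gives \<open>Y k\<close> times a regularised tail of \<open>Z\<close>, and
  it remains to sum over \<open>k\<close>.\<close>

lemma evaluable_pole_x:
  assumes "c \<in> \<rat>" "j \<ge> 1" "\<alpha> \<ge> p" "\<beta> \<ge> q"
  shows "evaluable (\<lambda>x y z a. c * pole_term a j \<alpha> \<beta> x y z)"
proof -
  obtain \<tau> where \<tau>: "\<tau> \<in> values_ring" "\<And>d. bisums (\<lambda>n. odd_term (j, \<sigma>1 * \<sigma>2 * \<sigma>3) (n + d)) \<tau>"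
    using bisums_odd_term[OF valid_prod[OF assms(2)]] by blast
  \<comment> \<open>The distances from the pole \<open>-2k\<close> to the others are
    \<open>-2k\<close> and \<open>-2(k + l)\<close>.\<close>
  define \<kappa> where "\<kappa> = c * inverse (-2) ^ \<alpha> * inverse (-2) ^ \<beta> * \<tau>"
  define Y where "Y = signed_term real (\<alpha>, \<sigma>2)"
  define Z where "Z = signed_term real (\<beta>, \<sigma>3)"
  have \<kappa>: "\<kappa> \<in> values_ring"
    unfolding \<kappa>_def using assms(1) \<tau>(1) by (intro values_ring_intros(2)) (auto intro!: values_ring_intros(5))
  have valid: "valid_index (\<alpha>, \<sigma>2)" "valid_index (\<beta>, \<sigma>3)"
    using assms exponents signs by (auto simp: valid_index_def)
  have "\<exists>v\<in>values_ring. (\<lambda>K. \<Sum>k = 1..K. Y k * (zeta_reg \<beta> - nested_sum [Z] k)) \<longlonglongrightarrow> v"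
  proof (cases "admissible_index (\<alpha>, \<sigma>2)")
    case True
    \<comment> \<open>With \<open>Y\<close> admissible the tail may be split; the inner sum includes
      the index \<open>k\<close> itself, hence the merged term.\<close>
    have "(\<Sum>k = 1..K. Y k * (zeta_reg \<beta> - nested_sum [Z] k)) =
        nested_sum [Y] K * zeta_reg \<beta> - nested_sum [Y, Z] K - nested_sum [\<lambda>n. Y n * Z n] K" for K
      by (induction K) (auto simp: algebra_simps)
    moreover have "(\<lambda>K. nested_sum [Y] K * zeta_reg \<beta> - nested_sum [Y, Z] K - nested_sum [\<lambda>n. Y n * Z n] K)
        \<longlonglongrightarrow> zeta_val [(\<alpha>, \<sigma>2)] * zeta_reg \<beta> - zeta_val [(\<alpha>, \<sigma>2), (\<beta>, \<sigma>3)]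
              - zeta_val [merge_index (\<alpha>, \<sigma>2) (\<beta>, \<sigma>3)]"
      unfolding Y_def Z_def signed_term_merge_fun
      by (intro tendsto_intros zeta_tendsto_1 zeta_tendsto_2 True valid admissible_merge_index)
    moreover have "zeta_val [(\<alpha>, \<sigma>2)] * zeta_reg \<beta> - zeta_val [(\<alpha>, \<sigma>2), (\<beta>, \<sigma>3)]
              - zeta_val [merge_index (\<alpha>, \<sigma>2) (\<beta>, \<sigma>3)] \<in> values_ring"
      by (intro values_ring_intros(2,3) zeta_1_in_values_ring zeta_2_in_values_ring zeta_reg_in_values_ring
          True valid admissible_merge_index)
    ultimately show ?thesis by auto
  next
    case False
    \<comment> \<open>Now \<open>(\<alpha>, \<sigma>2) = (1, 1)\<close>, so \<open>Y\<close>
      diverges and nothing can be split. But the third index is then admissible, and the sum over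
      tails is the double zeta value with \<open>Z\<close> outermost.\<close>
    then have "\<not> admissible_index (p, \<sigma>2)"
      using assms exponents by (auto simp: admissible_index_def valid_index_def)
    then have adm: "admissible_index (\<beta>, \<sigma>3)"
      using admissible_2_or_3 assms exponents by (auto simp: admissible_index_def valid_index_def)
    have z: "(\<lambda>N. \<Sum>n = 1..N. Z n) \<longlonglongrightarrow> zeta_reg \<beta>"
      using zeta_tendsto_1[OF adm] adm by (simp add: zeta_reg_def Z_def nested_sum_single[abs_def])
    have Y1: "\<bar>Y n\<bar> \<le> 1 / sqrt (real n)" if "n \<ge> 1" for n
      using abs_signed_term_le_inverse[OF denominators_real valid(1) that]
        divide_self_le_divide_sqrt[OF that, of 1] unfolding Y_def by linarith
    obtain l where l: "(\<lambda>N. \<Sum>n = 1..N. Z n * (\<Sum>k = 1..n - 1. Y k)) \<longlonglongrightarrow> l"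
      "\<And>K. summable (\<lambda>k. Y (Suc k) * (\<Sum>i = 1..K. Z (Suc k + i)))"
      "(\<lambda>K. \<Sum>k. Y (Suc k) * (\<Sum>i = 1..K. Z (Suc k + i))) \<longlonglongrightarrow> l"
      "(\<lambda>K. \<Sum>k = 1..K. Y k * (zeta_reg \<beta> - (\<Sum>n = 1..k. Z n))) \<longlonglongrightarrow> l"
      using nested_sum_limits_signed_term[OF denominators_real adm Y1 z[unfolded Z_def]]
        unfolding Z_def by blast
    have "nested_sum [Z, Y] = (\<lambda>N. \<Sum>n = 1..N. Z n * (\<Sum>k = 1..n - 1. Y k))"
      unfolding nested_sum_Cons[of Z, abs_def] nested_sum_single ..
    then have "l = zeta_val [(\<beta>, \<sigma>3), (\<alpha>, \<sigma>2)]"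
      using LIMSEQ_unique[OF l(1)] zeta_tendsto_2[OF adm valid(1)] unfolding Y_def Z_def by metis
    then show ?thesis
      using l(4) zeta_2_in_values_ring[OF adm valid(1)] by (auto simp: nested_sum_single)
  qed
  then obtain v where v: "v \<in> values_ring" "(\<lambda>K. \<Sum>k = 1..K. Y k * (zeta_reg \<beta> - nested_sum [Z] k)) \<longlonglongrightarrow> v"
    by blast
  show ?thesis
  proof (rule evaluableI[where E = "\<lambda>k l. \<kappa> * Y k * Z (k + l)" and Q = "\<lambda>k. \<kappa> * Y k * zeta_reg_coeff \<beta>"
        and V = "\<lambda>k. \<kappa> * (Y k * (zeta_reg \<beta> - nested_sum [Z] k))" and v = "\<kappa> * v"])
    show "\<kappa> * v \<in> values_ring" by (intro values_ring_intros \<kappa> v)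
    show "(\<lambda>K. \<Sum>k = 1..K. \<kappa> * (Y k * (zeta_reg \<beta> - nested_sum [Z] k))) \<longlonglongrightarrow> \<kappa> * v"
      unfolding sum_distrib_left[symmetric] by (intro tendsto_intros v)
    fix k :: nat assume "k \<ge> 1"
    have "(\<lambda>L. \<kappa> * Y k * (nested_sum [Z] (k + L) - counterterm L * zeta_reg_coeff \<beta> - nested_sum [Z] k))
        \<longlonglongrightarrow> \<kappa> * Y k * (zeta_reg \<beta> - nested_sum [Z] k)"
      unfolding Z_def by (intro tendsto_intros tendsto_zeta_reg assms)
    then show "(\<lambda>L. (\<Sum>l = 1..L. \<kappa> * Y k * Z (k + l)) - counterterm L * (\<kappa> * Y k * zeta_reg_coeff \<beta>))
        \<longlonglongrightarrow> \<kappa> * (Y k * (zeta_reg \<beta> - nested_sum [Z] k))"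
      unfolding sum_distrib_left[symmetric] nested_sum_single_diff by (simp add: algebra_simps)
    fix l :: nat assume "l \<ge> 1"
    define K where "K = c * (inverse (-2) ^ \<alpha> * Y k) * (inverse (-2) ^ \<beta> * Z (k + l))"
    have eq: "sign_char \<sigma>1 (n + int k) * sign_char \<sigma>2 n * sign_char \<sigma>3 (n - int l) *
        (c * pole_term (2 * of_int n - 1) j \<alpha> \<beta> (- 2 * real k) 0 (2 * real l)) =
        K * odd_term (j, \<sigma>1 * \<sigma>2 * \<sigma>3) (n + int k)" for n
    proof -
      have "2 * of_int n - 1 - - 2 * real k = 2 * of_int (n + int k) - 1" "- 2 * real k - 0 = (-2) * real k"
        "- 2 * real k - 2 * real l = (-2) * real (k + l)" by simp_all
      then show ?thesis
        unfolding sign_char_regroup(1) pole_term_def odd_term.simps K_def Y_def Z_def signed_term.simps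
        by (simp only: inverse_scaled_power) (simp add: mult_ac)
    qed
    have \<kappa>_eq: "\<kappa> * Y k * Z (k + l) = K * \<tau>" by (simp add: K_def \<kappa>_def mult_ac)
    show "bisums (\<lambda>n. sign_char \<sigma>1 (n + int k) * sign_char \<sigma>2 n * sign_char \<sigma>3 (n - int l) *
        (c * pole_term (2 * of_int n - 1) j \<alpha> \<beta> (- 2 * real k) 0 (2 * real l))) (\<kappa> * Y k * Z (k + l))"
      unfolding eq \<kappa>_eq by (rule bisums_cmult[OF \<tau>(2)])
  qed
qed

text \<open>The middle pole decouples the gaps: \<open>Y k * Z l\<close> yields products of single
  zeta values.\<close>

lemma evaluable_pole_y:
  assumes "c \<in> \<rat>" "j \<ge> 1" "\<alpha> \<ge> m" "\<beta> \<ge> q"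
  shows "evaluable (\<lambda>x y z a. c * pole_term a j \<alpha> \<beta> y x z)"
proof -
  obtain \<tau> where \<tau>: "\<tau> \<in> values_ring" "\<And>d. bisums (\<lambda>n. odd_term (j, \<sigma>1 * \<sigma>2 * \<sigma>3) (n + d)) \<tau>"
    using bisums_odd_term[OF valid_prod[OF assms(2)]] by blast
  define \<kappa> where "\<kappa> = c * inverse 2 ^ \<alpha> * inverse (-2) ^ \<beta> * \<tau>"
  define Y where "Y = signed_term real (\<alpha>, \<sigma>1)"
  define Z where "Z = signed_term real (\<beta>, \<sigma>3)"
  have \<kappa>: "\<kappa> \<in> values_ring"
    unfolding \<kappa>_def using assms(1) \<tau>(1) by (intro values_ring_intros(2)) (auto intro!: values_ring_intros(5))
  have adm: "admissible_index (\<alpha>, \<sigma>1)"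
    using assms exponents signs admissible_1 by (auto simp: admissible_index_def valid_index_def)
  show ?thesis
  proof (rule evaluableI[where E = "\<lambda>k l. \<kappa> * Y k * Z l" and Q = "\<lambda>k. \<kappa> * Y k * zeta_reg_coeff \<beta>"
        and V = "\<lambda>k. \<kappa> * zeta_reg \<beta> * Y k" and v = "\<kappa> * zeta_reg \<beta> * zeta_val [(\<alpha>, \<sigma>1)]"])
    show "\<kappa> * zeta_reg \<beta> * zeta_val [(\<alpha>, \<sigma>1)] \<in> values_ring"
      by (intro values_ring_intros(2) \<kappa> zeta_reg_in_values_ring zeta_1_in_values_ring adm)
    show "(\<lambda>K. \<Sum>k = 1..K. \<kappa> * zeta_reg \<beta> * Y k) \<longlonglongrightarrow> \<kappa> * zeta_reg \<beta> * zeta_val [(\<alpha>, \<sigma>1)]"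
      unfolding sum_distrib_left[symmetric] nested_sum_single[symmetric] Y_def
      by (intro tendsto_mult tendsto_const zeta_tendsto_1 adm)
    fix k :: nat assume "k \<ge> 1"
    have "(\<lambda>L. \<kappa> * Y k * (nested_sum [Z] (0 + L) - counterterm L * zeta_reg_coeff \<beta>)) \<longlonglongrightarrow> \<kappa> * Y k * zeta_reg \<beta>"
      unfolding Z_def by (intro tendsto_mult tendsto_const tendsto_zeta_reg assms)
    then show "(\<lambda>L. (\<Sum>l = 1..L. \<kappa> * Y k * Z l) - counterterm L * (\<kappa> * Y k * zeta_reg_coeff \<beta>))
        \<longlonglongrightarrow> \<kappa> * zeta_reg \<beta> * Y k"
      unfolding sum_distrib_left[symmetric] nested_sum_single[symmetric] by (simp add: algebra_simps)
    fix l :: nat assume "l \<ge> 1"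
    define K where "K = c * (inverse 2 ^ \<alpha> * Y k) * (inverse (-2) ^ \<beta> * Z l)"
    have eq: "sign_char \<sigma>1 (n + int k) * sign_char \<sigma>2 n * sign_char \<sigma>3 (n - int l) *
        (c * pole_term (2 * of_int n - 1) j \<alpha> \<beta> 0 (- 2 * real k) (2 * real l)) =
        K * odd_term (j, \<sigma>1 * \<sigma>2 * \<sigma>3) (n + 0)" for n
    proof -
      have "2 * of_int n - 1 - 0 = 2 * of_int n - (1 :: real)" "0 - - 2 * real k = 2 * real k"
        "0 - 2 * real l = (-2) * real l" by simp_all
      then show ?thesis
        unfolding sign_char_regroup(2) pole_term_def odd_term.simps K_def Y_def Z_def signed_term.simps
        by (simp only: inverse_scaled_power) (simp add: mult_ac)
    qed
    have \<kappa>_eq: "\<kappa> * Y k * Z l = K * \<tau>" by (simp add: K_def \<kappa>_def mult_ac)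
    show "bisums (\<lambda>n. sign_char \<sigma>1 (n + int k) * sign_char \<sigma>2 n * sign_char \<sigma>3 (n - int l) *
        (c * pole_term (2 * of_int n - 1) j \<alpha> \<beta> 0 (- 2 * real k) (2 * real l))) (\<kappa> * Y k * Z l)"
      unfolding eq \<kappa>_eq by (rule bisums_cmult[OF \<tau>(2)])
  qed
qed

text \<open>The summand is \<open>Y l * Z (l + k)\<close> with \<open>Z\<close> built on the
  admissible first sign and an exponent at least \<open>m\<close>. The sum over \<open>l\<close>
  converges without a counterterm, hence \<open>Q = 0\<close>, and summing over the gap
  \<open>k\<close> gives a double zeta value with \<open>Z\<close> outermost.\<close>

lemma evaluable_pole_z:
  assumes "c \<in> \<rat>" "j \<ge> 1" "\<alpha> \<ge> m" "\<beta> \<ge> p"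
  shows "evaluable (\<lambda>x y z a. c * pole_term a j \<alpha> \<beta> z x y)"
proof -
  obtain \<tau> where \<tau>: "\<tau> \<in> values_ring" "\<And>d. bisums (\<lambda>n. odd_term (j, \<sigma>1 * \<sigma>2 * \<sigma>3) (n + d)) \<tau>"
    using bisums_odd_term[OF valid_prod[OF assms(2)]] by blast
  define \<kappa> where "\<kappa> = c * inverse 2 ^ \<alpha> * inverse 2 ^ \<beta> * \<tau>"
  define Z where "Z = signed_term real (\<alpha>, \<sigma>1)"
  define Y where "Y = signed_term real (\<beta>, \<sigma>2)"
  have \<kappa>: "\<kappa> \<in> values_ring"
    unfolding \<kappa>_def using assms(1) \<tau>(1) by (intro values_ring_intros(2)) (auto intro!: values_ring_intros(5))
  have adm: "admissible_index (\<alpha>, \<sigma>1)"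
    using assms exponents signs admissible_1 by (auto simp: admissible_index_def valid_index_def)
  have valid: "valid_index (\<beta>, \<sigma>2)" using assms exponents signs by (auto simp: valid_index_def)
  have z: "(\<lambda>N. \<Sum>n = 1..N. Z n) \<longlonglongrightarrow> zeta_val [(\<alpha>, \<sigma>1)]"
    using zeta_tendsto_1[OF adm] by (simp add: Z_def nested_sum_single[abs_def])
  have Y1: "\<bar>Y n\<bar> \<le> 1 / sqrt (real n)" if "n \<ge> 1" for n
    using abs_signed_term_le_inverse[OF denominators_real valid(1) that]
      divide_self_le_divide_sqrt[OF that, of 1] unfolding Y_def by linarith
  obtain l where l: "(\<lambda>N. \<Sum>n = 1..N. Z n * (\<Sum>k = 1..n - 1. Y k)) \<longlonglongrightarrow> l"
    "\<And>K. summable (\<lambda>k. Y (Suc k) * (\<Sum>i = 1..K. Z (Suc k + i)))"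
    "(\<lambda>K. \<Sum>k. Y (Suc k) * (\<Sum>i = 1..K. Z (Suc k + i))) \<longlonglongrightarrow> l"
    "(\<lambda>K. \<Sum>k = 1..K. Y k * (zeta_val [(\<alpha>, \<sigma>1)] - (\<Sum>n = 1..k. Z n))) \<longlonglongrightarrow> l"
    using nested_sum_limits_signed_term[OF denominators_real adm Y1 z[unfolded Z_def]]
        unfolding Z_def by blast
  have "nested_sum [Z, Y] = (\<lambda>N. \<Sum>n = 1..N. Z n * (\<Sum>k = 1..n - 1. Y k))"
    unfolding nested_sum_Cons[of Z, abs_def] nested_sum_single ..
  then have l_eq: "l = zeta_val [(\<alpha>, \<sigma>1), (\<beta>, \<sigma>2)]"
    using LIMSEQ_unique[OF l(1)] zeta_tendsto_2[OF adm valid] unfolding Y_def Z_def by metis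
  have summ: "summable (\<lambda>i. Y (Suc i) * Z (Suc i + k))" if "k \<ge> 1" for k
  proof -
    \<comment> \<open>Summability is known only after summing over gaps up to \<open>K\<close>; a
      single gap is the difference of two such series.\<close>
    have "summable (\<lambda>i. Y (Suc i) * (\<Sum>j = 1..k. Z (Suc i + j)) - Y (Suc i) * (\<Sum>j = 1..k - 1. Z (Suc i + j)))"
      by (intro summable_diff l(2))
    moreover have "Y (Suc i) * (\<Sum>j = 1..k. Z (Suc i + j)) - Y (Suc i) * (\<Sum>j = 1..k - 1. Z (Suc i + j)) =
        Y (Suc i) * Z (Suc i + k)" for i
      using that by (cases k) (auto simp: algebra_simps)
    ultimately show ?thesis by simp
  qed
  show ?thesis
  proof (rule evaluableI[where E = "\<lambda>k l. \<kappa> * (Y l * Z (l + k))" and Q = "\<lambda>k. 0"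
        and V = "\<lambda>k. \<kappa> * (\<Sum>i. Y (Suc i) * Z (Suc i + k))" and v = "\<kappa> * zeta_val [(\<alpha>, \<sigma>1), (\<beta>, \<sigma>2)]"])
    show "\<kappa> * zeta_val [(\<alpha>, \<sigma>1), (\<beta>, \<sigma>2)] \<in> values_ring"
      by (intro values_ring_intros(2) \<kappa> zeta_2_in_values_ring adm valid)
    have "(\<Sum>k = 1..K. \<Sum>i. Y (Suc i) * Z (Suc i + k)) = (\<Sum>i. Y (Suc i) * (\<Sum>k = 1..K. Z (Suc i + k)))" for K
      unfolding sum_distrib_left by (rule suminf_sum[symmetric]) (use summ in auto)
    then show "(\<lambda>K. \<Sum>k = 1..K. \<kappa> * (\<Sum>i. Y (Suc i) * Z (Suc i + k))) \<longlonglongrightarrow> \<kappa> * zeta_val [(\<alpha>, \<sigma>1), (\<beta>, \<sigma>2)]"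
      unfolding sum_distrib_left[symmetric] using l(3) l_eq by (auto intro: tendsto_intros)
    fix k :: nat assume k: "k \<ge> 1"
    show "(\<lambda>L. (\<Sum>l = 1..L. \<kappa> * (Y l * Z (l + k))) - counterterm L * 0)
        \<longlonglongrightarrow> \<kappa> * (\<Sum>i. Y (Suc i) * Z (Suc i + k))"
      unfolding sum_distrib_left[symmetric] sum_1_eq_lessThan mult_zero_right diff_zero
      by (intro tendsto_mult tendsto_const summable_LIMSEQ summ k)
    fix l :: nat assume "l \<ge> 1"
    define K where "K = c * (inverse 2 ^ \<alpha> * Z (l + k)) * (inverse 2 ^ \<beta> * Y l)"
    have eq: "sign_char \<sigma>1 (n + int k) * sign_char \<sigma>2 n * sign_char \<sigma>3 (n - int l) *
        (c * pole_term (2 * of_int n - 1) j \<alpha> \<beta> (2 * real l) (- 2 * real k) 0) =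
        K * odd_term (j, \<sigma>1 * \<sigma>2 * \<sigma>3) (n + - int l)" for n
    proof -
      have "2 * of_int n - 1 - 2 * real l = 2 * of_int (n + - int l) - 1" "2 * real l - - 2 * real k = 2 * real (l + k)"
        "2 * real l - 0 = 2 * real l" by simp_all
      then show ?thesis
        unfolding sign_char_regroup(3) pole_term_def odd_term.simps K_def Y_def Z_def signed_term.simps
        by (simp only: inverse_scaled_power) (simp add: mult_ac)
    qed
    have \<kappa>_eq: "\<kappa> * (Y l * Z (l + k)) = K * \<tau>" by (simp add: K_def \<kappa>_def mult_ac)
    show "bisums (\<lambda>n. sign_char \<sigma>1 (n + int k) * sign_char \<sigma>2 n * sign_char \<sigma>3 (n - int l) *
        (c * pole_term (2 * of_int n - 1) j \<alpha> \<beta> (2 * real l) (- 2 * real k) 0)) (\<kappa> * (Y l * Z (l + k)))"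
      unfolding eq \<kappa>_eq by (rule bisums_cmult[OF \<tau>(2)])
  qed
qed

lemma evaluable_three_poles: "evaluable (three_poles m p q)"
proof -
  obtain f where f: "partial_fractions m p q f"
    "\<And>x y z a. distinct [x, y, z, a] \<Longrightarrow> three_poles m p q x y z a = f x y z a"
    using partial_fractions_exists[of "m - 1" "p - 1" "q - 1"] exponents by auto
  from f(1) have "evaluable f"
    by (induction rule: partial_fractions.induct)
       (auto intro: evaluable_add evaluable_pole_x evaluable_pole_y evaluable_pole_z)
  moreover have "three_poles m p q (- 2 * real k) 0 (2 * real l) (2 * of_int n - 1) =
      f (- 2 * real k) 0 (2 * real l) (2 * of_int n - 1)" if "k \<ge> 1" "l \<ge> 1" for k l n
  proof (rule f(2))
    have "2 * n - 1 \<noteq> - 2 * int k" "2 * n - 1 \<noteq> 0" "2 * n - 1 \<noteq> 2 * int l" by presburger+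
    then have "real_of_int (2 * n - 1) \<noteq> of_int (- 2 * int k)" "real_of_int (2 * n - 1) \<noteq> of_int 0"
      "real_of_int (2 * n - 1) \<noteq> of_int (2 * int l)" unfolding of_int_eq_iff by auto
    then show "distinct [- 2 * real k, 0, 2 * real l, 2 * of_int n - 1]" using that by auto
  qed
  ultimately show ?thesis unfolding evaluable_def by simp
qed

subsection \<open>The two-sided sums\<close>

abbreviation X1 where "X1 \<equiv> odd_term (m, \<sigma>1)"
abbreviation X2 where "X2 \<equiv> odd_term (p, \<sigma>2)"
abbreviation X3 where "X3 \<equiv> odd_term (q, \<sigma>3)"
abbreviation x1 where "x1 \<equiv> signed_term odd_denom (m, \<sigma>1)"
abbreviation x2 where "x2 \<equiv> signed_term odd_denom (p, \<sigma>2)"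
abbreviation x3 where "x3 \<equiv> signed_term odd_denom (q, \<sigma>3)"
abbreviation \<epsilon>1 where "\<epsilon>1 \<equiv> reflection_sign (m, \<sigma>1)"
abbreviation \<epsilon>2 where "\<epsilon>2 \<equiv> reflection_sign (p, \<sigma>2)"
abbreviation \<epsilon>3 where "\<epsilon>3 \<equiv> reflection_sign (q, \<sigma>3)"

declare odd_term.simps [simp del] reflection_sign.simps [simp del]

lemma abs_reflection_sign: "\<bar>reflection_sign x\<bar> = 1" if "valid_index x" for x
  using that by (cases x) (auto simp: reflection_sign.simps valid_index_def abs_mult)

lemma reflection_sign_square: "reflection_sign x * reflection_sign x = 1" if "valid_index x" for x
  using abs_reflection_sign[OF that] by (metis abs_mult_self_eq mult_1)

lemma reflection_sign_3: "\<not> admissible_index (q, \<sigma>3) \<Longrightarrow> \<epsilon>3 = -1"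
  using valid_3 by (auto simp: admissible_index_def reflection_sign.simps)

definition partial_3 :: "nat \<Rightarrow> real" where
  "partial_3 = nested_sum [x3]"

lemma partial_3_0 [simp]: "partial_3 0 = 0"
  by (simp add: partial_3_def)

lemma partial_3_Suc: "partial_3 (Suc n) = partial_3 n + x3 (Suc n)"
  by (simp add: partial_3_def)

lemma abs_partial_3_le: "\<bar>partial_3 n\<bar> \<le> 2 * sqrt (real n)"
  unfolding partial_3_def by (rule abs_nested_sum_single_le[OF denominators_odd_denom valid_3])

text \<open>Normalised to vanish at 0, so that sums of \<open>X3\<close> over integer intervals are
  differences; the negative half follows from the reflection.\<close>

definition antidifference_3 :: "int \<Rightarrow> real" where
  "antidifference_3 n = (if n \<ge> 0 then partial_3 (nat n) else - \<epsilon>3 * partial_3 (nat (- n)))"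

lemma antidifference_3_step: "antidifference_3 n = antidifference_3 (n - 1) + X3 n"
proof (cases "n \<ge> 1")
  case True
  then have "nat n = Suc (nat (n - 1))" "int (nat n) = n" by auto
  then show ?thesis
    using True odd_term_nat[OF valid_3, of "nat n"] by (simp add: antidifference_3_def partial_3_Suc)
next
  case False
  then have n: "nat (1 - n) = Suc (nat (- n))" "int (nat (1 - n)) = 1 - n" by auto
  have "X3 n = \<epsilon>3 * X3 (1 - n)"
    using odd_term_reflect[OF valid_3, of "1 - n"] by simp
  then show ?thesis
    using False n odd_term_nat[OF valid_3, of "nat (1 - n)"]
    by (auto simp: antidifference_3_def partial_3_Suc algebra_simps)
qed

definition tail_3 :: "nat \<Rightarrow> int \<Rightarrow> real" where
  "tail_3 L n = (\<Sum>l = 1..L. X3 (n - int l)) + counterterm L"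

lemma tail_3_eq: "tail_3 L n = antidifference_3 (n - 1) - antidifference_3 (n - 1 - int L) + counterterm L"
proof -
  have "(\<Sum>l = 1..L. X3 (n - int l)) = antidifference_3 (n - 1) - antidifference_3 (n - 1 - int L)"
  proof (induction L)
    case (Suc L)
    then show ?case using antidifference_3_step[of "n - 1 - int L"] by (simp add: algebra_simps)
  qed simp
  then show ?thesis by (simp add: tail_3_def)
qed

text \<open>For the index \<open>(1, 1)\<close> the reflection sign is -1, so at
  \<open>n = 1\<close> the counterterm cancels the truncated sum exactly; this is the origin of the
  value 0.\<close>

definition t_reg :: real where
  "t_reg = (if admissible_index (q, \<sigma>3) then t_val [(q, \<sigma>3)] else 0)"

definition full_tail_3 :: "int \<Rightarrow> real" where
  "full_tail_3 n = antidifference_3 (n - 1) + \<epsilon>3 * t_reg"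

text \<open>Explicit at \<open>n = 1\<close>. Moving \<open>n\<close> by one changes the truncated
  tail by a fixed term of \<open>X3\<close> and a far term that tends to 0.\<close>

lemma tail_3_tendsto: "(\<lambda>L. tail_3 L n) \<longlonglongrightarrow> full_tail_3 n"
proof (induction n rule: int_induct[where k = 1])
  case base
  have "tail_3 L 1 = \<epsilon>3 * partial_3 L + counterterm L" for L
    by (cases "L = 0") (auto simp: tail_3_eq antidifference_3_def)
  moreover have "(\<lambda>L. \<epsilon>3 * partial_3 L + counterterm L) \<longlonglongrightarrow> \<epsilon>3 * t_reg"
  proof (cases "admissible_index (q, \<sigma>3)")
    case True
    then show ?thesis using t_tendsto_1[OF True]
      by (auto simp: counterterm_def t_reg_def partial_3_def intro: tendsto_intros)
  next
    case False
    then show ?thesis using reflection_sign_3 by (simp add: counterterm_def t_reg_def partial_3_def)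
  qed
  ultimately show ?case by (simp add: full_tail_3_def antidifference_3_def)
next
  case (step1 n)
  have "tail_3 L (n + 1) = tail_3 L n + X3 n - X3 (- int L + n)" for L
    using antidifference_3_step[of n] antidifference_3_step[of "n - int L"]
    by (simp add: tail_3_eq algebra_simps)
  moreover have "(\<lambda>L. tail_3 L n + X3 n - X3 (- int L + n)) \<longlonglongrightarrow> full_tail_3 n + X3 n - 0"
    by (intro tendsto_intros step1 odd_term_tendsto_0 valid_3)
  moreover have "full_tail_3 (n + 1) = full_tail_3 n + X3 n - 0"
    using antidifference_3_step[of n] by (simp add: full_tail_3_def)
  ultimately show ?case by simp
next
  case (step2 n)
  have "tail_3 L (n - 1) = tail_3 L n - X3 (n - 1) + X3 (- int L + (n - 1))" for L
    using antidifference_3_step[of "n - 1"] antidifference_3_step[of "n - 1 - int L"]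
    by (simp add: tail_3_eq algebra_simps)
  moreover have "(\<lambda>L. tail_3 L n - X3 (n - 1) + X3 (- int L + (n - 1))) \<longlonglongrightarrow> full_tail_3 n - X3 (n - 1) + 0"
    by (intro tendsto_intros step2 odd_term_tendsto_0 valid_3)
  moreover have "full_tail_3 (n - 1) = full_tail_3 n - X3 (n - 1) + 0"
    using antidifference_3_step[of "n - 1"] by (simp add: full_tail_3_def)
  ultimately show ?case by simp
qed

section \<open>Majorants uniform in the truncation \<open>L\<close>\<close>

abbreviation abs_odd :: "int \<Rightarrow> real" where
  "abs_odd n \<equiv> \<bar>2 * of_int n - 1\<bar>"

lemma abs_odd_ge: "abs_odd n \<ge> 1" "abs_odd n \<ge> \<bar>of_int (n - 1)\<bar>"
proof -
  have "\<bar>2 * n - 1\<bar> \<ge> 1" by presburger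
  then have "of_int \<bar>2 * n - 1\<bar> \<ge> (1 :: real)" by linarith
  then show "abs_odd n \<ge> 1" by simp
  have "\<bar>2 * n - 1\<bar> \<ge> \<bar>n - 1\<bar>" by presburger
  then have "(of_int \<bar>2 * n - 1\<bar> :: real) \<ge> of_int \<bar>n - 1\<bar>" by (simp only: of_int_le_iff)
  then show "abs_odd n \<ge> \<bar>of_int (n - 1)\<bar>" by simp
qed

text \<open>The point is uniformity in \<open>L\<close>, which permits the limit in \<open>L\<close>
  inside the sum over \<open>n\<close>. For an admissible index everything is bounded. For
  \<open>(1, 1)\<close>, \<open>partial_3\<close> is increasing and subadditive, so the two terms
  containing \<open>L\<close> differ by at most
  \<open>partial_3 (nat \<bar>n - 1\<bar>)\<close>.\<close>

lemma abs_tail_3_le: "\<bar>tail_3 L n\<bar> \<le> 4 * sqrt (abs_odd n)"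
proof (cases "admissible_index (q, \<sigma>3)")
  case True
  have "{1..N} = {0<..N}" for N :: nat by auto
  then have "\<bar>partial_3 N\<bar> \<le> 2" for N
    using signed_term_interval_sum[OF denominators_odd_denom True, of 0 N]
    by (simp add: partial_3_def nested_sum_single)
  then have *: "\<bar>antidifference_3 j\<bar> \<le> 2" for j
    using abs_reflection_sign[OF valid_3] by (auto simp: antidifference_3_def abs_mult)
  have "\<bar>tail_3 L n\<bar> \<le> 4"
    using *[of "n - 1"] *[of "n - 1 - int L"] True unfolding tail_3_eq counterterm_def by auto
  also have "\<dots> \<le> 4 * sqrt (abs_odd n)" using abs_odd_ge(1)[of n] by simp
  finally show ?thesis .
next
  case False
  then have eq: "(q, \<sigma>3) = (1, 1)" using valid_3 by (auto simp: admissible_index_def)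
  have x3: "x3 k = 1 / odd_denom k" for k unfolding eq by (simp add: signed_term.simps)
  have mono: "partial_3 a \<le> partial_3 b" if "a \<le> b" for a b
    using that by (induction b rule: dec_induct) (auto simp: partial_3_Suc x3 odd_denom_def intro: order_trans)
  have sub: "partial_3 (a + b) \<le> partial_3 a + partial_3 b" for a b
  proof (induction b)
    case (Suc b)
    have "x3 (Suc (a + b)) \<le> x3 (Suc b)"
      unfolding x3 odd_denom_def by (intro divide_left_mono) auto
    then show ?case using Suc by (simp add: partial_3_Suc)
  qed auto
  have diff: "\<bar>partial_3 a - partial_3 b\<bar> \<le> partial_3 c" if "a \<le> b + c" "b \<le> a + c" for a b c
    using mono[OF that(1)] mono[OF that(2)] sub[of b c] sub[of a c] by linarith
  have S: "antidifference_3 j = partial_3 (nat \<bar>j\<bar>)" for j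
    using reflection_sign_3[OF False] by (auto simp: antidifference_3_def)
  have "tail_3 L n = partial_3 (nat \<bar>n - 1\<bar>) + (partial_3 L - partial_3 (nat \<bar>n - 1 - int L\<bar>))"
    using False by (simp add: tail_3_eq S counterterm_def partial_3_def)
  moreover have "\<bar>partial_3 L - partial_3 (nat \<bar>n - 1 - int L\<bar>)\<bar> \<le> partial_3 (nat \<bar>n - 1\<bar>)"
    by (intro diff) linarith+
  ultimately have "\<bar>tail_3 L n\<bar> \<le> 2 * \<bar>partial_3 (nat \<bar>n - 1\<bar>)\<bar>" by linarith
  also have "\<dots> \<le> 4 * sqrt \<bar>of_int (n - 1)\<bar>"
    using abs_partial_3_le[of "nat \<bar>n - 1\<bar>"] by (simp add: of_nat_nat)
  also have "\<dots> \<le> 4 * sqrt (abs_odd n)" using abs_odd_ge(2)[of n] by simp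
  finally show ?thesis .
qed

lemma abs_full_tail_3_le: "\<bar>full_tail_3 n\<bar> \<le> 4 * sqrt (abs_odd n)"
  by (rule tendsto_upperbound[OF tendsto_rabs[OF tail_3_tendsto]]) (auto simp: abs_tail_3_le)

text \<open>The bound may depend on the fixed gap \<open>k\<close>; the factor comes from
  \<open>abs_odd n \<le> (1 + 2 * real k) * abs_odd (n + int k)\<close>.\<close>

lemma abs_shifted_product_le:
  assumes "\<bar>g\<bar> \<le> C * sqrt (abs_odd n)"
  shows "\<bar>X1 (n + int k) * X2 n * g\<bar> \<le> (1 + 2 * real k) * C / (abs_odd n * sqrt (abs_odd n))"
proof -
  have pos: "abs_odd n > 0" "abs_odd (n + int k) > 0" using abs_odd_ge(1)[of n] abs_odd_ge(1)[of "n + int k"] by linarith+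
  have "abs_odd n \<le> abs_odd (n + int k) + 2 * real k" by (simp add: algebra_simps)
  also have "\<dots> \<le> (1 + 2 * real k) * abs_odd (n + int k)"
    using mult_left_mono[OF abs_odd_ge(1)[of "n + int k"], of "2 * real k"] by (simp add: algebra_simps)
  finally have "1 / abs_odd (n + int k) \<le> (1 + 2 * real k) / abs_odd n"
    using pos by (simp add: divide_simps mult.commute)
  then have 1: "\<bar>X1 (n + int k)\<bar> \<le> (1 + 2 * real k) / abs_odd n"
    using abs_odd_term_le[OF valid_1, of "n + int k"] by linarith
  have "\<bar>X1 (n + int k) * X2 n * g\<bar> \<le> (1 + 2 * real k) / abs_odd n * (1 / abs_odd n) * (C * sqrt (abs_odd n))"
    unfolding abs_mult using 1 abs_odd_term_le[OF valid_2, of n] assms pos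
    by (intro mult_mono) auto
  also have "\<dots> = (1 + 2 * real k) * C / (abs_odd n * sqrt (abs_odd n))"
  proof -
    have "sqrt (abs_odd n) * sqrt (abs_odd n) = abs_odd n" by simp
    then show ?thesis using pos by (simp add: divide_simps del: real_sqrt_mult_self) (simp add: mult_ac)
  qed
  finally show ?thesis .
qed

lemma abs_odd_decay:
  assumes "C \<ge> 0"
  shows "C / (abs_odd (int N + 1) * sqrt (abs_odd (int N + 1))) \<le> C / (real (Suc N) * sqrt (real (Suc N)))"
    and "C / (abs_odd (- int N) * sqrt (abs_odd (- int N))) \<le> C / (real (Suc N) * sqrt (real (Suc N)))"
proof -
  have eq: "abs_odd (int N + 1) = 2 * real N + 1" "abs_odd (- int N) = 2 * real N + 1" by auto
  have "C / ((2 * real N + 1) * sqrt (2 * real N + 1)) \<le> C / (real (Suc N) * sqrt (real (Suc N)))"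
    using assms by (intro divide_left_mono mult_mono mult_pos_pos) auto
  then show "C / (abs_odd (int N + 1) * sqrt (abs_odd (int N + 1))) \<le> C / (real (Suc N) * sqrt (real (Suc N)))"
    "C / (abs_odd (- int N) * sqrt (abs_odd (- int N))) \<le> C / (real (Suc N) * sqrt (real (Suc N)))"
    unfolding eq by blast+
qed

lemma shifted_product_bounds:
  assumes "\<And>n. \<bar>g n\<bar> \<le> 4 * sqrt (abs_odd n)"
  shows "\<bar>X1 (int N + 1 + int k) * X2 (int N + 1) * g (int N + 1)\<bar> \<le> (1 + 2 * real k) * 4 / (real (Suc N) * sqrt (real (Suc N)))"
    and "\<bar>X1 (- int N + int k) * X2 (- int N) * g (- int N)\<bar> \<le> (1 + 2 * real k) * 4 / (real (Suc N) * sqrt (real (Suc N)))"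
  by (rule order_trans[OF abs_shifted_product_le[OF assms] abs_odd_decay(1)], simp)
     (rule order_trans[OF abs_shifted_product_le[OF assms] abs_odd_decay(2)], simp)

text \<open>The sum over the middle index with the first gap equal to \<open>k\<close> and the third
  variable already summed out, regularised if necessary.\<close>

definition middle_sum :: "nat \<Rightarrow> real" where
  "middle_sum k = (\<Sum>N. X1 (int N + 1 + int k) * X2 (int N + 1) * full_tail_3 (int N + 1)
      + X1 (- int N + int k) * X2 (- int N) * full_tail_3 (- int N))"

text \<open>Exchanges the sum over \<open>n\<close> with the limit of the sums over
  \<open>l\<close>. The counterterm is added to each tail inside the sum over \<open>n\<close>, so
  its total coefficient \<open>S\<close> is the two-sided sum of
  \<open>X1 (n + int k) * X2 n\<close>.\<close>

lemma middle_sum_tendsto: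
  assumes E: "\<And>l. l \<ge> 1 \<Longrightarrow> bisums (\<lambda>n. X1 (n + int k) * X2 n * X3 (n - int l)) (E l)"
  shows "\<exists>S. (\<lambda>L. (\<Sum>l = 1..L. E l) + counterterm L * S) \<longlonglongrightarrow> middle_sum k"
proof -
  have one: "\<bar>1\<bar> \<le> 4 * sqrt (abs_odd n)" for n using abs_odd_ge(1)[of n] real_sqrt_ge_one[of "abs_odd n"] by linarith
  define S where "S = (\<Sum>N. X1 (int N + 1 + int k) * X2 (int N + 1) * 1 + X1 (- int N + int k) * X2 (- int N) * 1)"
  have S: "bisums (\<lambda>n. X1 (n + int k) * X2 n * 1) S"
    unfolding bisums_def S_def
    by (intro summable_sums summable_add summable_inverse_three_halves_bound(1)[OF shifted_product_bounds(1)]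
        summable_inverse_three_halves_bound(1)[OF shifted_product_bounds(2)] one)
  have "bisums (\<lambda>n. X1 (n + int k) * X2 n * (\<Sum>l = 1..L. X3 (n - int l))) (\<Sum>l = 1..L. E l)" for L
  proof (induction L)
    case 0
    show ?case by (simp add: bisums_def)
  next
    case (Suc L)
    from bisums_add[OF Suc E[of "Suc L"]] show ?case by (simp add: algebra_simps)
  qed
  then have L: "bisums (\<lambda>n. X1 (n + int k) * X2 n * tail_3 L n) ((\<Sum>l = 1..L. E l) + counterterm L * S)" for L
    using bisums_add[OF _ bisums_cmult[OF S, where c = "counterterm L"]]
    by (simp add: tail_3_def ring_distribs mult_ac)
  have "(\<lambda>L. \<Sum>N. X1 (int N + 1 + int k) * X2 (int N + 1) * tail_3 L (int N + 1)
      + X1 (- int N + int k) * X2 (- int N) * tail_3 L (- int N)) \<longlonglongrightarrow> middle_sum k"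
    unfolding middle_sum_def
  proof (rule tannery_sequentially(3))
    show "(\<lambda>L. X1 (int N + 1 + int k) * X2 (int N + 1) * tail_3 L (int N + 1)
        + X1 (- int N + int k) * X2 (- int N) * tail_3 L (- int N))
        \<longlonglongrightarrow> X1 (int N + 1 + int k) * X2 (int N + 1) * full_tail_3 (int N + 1)
          + X1 (- int N + int k) * X2 (- int N) * full_tail_3 (- int N)" for N
      by (intro tendsto_intros tail_3_tendsto)
    show "\<bar>X1 (int N + 1 + int k) * X2 (int N + 1) * tail_3 L (int N + 1)
        + X1 (- int N + int k) * X2 (- int N) * tail_3 L (- int N)\<bar>
        \<le> (1 + 2 * real k) * 8 * (1 / (real (Suc N) * sqrt (real (Suc N))))" for N L
    proof -
      have "(1 + 2 * real k) * 8 * (1 / (real (Suc N) * sqrt (real (Suc N)))) =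
          (1 + 2 * real k) * 4 / (real (Suc N) * sqrt (real (Suc N))) +
          (1 + 2 * real k) * 4 / (real (Suc N) * sqrt (real (Suc N)))"
        by (simp only: add_divide_distrib[symmetric]) simp
      then show ?thesis
        using shifted_product_bounds[where g = "tail_3 L" and N = N and k = k, OF abs_tail_3_le] by linarith
    qed
    show "summable (\<lambda>N. (1 + 2 * real k) * 8 * (1 / (real (Suc N) * sqrt (real (Suc N)))))"
      by (intro summable_mult summable_inverse_three_halves)
  qed
  moreover have "(\<Sum>N. X1 (int N + 1 + int k) * X2 (int N + 1) * tail_3 L (int N + 1)
      + X1 (- int N + int k) * X2 (- int N) * tail_3 L (- int N)) = (\<Sum>l = 1..L. E l) + counterterm L * S" for L
    using L[of L] unfolding bisums_def by (rule sums_unique[symmetric])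
  ultimately show ?thesis by auto
qed

lemma counterterm_divergent:
  assumes "\<not> admissible_index (q, \<sigma>3)"
  shows "\<not> convergent counterterm"
proof
  assume "convergent counterterm"
  have eq: "(q, \<sigma>3) = (1, 1)" using assms valid_3 by (auto simp: admissible_index_def)
  have "counterterm = (\<lambda>L. \<Sum>n<L. 1 / (2 * real n + 1))"
    unfolding counterterm_def using assms
    by (intro ext, simp only: if_False nested_sum_single sum_1_eq_lessThan eq)
       (simp add: signed_term.simps odd_denom_def algebra_simps)
  then have "summable (\<lambda>n. 1 / (2 * real n + 1))"
    using \<open>convergent counterterm\<close> by (simp add: summable_iff_convergent)
  then have "summable (\<lambda>n. 2 * (1 / (2 * real n + 1)))" by (rule summable_mult)
  then have "summable (\<lambda>n. inverse (real (Suc n)))"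
    by (rule summable_comparison_test') (auto simp: divide_simps)
  then show False using not_summable_harmonic[where 'a = real] by (simp add: summable_Suc_iff[of "\<lambda>n. inverse (real n)"] del: of_nat_Suc)
qed

text \<open>
  The divergent parts of the partial fraction evaluation cancel because the counterterm diverges
  while all other quantities converge.
\<close>

lemma middle_sum_total: "\<exists>v\<in>values_ring. (\<lambda>K. \<Sum>k = 1..K. middle_sum k) \<longlonglongrightarrow> v"
proof -
  obtain E Q V v where v: "v \<in> values_ring"
    "\<And>k l. k \<ge> 1 \<Longrightarrow> l \<ge> 1 \<Longrightarrow> bisums (\<lambda>n. sign_char \<sigma>1 (n + int k) * sign_char \<sigma>2 n *
        sign_char \<sigma>3 (n - int l) * three_poles m p q (- 2 * real k) 0 (2 * real l) (2 * of_int n - 1)) (E k l)"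
    "\<And>k. k \<ge> 1 \<Longrightarrow> (\<lambda>L. (\<Sum>l = 1..L. E k l) - counterterm L * Q k) \<longlonglongrightarrow> V k"
    "(\<lambda>K. \<Sum>k = 1..K. V k) \<longlonglongrightarrow> v"
    using evaluable_three_poles unfolding evaluable_def by blast
  have "middle_sum k = V k" if k: "k \<ge> 1" for k
  proof -
    have "sign_char \<sigma>1 (n + int k) * sign_char \<sigma>2 n * sign_char \<sigma>3 (n - int l) *
        three_poles m p q (- 2 * real k) 0 (2 * real l) (2 * of_int n - 1) =
        X1 (n + int k) * X2 n * X3 (n - int l)" for n l
      by (simp add: three_poles_def odd_term.simps algebra_simps)
    then have "bisums (\<lambda>n. X1 (n + int k) * X2 n * X3 (n - int l)) (E k l)" if "l \<ge> 1" for l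
      using v(2)[OF k that] by simp
    from middle_sum_tendsto[of k "E k", OF this]
    obtain S where S: "(\<lambda>L. (\<Sum>l = 1..L. E k l) + counterterm L * S) \<longlonglongrightarrow> middle_sum k" by blast
    from tendsto_diff[OF S v(3)[OF k]]
    have lim: "(\<lambda>L. counterterm L * (S + Q k)) \<longlonglongrightarrow> middle_sum k - V k"
      by (simp add: algebra_simps)
    show "middle_sum k = V k"
    proof (cases "admissible_index (q, \<sigma>3)")
      case True
      then show ?thesis using lim by (simp add: counterterm_def LIMSEQ_const_iff)
    next
      case False
      have "S + Q k = 0"
      proof (rule ccontr)
        assume nz: "S + Q k \<noteq> 0"
        then have "(\<lambda>L. counterterm L * (S + Q k) / (S + Q k)) \<longlonglongrightarrow> (middle_sum k - V k) / (S + Q k)"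
          by (intro tendsto_divide lim tendsto_const)
        then have "convergent counterterm" using nz by (auto simp: convergent_def)
        then show False using counterterm_divergent[OF False] by blast
      qed
      then show ?thesis using lim by (simp add: LIMSEQ_const_iff)
    qed
  qed
  then have "(\<Sum>k = 1..K. middle_sum k) = (\<Sum>k = 1..K. V k)" for K by (intro sum.cong) auto
  then show ?thesis using v by auto
qed

subsection \<open>Comparison with triple values\<close>

definition second_term :: "nat \<Rightarrow> real" where
  "second_term n = X2 (int n) * full_tail_3 (int n)"

text \<open>For \<open>b \<ge> 1\<close> the middle index \<open>1 - b\<close> runs through the
  nonpositive integers.\<close>

definition reflected_second_term :: "nat \<Rightarrow> real" where
  "reflected_second_term b = X2 (1 - int b) * full_tail_3 (1 - int b)"

lemma second_term_eq:
  "n \<ge> 1 \<Longrightarrow> second_term n = x2 n * (partial_3 (n - 1) + \<epsilon>3 * t_reg)"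
  by (simp add: second_term_def full_tail_3_def antidifference_3_def odd_term_nat[OF valid_2] of_nat_diff nat_diff_distrib)

text \<open>Reflecting the second and third variables produces
  \<open>\<epsilon>2 * \<epsilon>3\<close>, which the parity condition identifies with
  \<open>\<epsilon>1\<close>. The condition that the third variable be smaller becomes a tail beyond
  \<open>b\<close>, hence the minus sign.\<close>

lemma reflected_second_term_eq:
  "reflected_second_term b = - \<epsilon>1 * (x2 b * (partial_3 b - t_reg))"
proof -
  have "\<epsilon>2 * \<epsilon>3 = \<epsilon>1"
    using reflection_sign_prod reflection_sign_square[OF valid_1]
    by (metis mult.assoc mult.commute mult_1)
  moreover have "full_tail_3 (1 - int b) = - \<epsilon>3 * (partial_3 b - t_reg)"
    by (cases "b = 0") (auto simp: full_tail_3_def antidifference_3_def algebra_simps)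
  ultimately show ?thesis
    using odd_term_reflect[OF valid_2, of "int b"] odd_term_nat[OF valid_2, of b]
    unfolding reflected_second_term_def by (simp add: mult_ac)
qed

lemma partial_3_minus_t_reg:
  assumes "admissible_index (q, \<sigma>3)"
  shows "\<bar>partial_3 n - t_reg\<bar> \<le> 2 / real (Suc n)"
proof -
  have "(\<lambda>N. \<bar>partial_3 n - partial_3 N\<bar>) \<longlonglongrightarrow> \<bar>partial_3 n - t_reg\<bar>"
    using t_tendsto_1[OF assms] assms by (auto simp: partial_3_def t_reg_def intro!: tendsto_intros)
  moreover have "\<bar>partial_3 n - partial_3 N\<bar> \<le> 2 / real (Suc n)" if "N \<ge> n" for N
  proof -
    have "partial_3 N - partial_3 n = (\<Sum>i\<in>{n<..N}. x3 i)"
      unfolding partial_3_def nested_sum_single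
      using that by (subst sum_diff[symmetric]) (auto intro!: sum.cong)
    then show ?thesis using signed_term_interval_sum[OF denominators_odd_denom assms, of n N]
      by (simp add: abs_minus_commute)
  qed
  ultimately show ?thesis
    by (intro tendsto_upperbound[where F = sequentially]) (auto intro: eventually_mono[OF eventually_ge_at_top[of n]])
qed

lemma over_Suc_le_over_sqrt: "C \<ge> 0 \<Longrightarrow> C / real (Suc i) \<le> C / sqrt (real (Suc i))"
  by (rule divide_self_le_divide_sqrt) auto

text \<open>
  When \<open>(q, \<sigma>3) = (1, 1)\<close> the sums over the third variable grow, and summation by parts against the
  then admissible second index is needed.
\<close>

lemma reflected_second_term_interval_sum:
  "\<bar>\<Sum>n\<in>{i<..j}. reflected_second_term n\<bar> \<le> 8 / sqrt (real (Suc i))"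
proof (cases "admissible_index (q, \<sigma>3)")
  case True
  have "\<bar>reflected_second_term n\<bar> \<le> 2 / real n ^ 2" if "n \<ge> 1" for n
  proof -
    have "\<bar>partial_3 n - t_reg\<bar> \<le> 2 / real n"
      by (rule order_trans[OF partial_3_minus_t_reg[OF True]]) (use that in \<open>auto intro!: divide_left_mono\<close>)
    then have "\<bar>reflected_second_term n\<bar> \<le> 1 / real n * (2 / real n)"
      unfolding reflected_second_term_eq abs_mult abs_minus_cancel abs_reflection_sign[OF valid_1] mult_1
      using abs_signed_term_le_inverse[OF denominators_odd_denom valid_2 that] by (intro mult_mono) auto
    then show ?thesis by (simp add: power2_eq_square)
  qed
  then have "\<bar>\<Sum>n\<in>{i<..j}. reflected_second_term n\<bar> \<le> 2 * 2 / real (Suc i)"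
    by (rule inverse_square_interval_sum) auto
  also have "\<dots> \<le> 8 / real (Suc i)" by (intro divide_right_mono) auto
  also have "\<dots> \<le> 8 / sqrt (real (Suc i))" by (rule over_Suc_le_over_sqrt) auto
  finally show ?thesis .
next
  case False
  then have adm: "admissible_index (p, \<sigma>2)" using admissible_2_or_3 by blast
  have tail: "\<bar>\<Sum>n\<in>{r<..j}. x2 n\<bar> \<le> 2 / real (Suc r)" for r
    by (rule signed_term_interval_sum[OF denominators_odd_denom adm])
  \<comment> \<open>Expand \<open>partial_3 n\<close> beyond \<open>i\<close> and exchange the
    summations. The inner block starts at \<open>n = r\<close> itself, hence \<open>r - 1\<close> as
    its open end. Both pieces turn out to be at most \<open>4 / sqrt (real (Suc i))\<close>.\<close>
  have parts: "(\<Sum>n\<in>{i<..j}. x2 n * partial_3 n) =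
      partial_3 i * (\<Sum>n\<in>{i<..j}. x2 n) + (\<Sum>r\<in>{i<..j}. x3 r * (\<Sum>n\<in>{r - 1<..j}. x2 n))" if "i \<le> j" for j
    using that
  proof (induction j rule: dec_induct)
    case (step j)
    have 1: "(\<Sum>n\<in>{r<..Suc j}. x2 n) = (\<Sum>n\<in>{r<..j}. x2 n) + x2 (Suc j)" if "r \<le> j" for r
    proof -
      have "{r<..Suc j} = insert (Suc j) {r<..j}" using that by auto
      then show ?thesis by simp
    qed
    have 2: "{i<..Suc j} = insert (Suc j) {i<..j}" using step by auto
    have 3: "partial_3 (Suc j) = partial_3 i + (\<Sum>r\<in>{i<..j}. x3 r) + x3 (Suc j)"
      using step(1) by (induction j rule: dec_induct)
        (auto simp: partial_3_Suc atLeastSucAtMost_greaterThanAtMost[symmetric] sum.cl_ivl_Suc)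
    have "(\<Sum>r\<in>{i<..j}. x3 r * (\<Sum>n\<in>{r - 1<..Suc j}. x2 n)) =
        (\<Sum>r\<in>{i<..j}. x3 r * (\<Sum>n\<in>{r - 1<..j}. x2 n)) + (\<Sum>r\<in>{i<..j}. x3 r) * x2 (Suc j)"
      unfolding sum_distrib_right sum.distrib[symmetric]
      by (intro sum.cong refl) (auto simp: 1 algebra_simps)
    moreover have "{j<..Suc j} = {Suc j}" by auto
    ultimately show ?case using step 1[of i] 2 3 by (simp add: algebra_simps)
  qed auto
  have "\<bar>\<Sum>n\<in>{i<..j}. x2 n * partial_3 n\<bar> \<le> 8 / sqrt (real (Suc i))"
  proof (cases "i \<le> j")
    case True
    have "\<bar>partial_3 i * (\<Sum>n\<in>{i<..j}. x2 n)\<bar> \<le> 2 * sqrt (real (Suc i)) * (2 / real (Suc i))"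
      unfolding abs_mult using tail[of i] order_trans[OF abs_partial_3_le[of i], of "2 * sqrt (real (Suc i))"]
      by (intro mult_mono) auto
    also have "\<dots> = 4 / sqrt (real (Suc i))"
    proof -
      have "r > 0 \<Longrightarrow> 2 * sqrt r * (2 / r) = 4 / sqrt r" for r :: real
        by (simp add: divide_simps)
      then show ?thesis by simp
    qed
    finally have 1: "\<bar>partial_3 i * (\<Sum>n\<in>{i<..j}. x2 n)\<bar> \<le> 4 / sqrt (real (Suc i))" .
    have "\<bar>x3 r * (\<Sum>n\<in>{r - 1<..j}. x2 n)\<bar> \<le> 2 / real r ^ 2" if "r \<ge> 1" for r
    proof -
      have "\<bar>x3 r * (\<Sum>n\<in>{r - 1<..j}. x2 n)\<bar> \<le> 1 / real r * (2 / real r)"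
        unfolding abs_mult
        using tail[of "r - 1"] abs_signed_term_le_inverse[OF denominators_odd_denom valid_3 that] that
        by (intro mult_mono) auto
      then show ?thesis by (simp add: power2_eq_square)
    qed
    then have "\<bar>\<Sum>r\<in>{i<..j}. x3 r * (\<Sum>n\<in>{r - 1<..j}. x2 n)\<bar> \<le> 2 * 2 / real (Suc i)"
      by (rule inverse_square_interval_sum) auto
    also have "\<dots> \<le> 4 / sqrt (real (Suc i))" using over_Suc_le_over_sqrt[of 4 i] by simp
    finally have "\<bar>\<Sum>n\<in>{i<..j}. x2 n * partial_3 n\<bar> \<le> 4 / sqrt (real (Suc i)) + 4 / sqrt (real (Suc i))"
      unfolding parts[OF True] using 1 by linarith
    then show ?thesis by simp
  qed auto
  moreover have "(\<Sum>n\<in>{i<..j}. reflected_second_term n) = - \<epsilon>1 * (\<Sum>n\<in>{i<..j}. x2 n * partial_3 n)"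
    unfolding sum_distrib_left reflected_second_term_eq using False by (simp add: t_reg_def)
  ultimately show ?thesis by (simp add: abs_mult abs_reflection_sign[OF valid_1])
qed

text \<open>The input for Mertens' theorem. If the third index is admissible, its tails supply a
  second factor \<open>1 / n\<close>; otherwise \<open>p \<ge> 2\<close> compensates the growth of
  its partial sums, and for \<open>p = 1\<close> the first series is absolutely convergent.\<close>

lemma absolutely_summable_factor:
  "summable (\<lambda>a. \<bar>x1 (Suc a)\<bar>) \<or> summable (\<lambda>a. \<bar>reflected_second_term (Suc a)\<bar>)"
proof -
  have abs_eq: "\<bar>reflected_second_term n\<bar> = \<bar>x2 n\<bar> * \<bar>partial_3 n - t_reg\<bar>" for n
    by (simp add: reflected_second_term_eq abs_mult abs_reflection_sign[OF valid_1])
  have half: "1 / real n * (C / real n) \<le> C / (real n * sqrt (real n))" if "n \<ge> 1" "C \<ge> 0" for C n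
    using mult_left_mono[OF divide_self_le_divide_sqrt[OF that], of "1 / real n"] by simp
  consider "admissible_index (q, \<sigma>3)" | "\<not> admissible_index (q, \<sigma>3)" "p \<ge> 2"
    | "\<not> admissible_index (q, \<sigma>3)" "p = 1"
    using exponents by linarith
  then show ?thesis
  proof cases
    case 1
    have "\<bar>reflected_second_term (Suc a)\<bar> \<le> 2 / (real (Suc a) * sqrt (real (Suc a)))" for a
    proof -
      have "\<bar>partial_3 (Suc a) - t_reg\<bar> \<le> 2 / real (Suc a)"
        using partial_3_minus_t_reg[OF 1, of "Suc a"] by (rule order_trans) (auto intro!: divide_left_mono)
      then have "\<bar>reflected_second_term (Suc a)\<bar> \<le> 1 / real (Suc a) * (2 / real (Suc a))"
        unfolding abs_eq using abs_signed_term_le_inverse[OF denominators_odd_denom valid_2, of "Suc a"]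
        by (intro mult_mono) auto
      also have "\<dots> \<le> 2 / (real (Suc a) * sqrt (real (Suc a)))" by (rule half) auto
      finally show ?thesis .
    qed
    from summable_inverse_three_halves_bound(2)[OF this] show ?thesis ..
  next
    case 2
    have "\<bar>reflected_second_term (Suc a)\<bar> \<le> 2 / (real (Suc a) * sqrt (real (Suc a)))" for a
    proof -
      have "\<bar>reflected_second_term (Suc a)\<bar> \<le> 1 / real (Suc a) ^ 2 * (2 * sqrt (real (Suc a)))"
        unfolding abs_eq using abs_signed_term_le[OF denominators_odd_denom valid_2, of "Suc a" 2] 2
          abs_partial_3_le[of "Suc a"]
        by (intro mult_mono) (auto simp: t_reg_def)
      also have "\<dots> = 2 / (real (Suc a) * sqrt (real (Suc a)))"
      proof -
        have "r > 0 \<Longrightarrow> 1 / r ^ 2 * (2 * sqrt r) = 2 / (r * sqrt r)" for r :: real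
          by (simp add: power2_eq_square divide_simps)
        then show ?thesis by simp
      qed
      finally show ?thesis .
    qed
    from summable_inverse_three_halves_bound(2)[OF this] show ?thesis ..
  next
    case 3
    have "(q, \<sigma>3) = (1, 1)" "\<sigma>2 = -1"
      using 3 valid_3 valid_2 admissible_2_or_3 by (auto simp: admissible_index_def valid_index_def)
    \<comment> \<open>Here \<open>\<epsilon>2 = 1\<close> and \<open>\<epsilon>3 = -1\<close>. With
      \<open>m = 1\<close>, \<open>\<epsilon>1 = -1\<close> would mean that the first index is
      \<open>(1, 1)\<close>.\<close>
    then have "\<epsilon>1 = -1"
      using reflection_sign_prod 3 by (simp add: reflection_sign.simps)
    then have "m \<noteq> 1" using admissible_1
      by (auto simp: reflection_sign.simps admissible_index_def valid_index_def)
    then have m: "m \<ge> 2" using exponents by simp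
    have "\<bar>x1 (Suc a)\<bar> \<le> 1 / (real (Suc a) * sqrt (real (Suc a)))" for a
    proof -
      have "\<bar>x1 (Suc a)\<bar> \<le> 1 / real (Suc a) * (1 / real (Suc a))"
        using abs_signed_term_le[OF denominators_odd_denom valid_1, of "Suc a" 2] m
        by (simp add: power2_eq_square)
      also have "\<dots> \<le> 1 / (real (Suc a) * sqrt (real (Suc a)))" by (rule half) auto
      finally show ?thesis .
    qed
    from summable_inverse_three_halves_bound(2)[OF this] show ?thesis ..
  qed
qed

text \<open>Three ranges of the middle index: positive; nonpositive with the first index still
  positive; both nonpositive. With middle index \<open>1 - b\<close> the first index is
  \<open>k + 1 - b\<close>, so the second range is \<open>b \<le> k\<close>.\<close>

lemma middle_sum_split:
  assumes k: "k \<ge> 1"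
  shows "summable (\<lambda>N. second_term (Suc N) * x1 (Suc N + k))"
    and "summable (\<lambda>N. x1 (Suc N) * reflected_second_term (Suc N + k))"
    and "middle_sum k = (\<Sum>N. second_term (Suc N) * x1 (Suc N + k))
      + (\<Sum>b = 1..k. x1 (k + 1 - b) * reflected_second_term b)
      + \<epsilon>1 * (\<Sum>N. x1 (Suc N) * reflected_second_term (Suc N + k))"
proof -
  define h where "h n = X1 (n + int k) * X2 n * full_tail_3 n" for n
  have s: "summable (\<lambda>N. h (int N + 1))" "summable (\<lambda>N. h (- int N))"
    unfolding h_def
    using summable_inverse_three_halves_bound(1)[OF shifted_product_bounds(1)[OF abs_full_tail_3_le]]
      summable_inverse_three_halves_bound(1)[OF shifted_product_bounds(2)[OF abs_full_tail_3_le]] by auto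
  have pos: "h (int N + 1) = second_term (Suc N) * x1 (Suc N + k)" for N
    using odd_term_nat[OF valid_1, of "Suc N + k"] by (simp add: h_def second_term_def algebra_simps)
  then show "summable (\<lambda>N. second_term (Suc N) * x1 (Suc N + k))" using s(1) by simp
  \<comment> \<open>The middle index \<open>- (N + k)\<close> corresponds to
    \<open>b = Suc N + k\<close>, and the first index is \<open>- N\<close>, the reflection of
    \<open>Suc N\<close>.\<close>
  have neg: "h (- int (N + k)) = \<epsilon>1 * (x1 (Suc N) * reflected_second_term (Suc N + k))" for N
    using odd_term_reflect[OF valid_1, of "int (Suc N)"] odd_term_nat[OF valid_1, of "Suc N"]
    by (simp add: h_def reflected_second_term_def algebra_simps)
  have s': "summable (\<lambda>N. h (- int (N + k)))" by (rule summable_ignore_initial_segment[OF s(2)])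
  then have "summable (\<lambda>N. \<epsilon>1 * (\<epsilon>1 * (x1 (Suc N) * reflected_second_term (Suc N + k))))"
    unfolding neg by (rule summable_mult)
  moreover have "\<epsilon>1 * (\<epsilon>1 * t) = t" for t
    using reflection_sign_square[OF valid_1] by (metis mult.assoc mult_1)
  ultimately show s'': "summable (\<lambda>N. x1 (Suc N) * reflected_second_term (Suc N + k))"
    by (simp only:)
  have "middle_sum k = (\<Sum>N. h (int N + 1)) + (\<Sum>N. h (- int N))"
    unfolding middle_sum_def h_def[symmetric] by (rule suminf_add[OF s, symmetric])
  also have "(\<Sum>N. h (- int N)) = (\<Sum>N. h (- int (N + k))) + (\<Sum>N<k. h (- int N))"
    by (rule suminf_split_initial_segment[OF s(2)])
  also have "(\<Sum>N. h (- int (N + k))) = \<epsilon>1 * (\<Sum>N. x1 (Suc N) * reflected_second_term (Suc N + k))"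
    unfolding neg by (rule suminf_mult[OF s''])
  also have "(\<Sum>N<k. h (- int N)) = (\<Sum>b = 1..k. x1 (k + 1 - b) * reflected_second_term b)"
    unfolding sum_1_eq_lessThan
  proof (intro sum.cong refl)
    fix N assume "N \<in> {..<k}"
    then have "int (k + 1 - Suc N) = - int N + int k" by auto
    then have "X1 (- int N + int k) = x1 (k + 1 - Suc N)"
      using odd_term_nat[OF valid_1, of "k + 1 - Suc N"] by (simp only:)
    moreover have "1 - int (Suc N) = - int N" by simp
    ultimately show "h (- int N) = x1 (k + 1 - Suc N) * reflected_second_term (Suc N)"
      unfolding h_def reflected_second_term_def by (simp only: mult.assoc)
  qed
  finally show "middle_sum k = (\<Sum>N. second_term (Suc N) * x1 (Suc N + k))
      + (\<Sum>b = 1..k. x1 (k + 1 - b) * reflected_second_term b)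
      + \<epsilon>1 * (\<Sum>N. x1 (Suc N) * reflected_second_term (Suc N + k))"
    unfolding pos by simp
qed

text \<open>Summing over the gap \<open>k\<close> restores the nested sum with the first index
  outermost. The constant that \<open>full_tail_3\<close> adds to the positive third indices
  accounts for the term of depth two.\<close>

lemma positive_part_tendsto:
  "(\<lambda>K. \<Sum>k = 1..K. \<Sum>N. second_term (Suc N) * x1 (Suc N + k))
     \<longlonglongrightarrow> t_val [(m, \<sigma>1), (p, \<sigma>2), (q, \<sigma>3)] + \<epsilon>3 * t_reg * t_val [(m, \<sigma>1), (p, \<sigma>2)]"
proof -
  have bound: "\<bar>second_term n\<bar> \<le> (2 + \<bar>t_reg\<bar>) / sqrt (real n)" if n: "n \<ge> 1" for n
  proof -
    have "\<bar>partial_3 (n - 1) + \<epsilon>3 * t_reg\<bar> \<le> (2 + \<bar>t_reg\<bar>) * sqrt (real n)"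
    proof -
      have "2 * sqrt (real (n - 1)) \<le> 2 * sqrt (real n)" by simp
      moreover have "\<bar>t_reg\<bar> * 1 \<le> \<bar>t_reg\<bar> * sqrt (real n)" using n by (intro mult_left_mono) auto
      moreover have "\<bar>\<epsilon>3 * t_reg\<bar> = \<bar>t_reg\<bar>" by (simp add: abs_mult abs_reflection_sign[OF valid_3])
      moreover have "(2 + \<bar>t_reg\<bar>) * sqrt (real n) = 2 * sqrt (real n) + \<bar>t_reg\<bar> * sqrt (real n)"
        by (simp add: ring_distribs)
      ultimately show ?thesis using abs_partial_3_le[of "n - 1"] by linarith
    qed
    then show ?thesis unfolding second_term_eq[OF n]
      using abs_signed_term_le_inverse[OF denominators_odd_denom valid_2 n] by (intro mult_le_divide_sqrt[OF n])
  qed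
  have z: "(\<lambda>N. \<Sum>n = 1..N. x1 n) \<longlonglongrightarrow> t_val [(m, \<sigma>1)]"
    using t_tendsto_1[OF admissible_1] by (simp add: nested_sum_single[abs_def])
  obtain l where l: "(\<lambda>N. \<Sum>n = 1..N. x1 n * (\<Sum>k = 1..n - 1. second_term k)) \<longlonglongrightarrow> l"
    "(\<lambda>K. \<Sum>N. second_term (Suc N) * (\<Sum>i = 1..K. x1 (Suc N + i))) \<longlonglongrightarrow> l"
    using nested_sum_limits_signed_term[OF denominators_odd_denom admissible_1 bound z] by blast
  have inner: "(\<Sum>k = 1..n. second_term k) = nested_sum [x2, x3] n + \<epsilon>3 * t_reg * nested_sum [x2] n" for n
    by (induction n) (auto simp: second_term_eq partial_3_def algebra_simps)
  have "(\<Sum>n = 1..N. x1 n * (\<Sum>k = 1..n - 1. second_term k)) =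
      nested_sum [x1, x2, x3] N + \<epsilon>3 * t_reg * nested_sum [x1, x2] N" for N
    unfolding inner by (induction N) (auto simp: algebra_simps)
  moreover have "(\<lambda>N. nested_sum [x1, x2, x3] N + \<epsilon>3 * t_reg * nested_sum [x1, x2] N)
      \<longlonglongrightarrow> t_val [(m, \<sigma>1), (p, \<sigma>2), (q, \<sigma>3)] + \<epsilon>3 * t_reg * t_val [(m, \<sigma>1), (p, \<sigma>2)]"
    by (intro tendsto_intros t_tendsto_3 t_tendsto_2 admissible_1 valid_2 valid_3)
  ultimately have "l = t_val [(m, \<sigma>1), (p, \<sigma>2), (q, \<sigma>3)] + \<epsilon>3 * t_reg * t_val [(m, \<sigma>1), (p, \<sigma>2)]"
    using LIMSEQ_unique[OF l(1)] by simp
  moreover have "(\<Sum>k = 1..K. \<Sum>N. second_term (Suc N) * x1 (Suc N + k)) =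
      (\<Sum>N. second_term (Suc N) * (\<Sum>k = 1..K. x1 (Suc N + k)))" for K
    unfolding sum_distrib_left by (rule suminf_sum[symmetric]) (use middle_sum_split(1) in auto)
  ultimately show ?thesis using l(2) by simp
qed

text \<open>The sums for reflected variables. The reversed triple value itself need not exist, since
  the third index may be \<open>(1, 1)\<close>. Hence two cases: an admissible second index allows
  splitting the tail into convergent sums, while an admissible third index makes the reversed value
  meaningful.\<close>

lemma reflected_sum_tendsto:
  "\<exists>u\<in>values_ring. (\<lambda>N. \<Sum>n = 1..N. x2 n * (partial_3 n - t_reg)) \<longlonglongrightarrow> u"
  "\<exists>w\<in>values_ring. (\<lambda>N. \<Sum>n = 1..N. x2 n * (partial_3 n - t_reg) * nested_sum [x1] (n - 1))
     \<longlonglongrightarrow> w - t_val [(m, \<sigma>1), (p, \<sigma>2), (q, \<sigma>3)]"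
proof -
  let ?A = "(m, \<sigma>1)" and ?B = "(p, \<sigma>2)" and ?C = "(q, \<sigma>3)"
  have t_reg: "t_reg \<in> values_ring"
    using t_1_in_values_ring values_ring_intros(5)[of 0] by (auto simp: t_reg_def)
  have "(\<exists>u\<in>values_ring. (\<lambda>N. \<Sum>n = 1..N. x2 n * (partial_3 n - t_reg)) \<longlonglongrightarrow> u) \<and>
    (\<exists>w\<in>values_ring. (\<lambda>N. \<Sum>n = 1..N. x2 n * (partial_3 n - t_reg) * nested_sum [x1] (n - 1))
     \<longlonglongrightarrow> w - t_val [?A, ?B, ?C])"
  proof (cases "admissible_index ?B")
    case True
    have "(\<Sum>n = 1..N. x2 n * (partial_3 n - t_reg)) =
        nested_sum [x2, x3] N + nested_sum [\<lambda>n. x2 n * x3 n] N - t_reg * nested_sum [x2] N" for N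
      by (induction N) (auto simp: partial_3_def algebra_simps)
    moreover have "(\<lambda>N. nested_sum [x2, x3] N + nested_sum [\<lambda>n. x2 n * x3 n] N - t_reg * nested_sum [x2] N)
        \<longlonglongrightarrow> t_val [?B, ?C] + t_val [merge_index ?B ?C] - t_reg * t_val [?B]"
      unfolding signed_term_merge_fun
      by (intro tendsto_intros t_tendsto_1 t_tendsto_2 True valid_2 valid_3 admissible_merge_index)
    moreover have "t_val [?B, ?C] + t_val [merge_index ?B ?C] - t_reg * t_val [?B] \<in> values_ring"
      by (intro values_ring_intros(1-3) t_reg t_1_in_values_ring t_2_in_values_ring True valid_2 valid_3
          admissible_merge_index)
    ultimately have 1: "\<exists>u\<in>values_ring. (\<lambda>N. \<Sum>n = 1..N. x2 n * (partial_3 n - t_reg)) \<longlonglongrightarrow> u"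
      by auto
    have "(\<Sum>n = 1..N. x2 n * (partial_3 n - t_reg) * nested_sum [x1] (n - 1)) =
        nested_sum [x2, x3, x1] N + nested_sum [x2, x1, x3] N + nested_sum [x2, \<lambda>n. x1 n * x3 n] N
        + nested_sum [\<lambda>n. x2 n * x3 n, x1] N - t_reg * nested_sum [x2, x1] N" for N
    proof (induction N)
      case (Suc N)
      have "x2 (Suc N) * (nested_sum [x1] N * nested_sum [x3] N) = x2 (Suc N) *
          (nested_sum [x1, x3] N + nested_sum [x3, x1] N + nested_sum [\<lambda>n. x1 n * x3 n] N)"
        by (simp only: stuffle_1_1)
      then show ?case using Suc by (simp add: partial_3_def algebra_simps)
    qed simp
    \<comment> \<open>Multiplying \<open>[x1]\<close> by \<open>[x2, x3]\<close> replaces the triple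
      sums starting with \<open>x2\<close> by minus \<open>[x1, x2, x3]\<close>, up to products and
      lower depth.\<close>
    then have "(\<Sum>n = 1..N. x2 n * (partial_3 n - t_reg) * nested_sum [x1] (n - 1)) =
        nested_sum [x1] N * nested_sum [x2, x3] N - nested_sum [\<lambda>n. x1 n * x2 n, x3] N
        + nested_sum [\<lambda>n. x2 n * x3 n, x1] N - t_reg * nested_sum [x2, x1] N - nested_sum [x1, x2, x3] N" for N
      using stuffle_1_2[of x1 N x2 x3] by simp
    moreover have "(\<lambda>N. nested_sum [x1] N * nested_sum [x2, x3] N - nested_sum [\<lambda>n. x1 n * x2 n, x3] N
        + nested_sum [\<lambda>n. x2 n * x3 n, x1] N - t_reg * nested_sum [x2, x1] N - nested_sum [x1, x2, x3] N)
        \<longlonglongrightarrow> t_val [?A] * t_val [?B, ?C] - t_val [merge_index ?A ?B, ?C]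
          + t_val [merge_index ?B ?C, ?A] - t_reg * t_val [?B, ?A] - t_val [?A, ?B, ?C]"
      unfolding signed_term_merge_fun
      by (intro tendsto_intros t_tendsto_1 t_tendsto_2 t_tendsto_3 True admissible_1 valid_1 valid_2 valid_3
          admissible_merge_index)
    moreover have "t_val [?A] * t_val [?B, ?C] - t_val [merge_index ?A ?B, ?C]
          + t_val [merge_index ?B ?C, ?A] - t_reg * t_val [?B, ?A] \<in> values_ring"
      by (intro values_ring_intros(1-3) t_reg t_1_in_values_ring t_2_in_values_ring True admissible_1
          valid_1 valid_2 valid_3 admissible_merge_index)
    ultimately show ?thesis using 1 by auto
  next
    case False
    then have adm: "admissible_index ?C" using admissible_2_or_3 by blast
    have z: "(\<lambda>N. \<Sum>n = 1..N. x3 n) \<longlonglongrightarrow> t_reg"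
      using t_tendsto_1[OF adm] adm by (simp add: t_reg_def nested_sum_single[abs_def])
    have bound1: "\<bar>x2 n\<bar> \<le> 1 / sqrt (real n)" if "n \<ge> 1" for n
      using abs_signed_term_le_inverse[OF denominators_odd_denom valid_2 that]
        divide_self_le_divide_sqrt[OF that, of 1] by linarith
    obtain l where l: "(\<lambda>N. \<Sum>n = 1..N. x3 n * (\<Sum>k = 1..n - 1. x2 k)) \<longlonglongrightarrow> l"
      "(\<lambda>K. \<Sum>k = 1..K. x2 k * (t_reg - (\<Sum>n = 1..k. x3 n))) \<longlonglongrightarrow> l"
      using nested_sum_limits_signed_term[OF denominators_odd_denom adm bound1 z] by blast
    have "nested_sum [x3, x2] = (\<lambda>N. \<Sum>n = 1..N. x3 n * (\<Sum>k = 1..n - 1. x2 k))"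
      unfolding nested_sum_Cons[of x3, abs_def] nested_sum_single ..
    then have "l = t_val [?C, ?B]"
      using LIMSEQ_unique[OF l(1)] t_tendsto_2[OF adm valid_2] by metis
    then have "(\<lambda>K. - (\<Sum>k = 1..K. x2 k * (t_reg - partial_3 k))) \<longlonglongrightarrow> - t_val [?C, ?B]"
      using l(2) by (intro tendsto_minus) (simp add: partial_3_def nested_sum_single)
    then have "(\<lambda>N. \<Sum>n = 1..N. x2 n * (partial_3 n - t_reg)) \<longlonglongrightarrow> - t_val [?C, ?B]"
      by (simp add: algebra_simps flip: sum_negf)
    moreover have "- t_val [?C, ?B] \<in> values_ring"
      by (intro values_ring_intros(4) t_2_in_values_ring adm valid_2)
    ultimately have 1: "\<exists>u\<in>values_ring. (\<lambda>N. \<Sum>n = 1..N. x2 n * (partial_3 n - t_reg)) \<longlonglongrightarrow> u"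
      by auto
    have bound2: "\<bar>x2 n * nested_sum [x1] (n - 1)\<bar> \<le> 2 / sqrt (real n)" if n: "n \<ge> 1" for n
    proof -
      have "\<bar>nested_sum [x1] (n - 1)\<bar> \<le> 2 * sqrt (real n)"
        using abs_nested_sum_single_le[OF denominators_odd_denom valid_1, of "n - 1"]
        by (rule order_trans) auto
      then show ?thesis using abs_signed_term_le_inverse[OF denominators_odd_denom valid_2 n]
        by (intro mult_le_divide_sqrt[OF n])
    qed
    obtain l' where l': "(\<lambda>N. \<Sum>n = 1..N. x3 n * (\<Sum>k = 1..n - 1. x2 k * nested_sum [x1] (k - 1))) \<longlonglongrightarrow> l'"
      "(\<lambda>K. \<Sum>k = 1..K. x2 k * nested_sum [x1] (k - 1) * (t_reg - (\<Sum>n = 1..k. x3 n))) \<longlonglongrightarrow> l'"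
      using nested_sum_limits_signed_term[OF denominators_odd_denom adm bound2 z] by blast
    \<comment> \<open>The tail form represents minus the reversed triple sum, which the reversal
      identity then expresses by the original one.\<close>
    have "nested_sum [x3, x2, x1] = (\<lambda>N. \<Sum>n = 1..N. x3 n * (\<Sum>k = 1..n - 1. x2 k * nested_sum [x1] (k - 1)))"
      unfolding nested_sum_Cons[of x3, abs_def] nested_sum_Cons[of x2] ..
    then have lim: "nested_sum [x3, x2, x1] \<longlonglongrightarrow> l'" using l'(1) by simp
    have "(\<lambda>N. nested_sum [x1, x2, x3] N - nested_sum [x1, x2] N * nested_sum [x3] N
        + nested_sum [x1] N * nested_sum [x3, x2] N + nested_sum [x1, \<lambda>n. x2 n * x3 n] N
        - nested_sum [x3, \<lambda>n. x1 n * x2 n] N)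
        \<longlonglongrightarrow> t_val [?A, ?B, ?C] - t_val [?A, ?B] * t_val [?C] + t_val [?A] * t_val [?C, ?B]
          + t_val [?A, merge_index ?B ?C] - t_val [?C, merge_index ?A ?B]"
      unfolding signed_term_merge_fun
      by (intro tendsto_intros t_tendsto_1 t_tendsto_2 t_tendsto_3 adm admissible_1 valid_1 valid_2 valid_3
          admissible_merge_index admissible_indexD)
    then have l'_eq: "l' = t_val [?A, ?B, ?C] - t_val [?A, ?B] * t_val [?C] + t_val [?A] * t_val [?C, ?B]
          + t_val [?A, merge_index ?B ?C] - t_val [?C, merge_index ?A ?B]"
      unfolding nested_sum_reversal[symmetric] by (rule LIMSEQ_unique[OF lim])
    define w where "w = t_val [?A, ?B] * t_val [?C] - t_val [?A] * t_val [?C, ?B]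
          - t_val [?A, merge_index ?B ?C] + t_val [?C, merge_index ?A ?B]"
    have "w \<in> values_ring"
      unfolding w_def
      by (intro values_ring_intros(1-3) t_1_in_values_ring t_2_in_values_ring adm admissible_1
          valid_1 valid_2 valid_3 admissible_merge_index admissible_indexD)
    moreover have "(\<lambda>K. - (\<Sum>k = 1..K. x2 k * nested_sum [x1] (k - 1) * (t_reg - partial_3 k))) \<longlonglongrightarrow> - l'"
      using l'(2) by (intro tendsto_minus) (simp add: partial_3_def nested_sum_single)
    then have "(\<lambda>N. \<Sum>n = 1..N. x2 n * (partial_3 n - t_reg) * nested_sum [x1] (n - 1))
       \<longlonglongrightarrow> w - t_val [?A, ?B, ?C]"
      unfolding l'_eq w_def by (simp add: algebra_simps flip: sum_negf)
    ultimately show ?thesis using 1 by blast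
  qed
  then show "\<exists>u\<in>values_ring. (\<lambda>N. \<Sum>n = 1..N. x2 n * (partial_3 n - t_reg)) \<longlonglongrightarrow> u"
    "\<exists>w\<in>values_ring. (\<lambda>N. \<Sum>n = 1..N. x2 n * (partial_3 n - t_reg) * nested_sum [x1] (n - 1))
     \<longlonglongrightarrow> w - t_val [?A, ?B, ?C]"
    by blast+
qed

lemma LIMSEQ_const_over_sqrt_Suc: "(\<lambda>i. C / sqrt (real (Suc i))) \<longlonglongrightarrow> 0"
  by real_asymp

text \<open>The outer series \<open>reflected_second_term\<close> converges only conditionally, with
  block sums of order \<open>1 / sqrt n\<close>; the factor \<open>1 / n\<close> from
  \<open>x1\<close> restores domination. The signs combine to
  \<open>- (\<epsilon>1 * \<epsilon>1)\<close>, that is -1.\<close>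

lemma negative_part_tendsto:
  assumes "(\<lambda>N. \<Sum>n = 1..N. x2 n * (partial_3 n - t_reg)) \<longlonglongrightarrow> u"
    and "(\<lambda>N. \<Sum>n = 1..N. x2 n * (partial_3 n - t_reg) * nested_sum [x1] (n - 1)) \<longlonglongrightarrow> v"
  shows "(\<lambda>K. \<Sum>k = 1..K. \<epsilon>1 * (\<Sum>N. x1 (Suc N) * reflected_second_term (Suc N + k))) \<longlonglongrightarrow> - v"
proof -
  have z: "(\<lambda>N. \<Sum>n = 1..N. reflected_second_term n) \<longlonglongrightarrow> - \<epsilon>1 * u"
    unfolding reflected_second_term_eq sum_distrib_left[symmetric] by (intro tendsto_mult tendsto_const assms)
  have "\<bar>\<bar>x1 (Suc k)\<bar> * (8 / sqrt (real (Suc (Suc k))))\<bar> \<le> 8 / (real (Suc k) * sqrt (real (Suc k)))" for k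
  proof -
    have "\<bar>x1 (Suc k)\<bar> * (8 / sqrt (real (Suc (Suc k)))) \<le> 1 / real (Suc k) * (8 / sqrt (real (Suc k)))"
      using abs_signed_term_le_inverse[OF denominators_odd_denom valid_1, of "Suc k"]
      by (intro mult_mono divide_left_mono) auto
    then show ?thesis by (simp add: abs_mult)
  qed
  then have "summable (\<lambda>k. \<bar>x1 (Suc k)\<bar> * (8 / sqrt (real (Suc (Suc k)))))"
    by (rule summable_inverse_three_halves_bound(1))
  from nested_sum_limits[OF reflected_second_term_interval_sum LIMSEQ_const_over_sqrt_Suc this z]
  obtain l where l: "(\<lambda>N. \<Sum>n = 1..N. reflected_second_term n * (\<Sum>k = 1..n - 1. x1 k)) \<longlonglongrightarrow> l"
    "(\<lambda>K. \<Sum>N. x1 (Suc N) * (\<Sum>i = 1..K. reflected_second_term (Suc N + i))) \<longlonglongrightarrow> l"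
    by blast
  have "(\<Sum>n = 1..N. reflected_second_term n * (\<Sum>k = 1..n - 1. x1 k)) =
      - \<epsilon>1 * (\<Sum>n = 1..N. x2 n * (partial_3 n - t_reg) * nested_sum [x1] (n - 1))" for N
    unfolding sum_distrib_left nested_sum_single reflected_second_term_eq
    by (intro sum.cong refl) simp
  then have l_eq: "l = - \<epsilon>1 * v"
    using LIMSEQ_unique[OF l(1)] tendsto_mult[OF tendsto_const[of "- \<epsilon>1"] assms(2)] by simp
  have "\<epsilon>1 * l = - (\<epsilon>1 * \<epsilon>1) * v" unfolding l_eq by simp
  then have "\<epsilon>1 * l = - v" by (simp add: reflection_sign_square[OF valid_1])
  moreover have "(\<Sum>k = 1..K. \<epsilon>1 * (\<Sum>N. x1 (Suc N) * reflected_second_term (Suc N + k))) =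
      \<epsilon>1 * (\<Sum>N. x1 (Suc N) * (\<Sum>k = 1..K. reflected_second_term (Suc N + k)))" for K
    unfolding sum_distrib_left[where r = "x1 _"] sum_distrib_left[symmetric, where r = \<epsilon>1]
    by (rule arg_cong[where f = "\<lambda>y. \<epsilon>1 * y"], rule suminf_sum[symmetric])
       (use middle_sum_split(2) in auto)
  ultimately show ?thesis
    using tendsto_mult[OF tendsto_const[of \<epsilon>1] l(2)] by simp
qed

text \<open>With positive first index \<open>a\<close> and middle index \<open>1 - b\<close>, the
  gap \<open>k\<close> is \<open>a + b - 1\<close>, so summing over \<open>k\<close> is a Cauchy
  product. Mertens' theorem is applied with whichever factor converges absolutely.\<close>

lemma mixed_part_tendsto:
  assumes "(\<lambda>N. \<Sum>n = 1..N. x2 n * (partial_3 n - t_reg)) \<longlonglongrightarrow> u"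
  shows "(\<lambda>K. \<Sum>k = 1..K. \<Sum>b = 1..k. x1 (k + 1 - b) * reflected_second_term b)
     \<longlonglongrightarrow> - \<epsilon>1 * t_val [(m, \<sigma>1)] * u"
proof -
  have y: "(\<lambda>N. \<Sum>n = 1..N. reflected_second_term n) \<longlonglongrightarrow> - \<epsilon>1 * u"
    unfolding reflected_second_term_eq sum_distrib_left[symmetric] by (intro tendsto_mult tendsto_const assms)
  have x: "(\<lambda>N. \<Sum>n = 1..N. x1 n) \<longlonglongrightarrow> t_val [(m, \<sigma>1)]"
    using t_tendsto_1[OF admissible_1] by (simp add: nested_sum_single[abs_def])
  show ?thesis using absolutely_summable_factor
  proof
    assume "summable (\<lambda>a. \<bar>x1 (Suc a)\<bar>)"
    from mertens_partial_sums[OF this y x] show ?thesis by (simp add: mult_ac)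
  next
    assume "summable (\<lambda>a. \<bar>reflected_second_term (Suc a)\<bar>)"
    from mertens_partial_sums[OF this x y]
    have "(\<lambda>K. \<Sum>k = 1..K. \<Sum>b = 1..k. reflected_second_term (k + 1 - b) * x1 b)
        \<longlonglongrightarrow> - \<epsilon>1 * t_val [(m, \<sigma>1)] * u" by (simp add: mult_ac)
    moreover have "(\<Sum>b = 1..k. reflected_second_term (k + 1 - b) * x1 b) =
        (\<Sum>b = 1..k. x1 (k + 1 - b) * reflected_second_term b)" for k
      by (rule sum.reindex_bij_witness[of _ "\<lambda>b. k + 1 - b" "\<lambda>b. k + 1 - b"]) (auto simp: mult.commute)
    ultimately show ?thesis by simp
  qed
qed

lemma reflection_sign_in_values_ring: "reflection_sign x \<in> values_ring"
  by (cases x) (auto simp: reflection_sign.simps intro!: values_ring_intros(5))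

lemma t_3_in_values_ring: "t_val [(m, \<sigma>1), (p, \<sigma>2), (q, \<sigma>3)] \<in> values_ring"
proof -
  let ?A = "(m, \<sigma>1)" and ?B = "(p, \<sigma>2)" and ?C = "(q, \<sigma>3)"
  obtain v where v: "v \<in> values_ring" "(\<lambda>K. \<Sum>k = 1..K. middle_sum k) \<longlonglongrightarrow> v"
    using middle_sum_total by blast
  obtain u where u: "u \<in> values_ring" "(\<lambda>N. \<Sum>n = 1..N. x2 n * (partial_3 n - t_reg)) \<longlonglongrightarrow> u"
    using reflected_sum_tendsto(1) by blast
  obtain w where w: "w \<in> values_ring"
    "(\<lambda>N. \<Sum>n = 1..N. x2 n * (partial_3 n - t_reg) * nested_sum [x1] (n - 1)) \<longlonglongrightarrow> w - t_val [?A, ?B, ?C]"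
    using reflected_sum_tendsto(2) by blast
  have t_reg: "t_reg \<in> values_ring"
    using t_1_in_values_ring values_ring_intros(5)[of 0] by (auto simp: t_reg_def)
  have "(\<Sum>k = 1..K. middle_sum k) = (\<Sum>k = 1..K. \<Sum>N. second_term (Suc N) * x1 (Suc N + k))
      + (\<Sum>k = 1..K. \<Sum>b = 1..k. x1 (k + 1 - b) * reflected_second_term b)
      + (\<Sum>k = 1..K. \<epsilon>1 * (\<Sum>N. x1 (Suc N) * reflected_second_term (Suc N + k)))" for K
    unfolding sum.distrib[symmetric] by (intro sum.cong refl middle_sum_split(3)) auto
  then have "(\<lambda>K. \<Sum>k = 1..K. middle_sum k) \<longlonglongrightarrow>
      (t_val [?A, ?B, ?C] + \<epsilon>3 * t_reg * t_val [?A, ?B]) + (- \<epsilon>1 * t_val [?A] * u) + - (w - t_val [?A, ?B, ?C])"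
    using tendsto_add[OF tendsto_add[OF positive_part_tendsto mixed_part_tendsto[OF u(2)]]
        negative_part_tendsto[OF u(2) w(2)]] by simp
  \<comment> \<open>The triple value enters with coefficient +1 from the positive part and again
    from the negative part, so it can be solved for.\<close>
  from LIMSEQ_unique[OF v(2) this]
  have "t_val [?A, ?B, ?C] = 1 / 2 * (v - \<epsilon>3 * t_reg * t_val [?A, ?B] + \<epsilon>1 * t_val [?A] * u + w)"
    by simp
  also have "\<dots> \<in> values_ring"
    by (rule values_ring_intros(2), rule values_ring_intros(5), simp)
       (intro values_ring_intros(1-3) v u w t_reg reflection_sign_in_values_ring t_1_in_values_ring
         t_2_in_values_ring admissible_1 valid_2)
  finally show ?thesis .
qed

end

theorem theorem4p4:
  fixes m p q :: nat and \<sigma>1 \<sigma>2 \<sigma>3 :: int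
  assumes "m \<ge> 1" "p \<ge> 1" "q \<ge> 1"
    and "\<sigma>1 \<in> {1, -1}" "\<sigma>2 \<in> {1, -1}" "\<sigma>3 \<in> {1, -1}"
    and "(m, \<sigma>1) \<noteq> (1, 1)"
    and "(p, \<sigma>2) \<noteq> (1, 1) \<or> (q, \<sigma>3) \<noteq> (1, 1)"
    and "even (m + p + q) \<longleftrightarrow> even ((1 - \<sigma>1 * \<sigma>2 * \<sigma>3) div 2)"
  shows "t_val [(m, \<sigma>1), (p, \<sigma>2), (q, \<sigma>3)]
           \<in> rat_polynomials_in (zeta_values 1 \<union> beta_values \<union> zeta_values 2 \<union> t_values 2)
       \<and> t_tilde_val [(m, \<sigma>1), (p, \<sigma>2), (q, \<sigma>3)]
           \<in> rat_polynomials_in (zeta_values 1 \<union> beta_values \<union> zeta_values 2 \<union> t_values 2)"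
proof -
  have "reflection_sign (m, \<sigma>1) * reflection_sign (p, \<sigma>2) * reflection_sign (q, \<sigma>3) =
      of_int (\<sigma>1 * \<sigma>2 * \<sigma>3) * (-1) ^ (m + p + q)"
    by (simp add: power_add)
  \<comment> \<open>The product of the signs is \<open>(-1)\<close> to the power
    \<open>(1 - \<sigma>1 * \<sigma>2 * \<sigma>3) div 2\<close>, and this exponent has the parity
    of the weight.\<close>
  also have "\<dots> = 1"
    using assms(4-6,9) by (cases "even (m + p + q)") (auto simp del: even_add)
  finally interpret parity_triple m p q \<sigma>1 \<sigma>2 \<sigma>3
    using assms by unfold_locales (auto simp: admissible_index_def valid_index_def)
  have "t_tilde_val [(m, \<sigma>1), (p, \<sigma>2), (q, \<sigma>3)] \<in> values_ring"
    unfolding t_tilde_val_def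
    by (rule values_ring_intros(2)[OF values_ring_intros(5) t_3_in_values_ring]) simp
  then show ?thesis using t_3_in_values_ring unfolding values_ring_def by blast
qed

end
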